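(* Let $K$ be a number field with $s$ real embeddings and $t$ pairs of complex embeddings, and let $\psi_\rho:I_K\to\mathbb{R}_{\ge0}$ ($\rho\in\Sigma$) be functions, with $\Psi(\mathfrak{n})=\prod_{\rho\text{ real}}\psi_\rho(\mathfrak{n})\prod_{\rho\text{ complex}}\psi_\rho(\mathfrak{n})^2$. Suppose that $\Psi(\mathfrak{n})\to 0$ as $\mathrm{Nm}(\mathfrak{n})\to\infty$. Then the set $\mathcal{A}'(\underline{\psi})$ has Lebesgue measure $0$ or $\lambda(D_K)$.
   Context: $\mathcal{O}_K$ is the ring of integers of $K$ and $I_K$ the set of nonzero integral ideals; $\mathrm{Nm}(\mathfrak{n})=\#(\mathcal{O}_K/\mathfrak{n})$. $\Sigma=\{\sigma_1,\dots,\sigma_s,\tau_1,\dots,\tau_t\}$ consists of the real embeddings and one embedding from each complex-conjugate pair. For real $\rho$, $|\cdot|_\rho$ is the usual absolute value; for complex $\rho$, $|\cdot|_\rho$ is the square of the usual complex absolute value. $\iota:K\to\mathbb{R}^s\times\mathbb{C}^t$, $\iota(\alpha)=(\rho(\alpha))_{\rho\in\Sigma}$; $D_K$ is a fixed fundamental domain of the lattice $\iota(\mathcal{O}_K)$, and $\lambda$ is Lebesgue measure on $\mathbb{R}^s\times\mathbb{C}^t\cong\mathbb{R}^{s+2t}$. For $\gamma\in K^\times$, writing $(\gamma)=\mathfrak{a}/\mathfrak{n}$ with coprime $\mathfrak{a},\mathfrak{n}\in I_K$, set $\mathrm{dnm}(\gamma)=\mathfrak{n}$. $\gamma\in K$ is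 a $\underline{\psi}$-good approximation to $\mathbf{x}=(x_\rho)$ if $|x_\rho-\rho(\gamma)|_\rho\le\psi_\rho(\mathrm{dnm}(\gamma))$ for all $\rho\in\Sigma$; $\mathcal{A}'(\underline{\psi})$ is the set of $\mathbf{x}\in D_K$ having infinitely many $\underline{\psi}$-good approximations $\gamma\in K$. *)

theory Defs
  imports
    "HOL-Analysis.Analysis"
    "HOL-Library.Going_To_Filter"
    "HOL-Algebra.Ideal_Product"
    "HOL-Algebra.QuotRing"
begin

text \<open>
  A number field is a type of class \<^class>\<open>field_char_0\<close> that is a finite-dimensional
  vector space over the rationals.
\<close>

definition number_field :: "'k::field_char_0 itself \<Rightarrow> bool" where
  "number_field _ \<longleftrightarrow>
     (\<exists>B :: 'k set. finite_dimensional_vector_space (\<lambda>q x. of_rat q * x) B)"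

definition field_ring :: "'k::field_char_0 ring" where
  "field_ring = \<lparr>carrier = UNIV, mult = (*), one = 1, zero = 0, add = (+)\<rparr>"

definition ring_of_integers :: "'k::field_char_0 ring" where
  "ring_of_integers = field_ring\<lparr>carrier := {x. algebraic_int x}\<rparr>"

definition integral_ideals :: "'k::field_char_0 set set" where
  "integral_ideals = {I. ideal I ring_of_integers \<and> I \<noteq> {0}}"

definition ideal_norm :: "'k::field_char_0 set \<Rightarrow> nat" where
  "ideal_norm I = card (carrier (ring_of_integers Quot I))"

definition coprime_ideals :: "'k::field_char_0 set \<Rightarrow> 'k set \<Rightarrow> bool" where
  "coprime_ideals I J \<longleftrightarrow>
     I <+>\<^bsub>ring_of_integers\<^esub> J = carrier (ring_of_integers :: 'k ring)"

definition principal_frac_ideal :: "'k::field_char_0 \<Rightarrow> 'k set" where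
  "principal_frac_ideal \<gamma> = (\<lambda>x. \<gamma> * x) ` carrier ring_of_integers"

text \<open>
  In the group of fractional ideals, \<open>(\<gamma>) = \<aa>/\<nn>\<close> means \<open>(\<gamma>)\<nn> = \<aa>\<close>; the product of
  fractional ideals is formed inside \<open>K\<close>.  For \<open>\<gamma> = 0\<close> the convention is \<open>dnm 0 = \<O>\<^sub>K\<close>
  (from \<open>0 = 0/1\<close>); it is immaterial below, where only infinite sets of \<open>\<gamma>\<close> matter.
\<close>

definition dnm :: "'k::field_char_0 \<Rightarrow> 'k set" where
  "dnm \<gamma> =
     (if \<gamma> = 0 then carrier ring_of_integers
      else THE \<nn>. \<nn> \<in> integral_ideals \<and>
             (\<exists>\<aa>\<in>integral_ideals. coprime_ideals \<aa> \<nn> \<and>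
                ideal_prod field_ring (principal_frac_ideal \<gamma>) \<nn> = \<aa>))"

definition embeddings :: "('k::field_char_0 \<Rightarrow> complex) set" where
  "embeddings = {\<rho>. \<rho> 1 = 1 \<and> (\<forall>x y. \<rho> (x + y) = \<rho> x + \<rho> y) \<and> (\<forall>x y. \<rho> (x * y) = \<rho> x * \<rho> y)}"

definition real_embedding :: "('k::field_char_0 \<Rightarrow> complex) \<Rightarrow> bool" where
  "real_embedding \<rho> \<longleftrightarrow> range \<rho> \<subseteq> \<real>"

text \<open>
  The real embeddings together with one embedding out of each complex-conjugate pair.
  A real embedding equals its own conjugate, so the condition forces it to belong to \<open>S\<close>.
\<close>

definition place_reps :: "('k::field_char_0 \<Rightarrow> complex) set \<Rightarrow> bool" where
  "place_reps S \<longleftrightarrow>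
     S \<subseteq> embeddings \<and> (\<forall>\<sigma>\<in>embeddings. \<exists>!\<rho>. \<rho> \<in> S \<and> (\<rho> = \<sigma> \<or> \<rho> = cnj \<circ> \<sigma>))"

definition real_places :: "('k::field_char_0 \<Rightarrow> complex) set \<Rightarrow> ('k \<Rightarrow> complex) set" where
  "real_places S = {\<rho>\<in>S. real_embedding \<rho>}"

definition complex_places :: "('k::field_char_0 \<Rightarrow> complex) set \<Rightarrow> ('k \<Rightarrow> complex) set" where
  "complex_places S = {\<rho>\<in>S. \<not> real_embedding \<rho>}"

text \<open>
  \<open>\<real>\<^sup>s \<times> \<complex>\<^sup>t\<close> is modelled with the real and the complex places in \<open>S\<close> as index sets: a point is
  a pair of an extensional real-valued function on the former and an extensional
  complex-valued function on the latter.  Lebesgue measure is the completed product of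
  the Lebesgue measures of the factors (two-dimensional on each copy of \<open>\<complex>\<close>).
\<close>

type_synonym 'k point = "(('k \<Rightarrow> complex) \<Rightarrow> real) \<times> (('k \<Rightarrow> complex) \<Rightarrow> complex)"

definition minkowski_lebesgue :: "('k::field_char_0 \<Rightarrow> complex) set \<Rightarrow> 'k point measure" where
  "minkowski_lebesgue S =
     completion (PiM (real_places S) (\<lambda>_. lborel) \<Otimes>\<^sub>M PiM (complex_places S) (\<lambda>_. lborel))"

definition minkowski_emb :: "('k::field_char_0 \<Rightarrow> complex) set \<Rightarrow> 'k \<Rightarrow> 'k point" where
  "minkowski_emb S \<alpha> = (\<lambda>\<rho>\<in>real_places S. Re (\<rho> \<alpha>), \<lambda>\<rho>\<in>complex_places S. \<rho> \<alpha>)"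

definition point_add ::
    "('k::field_char_0 \<Rightarrow> complex) set \<Rightarrow> 'k point \<Rightarrow> 'k point \<Rightarrow> 'k point" where
  "point_add S x y =
     (\<lambda>\<rho>\<in>real_places S. fst x \<rho> + fst y \<rho>, \<lambda>\<rho>\<in>complex_places S. snd x \<rho> + snd y \<rho>)"

definition point_coord :: "'k::field_char_0 point \<Rightarrow> ('k \<Rightarrow> complex) \<Rightarrow> complex" where
  "point_coord x \<rho> = (if real_embedding \<rho> then complex_of_real (fst x \<rho>) else snd x \<rho>)"

text \<open>
  Fundamental domain of the lattice \<open>\<iota>(\<O>\<^sub>K)\<close>, up to null sets: this covers exact systems of
  coset representatives as well as closed fundamental parallelepipeds.
\<close>

definition fundamental_domain ::
    "('k::field_char_0 \<Rightarrow> complex) set \<Rightarrow> 'k point set \<Rightarrow> bool" where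
  "fundamental_domain S D \<longleftrightarrow>
     D \<in> sets (minkowski_lebesgue S) \<and>
     (AE x in minkowski_lebesgue S.
        \<exists>\<alpha>\<in>carrier ring_of_integers. x \<in> point_add S (minkowski_emb S \<alpha>) ` D) \<and>
     (\<forall>\<alpha>\<in>carrier ring_of_integers. \<forall>\<beta>\<in>carrier ring_of_integers. \<alpha> \<noteq> \<beta> \<longrightarrow>
        point_add S (minkowski_emb S \<alpha>) ` D \<inter> point_add S (minkowski_emb S \<beta>) ` D
          \<in> null_sets (minkowski_lebesgue S))"

definition place_abs :: "('k::field_char_0 \<Rightarrow> complex) \<Rightarrow> complex \<Rightarrow> real" where
  "place_abs \<rho> z = (if real_embedding \<rho> then cmod z else (cmod z)\<^sup>2)"

definition good_approximation ::
    "('k::field_char_0 \<Rightarrow> complex) set \<Rightarrow> (('k \<Rightarrow> complex) \<Rightarrow> 'k set \<Rightarrow> real) \<Rightarrow>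
     'k point \<Rightarrow> 'k \<Rightarrow> bool" where
  "good_approximation S \<psi> x \<gamma> \<longleftrightarrow>
     (\<forall>\<rho>\<in>S. place_abs \<rho> (point_coord x \<rho> - \<rho> \<gamma>) \<le> \<psi> \<rho> (dnm \<gamma>))"

definition approximable_set ::
    "('k::field_char_0 \<Rightarrow> complex) set \<Rightarrow> (('k \<Rightarrow> complex) \<Rightarrow> 'k set \<Rightarrow> real) \<Rightarrow>
     'k point set \<Rightarrow> 'k point set" where
  "approximable_set S \<psi> D = {x\<in>D. infinite {\<gamma>. good_approximation S \<psi> x \<gamma>}}"

text \<open>
  The complex factors are squared although \<^const>\<open>place_abs\<close> is already the squared modulus.
\<close>

definition psi_prod ::
    "('k::field_char_0 \<Rightarrow> complex) set \<Rightarrow> (('k \<Rightarrow> complex) \<Rightarrow> 'k set \<Rightarrow> real) \<Rightarrow>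
     'k set \<Rightarrow> real" where
  "psi_prod S \<psi> \<nn> = (\<Prod>\<rho>\<in>real_places S. \<psi> \<rho> \<nn>) * (\<Prod>\<rho>\<in>complex_places S. (\<psi> \<rho> \<nn>)\<^sup>2)"

end

theory Submission
  imports Defs "Jordan_Normal_Form.Char_Poly"
begin

text \<open>
  The proof follows Gallagher.  Lift the set to an \<open>\<O>\<^sub>K\<close>-periodic limsup set of boxes
  centred at the points of \<open>K\<close>.  Since the product of the radii tends to \<open>0\<close>, so does their
  minimum, and it suffices to treat the denominators whose smallest radius occurs at a fixed
  place \<open>\<rho>\<^sub>0\<close>.  The radii at the other places may stay large, so nothing may be enlarged
  there: choose a nonunit \<open>a \<in> \<O>\<^sub>K\<close> with \<open>\<bar>\<rho>(a)\<bar> \<le> 1\<close> for all \<open>\<rho> \<noteq> \<rho>\<^sub>0\<close>.  Multiplication by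
  \<open>a\<close> enlarges the boxes at \<open>\<rho>\<^sub>0\<close> only, which by Cassels' lemma on lines does not change the
  measure of a limsup set.

  For \<open>\<gamma>\<close> with denominator prime to \<open>a\<close> (up to finitely many shifts) multiplication by \<open>a\<close>
  preserves the denominator, so the limsup set is mapped into itself; a density argument makes
  it invariant under \<open>a\<^sup>-\<^sup>k \<O>\<^sub>K\<close> for every \<open>k\<close>.  For \<open>\<gamma>\<close> whose denominator is divisible by
  arbitrarily high powers of a prime over \<open>a\<close>, the limsup set is invariant under translations with
  denominators supported at that prime.  In both cases the translations are dense, and a
  measurable set invariant under a dense group of translations is null or conull.
\<close>

section \<open>Algebraic integers form a ring\<close>

text \<open>The two kinds of approximants are combined by a dichotomy, not by a partition. For each
  \<open>M\<close>, finitely many shifted coprime classes together with the classes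
  \<open>den (a ^ M * g) \<subseteq> q\<close>, one for each maximal ideal \<open>q\<close> over
  \<open>a\<close>, exhaust the approximants. The coprime classes obey the zero-one law for each
  single \<open>M\<close>. A class at \<open>q\<close> is shown invariant only under the
  translations of level at most \<open>M\<close>, so its law is proved for the decreasing
  intersection over all \<open>M\<close>. Hence either some coprime class is conull, or all of them
  are null and only the intersections remain.

  The ideal theory rests on \<open>den g\<close>, the multipliers that make \<open>g\<close>
  integral, on the comaximality of \<open>den g\<close> and \<open>g * den g\<close>, and on the
  finiteness of the set of ideals containing a given nonzero integer. In the geometry of numbers,
  cocompactness of the integers comes from weak approximation, and their discreteness is extracted
  from the existence of the fundamental domain.

  Completions at real places are embedded in the complex plane, so that a point is one
  complex-valued function on \<open>S\<close>; translation invariance then holds along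
  \<open>W\<close>, a set of full measure.\<close>

definition int_span :: "'k::field_char_0 set \<Rightarrow> 'k set" where
  "int_span B = range (\<lambda>c. \<Sum>b\<in>B. of_int (c b) * b)"

lemma int_spanI: "x = (\<Sum>b\<in>B. of_int (c b) * b) \<Longrightarrow> x \<in> int_span B"
  unfolding int_span_def by blast

lemma int_span_base:
  assumes "finite B" "b \<in> B"
  shows "b \<in> int_span B"
proof -
  have "b = (\<Sum>x\<in>B. of_int (if x = b then 1 else 0) * x)"
    using assms by (subst sum.remove[of B b]) (auto intro!: sum.neutral)
  thus ?thesis by (rule int_spanI)
qed

lemma int_span_0: "0 \<in> int_span B"
proof -
  have "0 = (\<Sum>b\<in>B. of_int 0 * b)" by simp
  thus ?thesis by (rule int_spanI)
qed

lemma int_span_add: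
  assumes "x \<in> int_span B" "y \<in> int_span B"
  shows "x + y \<in> int_span B"
proof -
  obtain c d where x: "x = (\<Sum>b\<in>B. of_int (c b) * b)" and y: "y = (\<Sum>b\<in>B. of_int (d b) * b)"
    using assms unfolding int_span_def by auto
  have "x + y = (\<Sum>b\<in>B. of_int (c b + d b) * b)"
    by (simp add: x y sum.distrib distrib_right)
  thus ?thesis by (rule int_spanI)
qed

lemma int_span_scale:
  assumes "x \<in> int_span B"
  shows "of_int k * x \<in> int_span B"
proof -
  obtain c where x: "x = (\<Sum>b\<in>B. of_int (c b) * b)"
    using assms unfolding int_span_def by auto
  have "of_int k * x = (\<Sum>b\<in>B. of_int (k * c b) * b)"
    by (simp add: x sum_distrib_left mult_ac)
  thus ?thesis by (rule int_spanI)
qed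

lemma int_span_sum:
  assumes "\<And>i. i \<in> I \<Longrightarrow> f i \<in> int_span B"
  shows "sum f I \<in> int_span B"
  using assms by (induction I rule: infinite_finite_induct) (auto intro: int_span_0 int_span_add)

lemma int_span_mult:
  assumes "finite B" "finite C" "x \<in> int_span B" "y \<in> int_span C"
  shows "x * y \<in> int_span ((\<lambda>(b, c). b * c) ` (B \<times> C))"
proof -
  obtain c d where x: "x = (\<Sum>b\<in>B. of_int (c b) * b)" and y: "y = (\<Sum>b\<in>C. of_int (d b) * b)"
    using assms(3,4) unfolding int_span_def by auto
  have "x * y = (\<Sum>b\<in>B. \<Sum>e\<in>C. of_int (c b) * (of_int (d e) * (b * e)))"
    by (simp add: x y sum_product mult_ac)
  also have "\<dots> \<in> int_span ((\<lambda>(b, c). b * c) ` (B \<times> C))"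
    using assms(1,2) by (intro int_span_sum int_span_scale int_span_base) auto
  finally show ?thesis .
qed

text \<open>The determinant trick: multiplication by \<open>x\<close> acts on the generators through
  an integer matrix, and the vector of generators, nonzero because of \<open>b0\<close>, is an
  eigenvector for \<open>x\<close>. So \<open>x\<close> is a root of a monic integral characteristic
  polynomial.\<close>

lemma algebraic_int_if_int_span_stable:
  fixes x :: "'k::field_char_0"
  assumes "finite B" "b0 \<in> B" "b0 \<noteq> 0" and stable: "\<And>b. b \<in> B \<Longrightarrow> x * b \<in> int_span B"
  shows "algebraic_int x"
proof -
  obtain bs where bs: "set bs = B" "distinct bs"
    using finite_distinct_list[OF assms(1)] by blast
  define n where "n = length bs"
  have "\<forall>b\<in>B. \<exists>c. x * b = (\<Sum>e\<in>B. of_int (c e) * e)"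
    using stable unfolding int_span_def by blast
  then obtain c where c: "\<And>b. b \<in> B \<Longrightarrow> x * b = (\<Sum>e\<in>B. of_int (c b e) * e)"
    by metis
  define A :: "int mat" where "A = mat n n (\<lambda>(i, j). c (bs ! i) (bs ! j))"
  define A' :: "'k mat" where "A' = map_mat of_int A"
  define v where "v = vec n (\<lambda>i. bs ! i)"
  have A: "A \<in> carrier_mat n n" by (simp add: A_def)
  have A': "A' \<in> carrier_mat n n" by (simp add: A'_def A_def)
  have reindex: "(\<Sum>j<n. f (bs ! j)) = sum f B" for f :: "'k \<Rightarrow> 'k"
    using bs unfolding n_def
    by (metis bij_betw_nth lessThan_atLeast0 sum.reindex_bij_betw)
  have "eigenvector A' v x"
    unfolding eigenvector_def
  proof (intro conjI)
    show "v \<in> carrier_vec (dim_row A')" using A' by (auto simp: v_def)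
    obtain i where "i < n" "bs ! i = b0"
      using assms(2) bs unfolding n_def by (metis in_set_conv_nth)
    thus "v \<noteq> 0\<^sub>v (dim_row A')"
      using A' assms(3) by (auto simp: v_def dest!: arg_cong[where f = "\<lambda>w. vec_index w i"])
    show "A' *\<^sub>v v = x \<cdot>\<^sub>v v"
    proof (rule eq_vecI)
      show "dim_vec (A' *\<^sub>v v) = dim_vec (x \<cdot>\<^sub>v v)" using A' by (simp add: v_def)
      fix i assume "i < dim_vec (x \<cdot>\<^sub>v v)"
      hence i: "i < n" by (simp add: v_def)
      have "vec_index (A' *\<^sub>v v) i = (\<Sum>j<n. of_int (c (bs ! i) (bs ! j)) * bs ! j)"
        using i by (simp add: A'_def A_def v_def scalar_prod_def lessThan_atLeast0)
      also have "\<dots> = (\<Sum>e\<in>B. of_int (c (bs ! i) e) * e)"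
        by (rule reindex)
      also have "\<dots> = x * bs ! i"
        using c[of "bs ! i"] i bs unfolding n_def by (metis nth_mem)
      finally show "vec_index (A' *\<^sub>v v) i = vec_index (x \<cdot>\<^sub>v v) i"
        using i by (simp add: v_def)
    qed
  qed
  hence "poly (char_poly A') x = 0"
    using eigenvalue_root_char_poly[OF A'] unfolding eigenvalue_def by blast
  moreover have "char_poly A' = map_poly of_int (char_poly A)"
    unfolding A'_def by (rule of_int_hom.char_poly_hom[OF A])
  moreover have "lead_coeff (char_poly A) = 1"
    using degree_monic_char_poly[OF A] by auto
  ultimately show ?thesis
    unfolding algebraic_int_altdef_ipoly by metis
qed

text \<open>The powers of \<open>x\<close> below the degree of a monic relation span a stable
  module. The degree is positive since the constant 1 has no root, which puts 1 among the
  generators.\<close>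

lemma algebraic_int_obtain_int_span:
  fixes x :: "'k::field_char_0"
  assumes "algebraic_int x"
  obtains B where "finite B" "1 \<in> B" "\<And>b. b \<in> B \<Longrightarrow> x * b \<in> int_span B"
proof -
  obtain p where p: "poly (map_poly of_int p) x = 0" "lead_coeff p = (1::int)"
    using assms unfolding algebraic_int_altdef_ipoly by blast
  define n where "n = degree p"
  have n: "n > 0"
  proof (rule ccontr)
    assume "\<not> n > 0"
    hence "p = [:1:]" using p(2) unfolding n_def by (metis degree_eq_zeroE lead_coeff_pCons(2) not_gr_zero pCons_0_0)
    thus False using p(1) by simp
  qed
  have "0 = (\<Sum>i\<le>n. of_int (coeff p i) * x ^ i)"
    using p(1) by (simp add: poly_altdef n_def coeff_map_poly degree_map_poly)
  also have "\<dots> = (\<Sum>i<n. of_int (coeff p i) * x ^ i) + x ^ n"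
    using p(2) by (simp add: n_def lessThan_Suc_atMost[symmetric])
  finally have xn: "x ^ n = (\<Sum>i<n. of_int (- coeff p i) * x ^ i)"
    by (simp add: eq_neg_iff_add_eq_0 sum_negf add.commute)
  define B where "B = (\<lambda>i. x ^ i) ` {..<n}"
  have fin: "finite B" by (simp add: B_def)
  show ?thesis
  proof (rule that[of B])
    show "1 \<in> B" unfolding B_def using n by (force intro!: image_eqI[of _ _ 0])
    fix b assume "b \<in> B"
    then obtain i where i: "i < n" "b = x ^ i" by (auto simp: B_def)
    show "x * b \<in> int_span B"
    proof (cases "Suc i < n")
      case True
      hence "x * b \<in> B" using i by (auto simp: B_def intro!: image_eqI[of _ _ "Suc i"])
      thus ?thesis using fin by (rule int_span_base[rotated])
    next
      case False
      hence "x * b = x ^ n" using i by (metis Suc_lessI power_Suc)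
      also have "\<dots> \<in> int_span B"
        unfolding xn using fin
        by (intro int_span_sum int_span_scale int_span_base) (auto simp: B_def)
      finally show ?thesis .
    qed
  qed (rule fin)
qed

text \<open>The products of two stable generating systems generate a module stable under both
  \<open>x\<close> and \<open>y\<close>, hence under their sum and product.\<close>

lemma algebraic_int_add_mult:
  fixes x y :: "'k::field_char_0"
  assumes "algebraic_int x" "algebraic_int y"
  shows "algebraic_int (x + y)" "algebraic_int (x * y)"
proof -
  obtain B where B: "finite B" "1 \<in> B" "\<And>b. b \<in> B \<Longrightarrow> x * b \<in> int_span B"
    using algebraic_int_obtain_int_span[OF assms(1)] by blast
  obtain C where C: "finite C" "1 \<in> C" "\<And>b. b \<in> C \<Longrightarrow> y * b \<in> int_span C"
    using algebraic_int_obtain_int_span[OF assms(2)] by blast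
  define D where "D = (\<lambda>(b, c). b * c) ` (B \<times> C)"
  have D: "finite D" "1 \<in> D"
    using B C by (auto simp: D_def intro!: image_eqI[of _ _ "(1, 1)"])
  have x: "x * d \<in> int_span D" and y: "y * d \<in> int_span D" if dD: "d \<in> D" for d
  proof -
    obtain b c where d: "d = b * c" "b \<in> B" "c \<in> C" using dD by (auto simp: D_def)
    have "(x * b) * c \<in> int_span D" "b * (y * c) \<in> int_span D"
      unfolding D_def
      using int_span_mult[OF B(1) C(1) B(3)[OF d(2)] int_span_base[OF C(1) d(3)]]
        int_span_mult[OF B(1) C(1) int_span_base[OF B(1) d(2)] C(3)[OF d(3)]] by simp_all
    thus "x * d \<in> int_span D" "y * d \<in> int_span D" by (simp_all add: d mult_ac)
  qed
  have xs: "x * z \<in> int_span D" if z: "z \<in> int_span D" for z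
  proof -
    obtain c where "z = (\<Sum>b\<in>D. of_int (c b) * b)"
      using z unfolding int_span_def by auto
    hence "x * z = (\<Sum>b\<in>D. of_int (c b) * (x * b))"
      by (simp add: sum_distrib_left mult_ac)
    thus ?thesis using x by (auto intro!: int_span_sum int_span_scale)
  qed
  show "algebraic_int (x + y)"
    using D by (rule algebraic_int_if_int_span_stable)
      (auto simp: distrib_right intro!: int_span_add x y)
  show "algebraic_int (x * y)"
    using D by (rule algebraic_int_if_int_span_stable) (auto simp: mult.assoc intro!: xs y)
qed

lemma algebraic_int_diff:
  fixes x y :: "'k::field_char_0"
  assumes "algebraic_int x" "algebraic_int y"
  shows "algebraic_int (x - y)"
  using algebraic_int_add_mult(1)[of x "- y"] assms by simp

lemma algebraic_int_power:
  fixes x :: "'k::field_char_0"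
  assumes "algebraic_int x"
  shows "algebraic_int (x ^ n)"
  by (induction n) (auto intro: algebraic_int_add_mult assms)

lemma algebraic_int_sum:
  fixes f :: "'i \<Rightarrow> 'k::field_char_0"
  assumes "\<And>i. i \<in> I \<Longrightarrow> algebraic_int (f i)"
  shows "algebraic_int (sum f I)"
  using assms by (induction I rule: infinite_finite_induct) (auto intro: algebraic_int_add_mult)

section \<open>Integrality in number fields\<close>

text \<open>Either two powers of \<open>x\<close> coincide, which gives the relation
  \<open>X^i - X^j\<close>, or the infinitely many powers are linearly dependent over the
  rationals.\<close>

lemma number_field_algebraic:
  fixes x :: "'k::field_char_0"
  assumes "number_field TYPE('k)"
  shows "algebraic x"
proof -
  obtain B :: "'k set" where "finite_dimensional_vector_space (\<lambda>q x. of_rat q * x) B"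
    using assms unfolding number_field_def by blast
  then interpret V: finite_dimensional_vector_space "\<lambda>q x :: 'k. of_rat q * x" B .
  show ?thesis
  proof (cases "inj (\<lambda>n::nat. x ^ n)")
    case False
    then obtain i j where ij: "i \<noteq> j" "x ^ i = x ^ j"
      by (auto simp: inj_def)
    define p :: "'k poly" where "p = monom 1 i - monom 1 j"
    have "coeff p i = 1" using ij by (simp add: p_def)
    moreover have "poly p x = 0" using ij by (simp add: p_def poly_monom)
    moreover have "coeff p n \<in> \<int>" for n by (simp add: p_def)
    ultimately show ?thesis unfolding algebraic_def by (metis coeff_0 zero_neq_one)
  next
    case True
    have "V.dependent (range (\<lambda>n::nat. x ^ n))"
    proof (rule ccontr)
      assume "V.independent (range (\<lambda>n::nat. x ^ n))"
      hence "finite (range (\<lambda>n::nat. x ^ n))"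
        using V.independent_span_bound[OF V.finite_Basis] V.span_Basis by blast
      thus False using finite_imageD[OF _ True] infinite_UNIV_nat by blast
    qed
    then obtain t u v where t: "finite t" "t \<subseteq> range (\<lambda>n. x ^ n)" "(\<Sum>v\<in>t. of_rat (u v) * v) = 0"
       "v \<in> t" "u v \<noteq> 0"
      using V.dependent_explicit[of "range (\<lambda>n. x ^ n)"] by auto
    obtain I where I: "finite I" "t = (\<lambda>n. x ^ n) ` I"
      using finite_subset_image[OF t(1,2)] by auto
    define p :: "'k poly" where "p = (\<Sum>i\<in>I. monom (of_rat (u (x ^ i))) i)"
    have coeff: "coeff p n = (if n \<in> I then of_rat (u (x ^ n)) else 0)" for n
      using I(1) by (simp add: p_def coeff_sum)
    obtain i where i: "i \<in> I" "v = x ^ i" using t(4) I by blast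
    have "p \<noteq> 0"
    proof
      assume "p = 0"
      thus False using coeff[of i] i t(5) by simp
    qed
    moreover have "poly p x = (\<Sum>i\<in>I. of_rat (u (x ^ i)) * x ^ i)"
      by (simp add: p_def poly_sum poly_monom)
    moreover have "\<dots> = (\<Sum>v\<in>t. of_rat (u v) * v)"
      unfolding I(2) using True by (subst sum.reindex) (auto simp: inj_def inj_on_def)
    moreover have "coeff p n \<in> \<rat>" for n by (simp add: coeff)
    ultimately show ?thesis using t(3) unfolding algebraic_altdef by metis
  qed
qed

text \<open>Countability makes limsup sets indexed by field elements measurable and unions of null
  sets over all integral translates null.\<close>

lemma number_field_countable:
  assumes "number_field TYPE('k::field_char_0)"
  shows "countable (UNIV :: 'k set)"
proof -
  obtain B :: "'k set" where "finite_dimensional_vector_space (\<lambda>q x. of_rat q * x) B"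
    using assms unfolding number_field_def by blast
  then interpret V: finite_dimensional_vector_space "\<lambda>q x :: 'k. of_rat q * x" B .
  have "countable (Pi\<^sub>E B (\<lambda>_. UNIV :: rat set))"
    by (intro countable_PiE V.finite_Basis) auto
  moreover have "(UNIV :: 'k set) \<subseteq> (\<lambda>u. \<Sum>b\<in>B. of_rat (u b) * b) ` Pi\<^sub>E B (\<lambda>_. UNIV)"
  proof
    fix x :: 'k
    have "x \<in> V.span B" using V.span_Basis by auto
    then obtain u where "x = (\<Sum>b\<in>B. of_rat (u b) * b)"
      unfolding V.span_finite[OF V.finite_Basis] by auto
    also have "\<dots> = (\<Sum>b\<in>B. of_rat (restrict u B b) * b)" by (intro sum.cong) auto
    finally have "x = (\<lambda>u. \<Sum>b\<in>B. of_rat (u b) * b) (restrict u B)" .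
    moreover have "restrict u B \<in> Pi\<^sub>E B (\<lambda>_. UNIV)" by auto
    ultimately show "x \<in> (\<lambda>u. \<Sum>b\<in>B. of_rat (u b) * b) ` Pi\<^sub>E B (\<lambda>_. UNIV)"
      by (rule image_eqI)
  qed
  ultimately show ?thesis by (meson countable_image countable_subset)
qed

lemma bezout_finite_int:
  fixes c :: "'i \<Rightarrow> int"
  assumes "finite I"
  shows "\<exists>z. (\<Sum>i\<in>I. z i * c i) = Gcd (c ` I)"
  using assms
proof (induction I rule: finite_induct)
  case (insert i I)
  then obtain z where z: "(\<Sum>i\<in>I. z i * c i) = Gcd (c ` I)" by blast
  obtain s t where st: "s * c i + t * Gcd (c ` I) = gcd (c i) (Gcd (c ` I))" using bezout_int by blast
  have "(\<Sum>j\<in>insert i I. (if j = i then s else t * z j) * c j)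
      = s * c i + (\<Sum>j\<in>I. (if j = i then s else t * z j) * c j)"
    using insert by simp
  also have "(\<Sum>j\<in>I. (if j = i then s else t * z j) * c j) = (\<Sum>j\<in>I. t * (z j * c j))"
    using insert by (intro sum.cong) auto
  also have "\<dots> = t * Gcd (c ` I)" by (simp add: z sum_distrib_left[symmetric])
  finally have "(\<Sum>j\<in>insert i I. (if j = i then s else t * z j) * c j) = Gcd (c ` insert i I)"
    using st by simp
  thus ?case by (rule exI[of _ "\<lambda>j. if j = i then s else t * z j"])
qed simp

text \<open>
  The coefficients of \<open>f / (X - \<gamma>)\<close> are algebraic integers for \<open>f \<in> \<int>[X]\<close> with \<open>f(\<gamma>) = 0\<close>:
  they preserve the \<open>\<int>\<close>-module spanned by \<open>1, \<gamma>, \<dots>, \<gamma>\<^bsup>deg f - 1\<^esup>\<close>.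
\<close>

lemma algebraic_int_quotient_coeff:
  fixes g :: "'k::field_char_0" and c :: "nat \<Rightarrow> int"
  assumes root: "(\<Sum>j\<le>d. of_int (c j) * g ^ j) = 0" and "k < d"
  shows "algebraic_int (\<Sum>j\<in>{k<..d}. of_int (c j) * g ^ (j - k - 1))" (is "algebraic_int ?b")
proof -
  define B where "B = (\<lambda>i. g ^ i) ` {..<d}"
  have B: "finite B" "1 \<in> B"
    using assms(2) by (auto simp: B_def intro!: image_eqI[of _ _ 0])
  have pow: "g ^ i \<in> int_span B" if "i < d" for i
    using that B by (intro int_span_base) (auto simp: B_def)
  show ?thesis
  proof (rule algebraic_int_if_int_span_stable[OF B])
    fix b assume "b \<in> B"
    then obtain i where i: "i < d" "b = g ^ i" by (auto simp: B_def)
    show "?b * b \<in> int_span B"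
    proof (cases "i \<le> k")
      case True
      have "?b * b = (\<Sum>j\<in>{k<..d}. of_int (c j) * g ^ (j - k - 1 + i))"
        unfolding i sum_distrib_right
        by (intro sum.cong) (auto simp: mult.assoc simp flip: power_add)
      also have "\<dots> \<in> int_span B"
        using True assms(2) by (intro int_span_sum int_span_scale pow) auto
      finally show ?thesis .
    next
      case False
      have split: "(\<Sum>j\<le>d. of_int (c j) * g ^ j)
          = (\<Sum>j\<le>k. of_int (c j) * g ^ j) + (\<Sum>j\<in>{k<..d}. of_int (c j) * g ^ j)"
        using assms(2) by (subst sum.union_disjoint[symmetric]) (auto intro!: sum.cong)
      have "?b * b = (\<Sum>j\<in>{k<..d}. of_int (c j) * g ^ j) * g ^ (i - k - 1)"
      proof -
        have "?b * g ^ (Suc k) = (\<Sum>j\<in>{k<..d}. of_int (c j) * g ^ j)"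
          unfolding sum_distrib_right
          by (intro sum.cong refl) (simp add: mult.assoc power_add[symmetric] del: power_Suc)
        moreover have "b = g ^ Suc k * g ^ (i - k - 1)"
          using False by (simp add: i flip: power_add power_Suc)
        ultimately show ?thesis by (metis mult.assoc)
      qed
      also have "\<dots> = - (\<Sum>j\<le>k. of_int (c j) * g ^ j) * g ^ (i - k - 1)"
        using root unfolding split by (metis add_eq_0_iff)
      also have "\<dots> = (\<Sum>j\<le>k. of_int (- c j) * g ^ (j + (i - k - 1)))"
        unfolding sum_distrib_right sum_negf[symmetric]
        by (intro sum.cong) (auto simp: power_add)
      also have "\<dots> \<in> int_span B"
        using False i by (intro int_span_sum int_span_scale pow) auto
      finally show ?thesis .
    qed
  qed simp
qed

text \<open>Dividing by the content keeps the root; coefficients without a common factor are what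
  the later Bezout argument starts from.\<close>

lemma number_field_primitive_relation:
  fixes g :: "'k::field_char_0"
  assumes "number_field TYPE('k)"
  obtains p :: "int poly" where "(\<Sum>j\<le>degree p. of_int (coeff p j) * g ^ j) = 0" "content p = 1" "p \<noteq> 0"
proof -
  have "algebraic g" using assms by (rule number_field_algebraic)
  then obtain q :: "int poly" where q: "q \<noteq> 0" "poly (map_poly of_int q) g = 0"
    using algebraicE'[of g] by metis
  have ev: "poly (map_poly of_int r) g = (\<Sum>j\<le>degree r. of_int (coeff r j) * g ^ j)" for r :: "int poly"
    by (simp add: poly_altdef coeff_map_poly degree_map_poly)
  have "map_poly of_int q = (Polynomial.smult (of_int (content q)) (map_poly of_int (primitive_part q)) :: 'k poly)"
    by (subst content_times_primitive_part[symmetric, of q])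
      (rule poly_eqI, simp add: coeff_map_poly del: content_times_primitive_part)
  hence "poly (map_poly of_int (primitive_part q)) g = 0"
    using q by simp
  thus ?thesis using that[of "primitive_part q"] q unfolding ev by simp
qed

text \<open>The \<open>b k\<close> are the coefficients of \<open>p / (X - g)\<close> for a
  primitive integral \<open>p\<close> with root \<open>g\<close>; the recursions compare
  coefficients in the product of this quotient with \<open>X - g\<close>.\<close>

lemma number_field_quotient_coeffs:
  fixes g :: "'k::field_char_0"
  assumes "number_field TYPE('k)"
  obtains d and c :: "nat \<Rightarrow> int" and b :: "nat \<Rightarrow> 'k"
  where "0 < d" "c d \<noteq> 0" "Gcd (c ` {..d}) = 1" "\<And>k. algebraic_int (b k)"
    "of_int (c 0) = - g * b 0" "\<And>k. of_int (c (Suc k)) = b k - g * b (Suc k)"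
    "b (d - 1) = of_int (c d)" "\<And>k. d < k \<Longrightarrow> c k = 0"
proof -
  obtain p :: "int poly" where p: "(\<Sum>j\<le>degree p. of_int (coeff p j) * g ^ j) = 0" "content p = 1" "p \<noteq> 0"
    using number_field_primitive_relation[OF assms] .
  define d where "d = degree p"
  define c where "c = coeff p"
  have root: "(\<Sum>j\<le>d. of_int (c j) * g ^ j) = 0" using p(1) by (simp add: d_def c_def)
  have cd: "c d \<noteq> 0" using p(3) by (simp add: d_def c_def)
  have dpos: "0 < d" using root cd by (cases d) auto
  define b where "b = (\<lambda>k. \<Sum>j\<in>{k<..d}. of_int (c j) * g ^ (j - k - 1))"
  have "set (coeffs p) \<subseteq> c ` {..d}" 
    by (auto simp: coeffs_def c_def d_def)
  hence "Gcd (c ` {..d}) dvd content p"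
    unfolding content_def by (intro Gcd_fin_greatest) auto
  hence gcd1: "Gcd (c ` {..d}) = 1"
    using p(2) by simp
  have bint: "algebraic_int (b k)" for k
    using algebraic_int_quotient_coeff[OF root, of k] by (cases "k < d") (simp_all add: b_def)
  have shift: "g * b k = (\<Sum>j\<in>{k<..d}. of_int (c j) * g ^ (j - k))" for k
    unfolding b_def sum_distrib_left
    by (intro sum.cong) (auto simp: mult_ac Suc_diff_Suc simp flip: power_Suc)
  have "{..d} = insert 0 {0<..d}" by auto
  hence c0: "of_int (c 0) = - g * b 0"
    using root shift[of 0] by (simp add: add_eq_0_iff)
  have cSuc: "of_int (c (Suc k)) = b k - g * b (Suc k)" for k
  proof (cases "Suc k \<le> d")
    case True
    hence "{k<..d} = insert (Suc k) {Suc k<..d}" by auto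
    thus ?thesis unfolding shift by (simp add: b_def)
  next
    case False
    thus ?thesis by (simp add: b_def c_def d_def coeff_eq_0)
  qed
  have "{d - 1<..d} = {d}" using dpos by auto
  hence "b (d - 1) = of_int (c d)" by (simp add: b_def)
  thus ?thesis using that[OF dpos cd gcd1 bint c0 cSuc] by (simp add: c_def d_def coeff_eq_0)
qed

text \<open>Solving the recursion for \<open>b k * g\<close> exhibits it as a difference of integral
  elements, so every \<open>b k\<close> is a multiplier that clears the denominator of
  \<open>g\<close>.\<close>

lemma number_field_quotient_coeffs_integral:
  fixes g :: "'k::field_char_0"
  assumes "number_field TYPE('k)"
  obtains d and c :: "nat \<Rightarrow> int" and b :: "nat \<Rightarrow> 'k"
  where "0 < d" "c d \<noteq> 0" "Gcd (c ` {..d}) = 1"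
    "\<And>k. algebraic_int (b k)" "\<And>k. algebraic_int (b k * g)"
    "\<And>k. of_int (c k) = (if k = 0 then 0 else b (k - 1)) - g * b k"
    "b (d - 1) = of_int (c d)"
proof -
  obtain d c and b :: "nat \<Rightarrow> 'k" where cb: "0 < d" "c d \<noteq> 0" "Gcd (c ` {..d}) = 1" "\<And>k. algebraic_int (b k)"
    "of_int (c 0) = - g * b 0" "\<And>k. of_int (c (Suc k)) = b k - g * b (Suc k)"
    "b (d - 1) = of_int (c d)"
    using number_field_quotient_coeffs[OF assms, of g] by metis
  have ck: "of_int (c k) = (if k = 0 then 0 else b (k - 1)) - g * b k" for k
    using cb(5) cb(6)[of "k - 1"] by (cases k) auto
  have "algebraic_int (b k * g)" for k
  proof (cases k)
    case 0
    have "b 0 * g = - of_int (c 0)" using cb(5) by (simp add: mult_ac)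
    thus ?thesis using 0 by simp
  next
    case (Suc n)
    have "b k * g = b n - of_int (c k)" using cb(6)[of n] Suc by (simp add: mult_ac)
    thus ?thesis using cb(4) by (simp add: algebraic_int_diff)
  qed
  thus ?thesis using that[OF cb(1-4) _ ck cb(7)] by blast
qed

text \<open>The top coefficient \<open>b (d - 1)\<close> is the leading coefficient of the relation,
  a nonzero rational integer.\<close>

lemma number_field_integral_multiple:
  fixes g :: "'k::field_char_0"
  assumes "number_field TYPE('k)"
  obtains n :: nat where "0 < n" "algebraic_int (of_nat n * g)"
proof -
  obtain d c and b :: "nat \<Rightarrow> 'k" where cb: "c d \<noteq> 0" "\<And>k. algebraic_int (b k * g)"
    "b (d - 1) = of_int (c d)"
    using number_field_quotient_coeffs_integral[OF assms, of g] by metis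
  have "algebraic_int (of_int (c d) * g)" using cb(2)[of "d - 1"] cb(3) by simp
  hence "algebraic_int (of_nat (nat \<bar>c d\<bar>) * g)"
    by (cases "c d \<ge> 0") (simp_all add: of_nat_nat)
  moreover have "0 < nat \<bar>c d\<bar>" using cb(1) by simp
  ultimately show ?thesis using that by blast
qed

text \<open>Gauss's lemma in disguise: a Bezout combination of the coprime
  \<open>c k = b (k - 1) - g * b k\<close> writes 1 as \<open>u + v * g\<close> with multipliers
  \<open>u\<close> and \<open>v\<close>. In ideal terms, \<open>den g\<close> and
  \<open>g * den g\<close> are comaximal, so \<open>(g)\<close> is a quotient of coprime integral
  ideals.\<close>

lemma number_field_comaximal_denominator:
  fixes g :: "'k::field_char_0"
  assumes "number_field TYPE('k)"
  obtains u v where "algebraic_int u" "algebraic_int v" "algebraic_int (u * g)" "algebraic_int (v * g)"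
    "u + v * g = 1"
proof -
  obtain d c and b :: "nat \<Rightarrow> 'k" where cb: "Gcd (c ` {..d}) = 1" "\<And>k. algebraic_int (b k)"
    and gb: "\<And>k. algebraic_int (b k * g)"
    and ck: "\<And>k. of_int (c k) = (if k = 0 then 0 else b (k - 1)) - g * b k"
    using number_field_quotient_coeffs_integral[OF assms, of g] by metis
  obtain z where z: "(\<Sum>k\<le>d. z k * c k) = 1"
    using bezout_finite_int[of "{..d}" c] cb(1) by auto
  define u where "u = (\<Sum>k\<le>d. of_int (z k) * (if k = 0 then 0 else b (k - 1)))"
  define v where "v = (\<Sum>k\<le>d. of_int (- z k) * b k)"
  have "(1::'k) = of_int (\<Sum>k\<le>d. z k * c k)" using z by simp
  also have "\<dots> = (\<Sum>k\<le>d. of_int (z k) * ((if k = 0 then 0 else b (k - 1)) - g * b k))"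
    by (simp only: of_int_sum of_int_mult ck)
  also have "\<dots> = u + v * g"
    unfolding u_def v_def sum_distrib_right sum.distrib[symmetric]
    by (intro sum.cong refl) (simp add: algebra_simps)
  finally have uv: "u + v * g = 1" by simp
  have comb: "algebraic_int (\<Sum>k\<le>d. of_int (y k) * f k)"
    if "\<And>k. algebraic_int (f k)" for y :: "nat \<Rightarrow> int" and f :: "nat \<Rightarrow> 'k"
    using that by (auto intro!: algebraic_int_sum algebraic_int_add_mult(2))
  have "algebraic_int u" "algebraic_int v"
    unfolding u_def v_def by (intro comb; simp add: cb(2))+
  moreover have "u * g = (\<Sum>k\<le>d. of_int (z k) * (if k = 0 then 0 else b (k - 1) * g))"
    "v * g = (\<Sum>k\<le>d. of_int (- z k) * (b k * g))"
    unfolding u_def v_def sum_distrib_right by (intro sum.cong refl; simp)+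
  hence "algebraic_int (u * g)" "algebraic_int (v * g)"
    using comb[of "\<lambda>k. if k = 0 then 0 else b (k - 1) * g" z]
      comb[of "\<lambda>k. b k * g" "\<lambda>k. - z k"] gb by auto
  ultimately show ?thesis using that uv by blast
qed

section \<open>Embeddings and approximation at the infinite places\<close>

lemma embeddingsD:
  assumes "\<rho> \<in> embeddings"
  shows "\<rho> 1 = 1" "\<rho> (x + y) = \<rho> x + \<rho> y" "\<rho> (x * y) = \<rho> x * \<rho> y"
  using assms by (simp_all add: embeddings_def)

context
  fixes \<rho> :: "'k::field_char_0 \<Rightarrow> complex"
  assumes \<rho>: "\<rho> \<in> embeddings"
begin

lemma embedding_0: "\<rho> 0 = 0"
  using embeddingsD(2)[OF \<rho>, of 0 0] by simp

lemma embedding_minus: "\<rho> (- x) = - \<rho> x"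
  using embeddingsD(2)[OF \<rho>, of x "- x"] by (simp add: embedding_0 eq_neg_iff_add_eq_0 add.commute)

lemma embedding_diff: "\<rho> (x - y) = \<rho> x - \<rho> y"
  using embeddingsD(2)[OF \<rho>, of x "- y"] by (simp add: embedding_minus)

lemma embedding_eq_0_iff: "\<rho> x = 0 \<longleftrightarrow> x = 0"
proof
  assume "\<rho> x = 0"
  show "x = 0"
  proof (rule ccontr)
    assume "x \<noteq> 0"
    hence "\<rho> x * \<rho> (inverse x) = 1"
      using embeddingsD(3)[OF \<rho>, of x "inverse x"] embeddingsD(1)[OF \<rho>] by simp
    thus False using \<open>\<rho> x = 0\<close> by simp
  qed
qed (simp add: embedding_0)

lemma embedding_inverse: "\<rho> (inverse x) = inverse (\<rho> x)"
proof (cases "x = 0")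
  case False
  hence "\<rho> x * \<rho> (inverse x) = 1"
    using embeddingsD(3)[OF \<rho>, of x "inverse x"] embeddingsD(1)[OF \<rho>] by simp
  thus ?thesis by (metis inverse_unique)
qed (simp add: embedding_0)

lemma embedding_divide: "\<rho> (x / y) = \<rho> x / \<rho> y"
  by (simp add: divide_inverse embeddingsD(3)[OF \<rho>] embedding_inverse)

lemma embedding_power: "\<rho> (x ^ n) = \<rho> x ^ n"
  by (induction n) (simp_all add: embeddingsD[OF \<rho>])

lemma embedding_sum: "\<rho> (sum f A) = (\<Sum>a\<in>A. \<rho> (f a))"
  by (induction A rule: infinite_finite_induct) (simp_all add: embeddingsD[OF \<rho>] embedding_0)

lemma embedding_of_nat: "\<rho> (of_nat n) = of_nat n"
  by (induction n) (simp_all add: embeddingsD[OF \<rho>] embedding_0)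

lemma embedding_of_int: "\<rho> (of_int n) = of_int n"
  by (cases n) (simp_all add: embedding_of_nat embedding_minus del: of_nat_Suc)

lemma embedding_of_rat: "\<rho> (of_rat q) = of_rat q"
  by (cases q) (simp add: of_rat_rat embedding_divide embedding_of_int)

end

text \<open>An embedding is determined by its values on a rational basis, and each value is a root
  of a fixed nonzero integral polynomial.\<close>

lemma finite_embeddings:
  assumes "number_field TYPE('k::field_char_0)"
  shows "finite (embeddings :: ('k \<Rightarrow> complex) set)"
proof -
  obtain B :: "'k set" where "finite_dimensional_vector_space (\<lambda>q x. of_rat q * x) B"
    using assms unfolding number_field_def by blast
  then interpret V: finite_dimensional_vector_space "\<lambda>q x :: 'k. of_rat q * x" B .
  have "\<forall>b :: 'k. \<exists>p :: int poly. p \<noteq> 0 \<and> poly (map_poly of_int p) b = 0"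
    using number_field_algebraic[OF assms] algebraicE' by metis
  then obtain p :: "'k \<Rightarrow> int poly"
    where p: "\<And>b. p b \<noteq> 0" "\<And>b. poly (map_poly of_int (p b)) b = 0"
    by metis
  define Z where "Z b = {z :: complex. poly (map_poly of_int (p b)) z = 0}" for b
  have Z: "finite (Z b)" for b
  proof -
    have "map_poly of_int (p b) \<noteq> (0 :: complex poly)"
      using p(1)[of b] by (metis coeff_0 coeff_map_poly leading_coeff_0_iff of_int_0 of_int_eq_iff)
    thus ?thesis unfolding Z_def by (rule poly_roots_finite)
  qed
  have root: "\<sigma> b \<in> Z b" if "\<sigma> \<in> embeddings" for \<sigma> b
  proof -
    have "poly (map_poly of_int (p b)) (\<sigma> b) = \<sigma> (poly (map_poly of_int (p b)) b)"
      by (simp add: poly_altdef degree_map_poly coeff_map_poly embedding_sum[OF that]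
          embeddingsD[OF that] embedding_power[OF that] embedding_of_int[OF that])
    thus ?thesis using p(2)[of b] by (simp add: Z_def embedding_0[OF that])
  qed
  have "inj_on (\<lambda>\<sigma>. restrict \<sigma> B) embeddings"
  proof (rule inj_onI, rule ext)
    fix \<sigma> \<tau> :: "'k \<Rightarrow> complex" and x
    assume *: "\<sigma> \<in> embeddings" "\<tau> \<in> embeddings" "restrict \<sigma> B = restrict \<tau> B"
    have eq: "\<sigma> b = \<tau> b" if "b \<in> B" for b
      using fun_cong[OF *(3), of b] that by simp
    have "x \<in> V.span B" using V.span_Basis by auto
    then obtain u where x: "x = (\<Sum>b\<in>B. of_rat (u b) * b)"
      unfolding V.span_finite[OF V.finite_Basis] by auto
    show "\<sigma> x = \<tau> x"
      unfolding x using eq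
      by (simp add: embedding_sum[OF *(1)] embedding_sum[OF *(2)] embeddingsD[OF *(1)]
          embeddingsD[OF *(2)] embedding_of_rat[OF *(1)] embedding_of_rat[OF *(2)])
  qed
  moreover have "(\<lambda>\<sigma>. restrict \<sigma> B) ` embeddings \<subseteq> Pi\<^sub>E B Z"
    using root by auto
  moreover have "finite (Pi\<^sub>E B Z)"
    using V.finite_Basis Z by (intro finite_PiE) auto
  ultimately show ?thesis using finite_imageD finite_subset by metis
qed

text \<open>If \<open>\<bar>\<sigma> x\<bar> = \<bar>\<tau> x\<bar>\<close> for all \<open>x\<close>, comparison at \<open>x + 1\<close> gives equal real parts, so each
  \<open>\<tau> x\<close> is \<open>\<sigma> x\<close> or its conjugate; a group is not the union of two proper subgroups.\<close>

lemma embedding_eqI_cmod: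
  assumes \<sigma>: "\<sigma> \<in> embeddings" and \<tau>: "\<tau> \<in> embeddings" and eq: "\<And>x. cmod (\<sigma> x) = cmod (\<tau> x)"
  shows "\<tau> = \<sigma> \<or> \<tau> = cnj \<circ> \<sigma>"
proof (rule ccontr)
  assume "\<not> ?thesis"
  then obtain x y where xy: "\<tau> x \<noteq> \<sigma> x" "\<tau> y \<noteq> cnj (\<sigma> y)" by (auto simp: fun_eq_iff)
  have sq: "(cmod (z + 1))\<^sup>2 = (cmod z)\<^sup>2 + 2 * Re z + 1" for z
    by (simp only: cmod_power2) (simp add: power2_eq_square algebra_simps)
  have Re: "Re (\<sigma> z) = Re (\<tau> z)" for z
    using eq[of "z + 1"] eq[of z] sq[of "\<sigma> z"] sq[of "\<tau> z"] embeddingsD[OF \<sigma>] embeddingsD[OF \<tau>] by simp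
  have Im: "Im (\<tau> z) = Im (\<sigma> z) \<or> Im (\<tau> z) = - Im (\<sigma> z)" for z
  proof -
    have "(Im (\<tau> z))\<^sup>2 = (Im (\<sigma> z))\<^sup>2"
      using eq[of z] Re[of z] cmod_power2[of "\<sigma> z"] cmod_power2[of "\<tau> z"] by simp
    thus ?thesis by (simp add: power2_eq_iff)
  qed
  have "Im (\<tau> x) = - Im (\<sigma> x)" "Im (\<sigma> x) \<noteq> 0" "Im (\<tau> y) = Im (\<sigma> y)" "Im (\<sigma> y) \<noteq> 0"
    using Im[of x] Im[of y] Re[of x] Re[of y] xy by (auto simp: complex_eq_iff)
  thus False using Im[of "x + y"] embeddingsD(2)[OF \<sigma>, of x y] embeddingsD(2)[OF \<tau>, of x y] by auto
qed

text \<open>The completion of the field at the place, realized inside the complex numbers so that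
  all places share one type.\<close>

definition place_field :: "('k::field_char_0 \<Rightarrow> complex) \<Rightarrow> complex set" where
  "place_field \<rho> = (if real_embedding \<rho> then \<real> else UNIV)"

lemma embedding_in_place_field: "\<rho> x \<in> place_field \<rho>"
  by (auto simp: place_field_def real_embedding_def)

lemma place_field_closed:
  assumes "x \<in> place_field \<rho>" "y \<in> place_field \<rho>"
  shows "x + y \<in> place_field \<rho>" "x - y \<in> place_field \<rho>" "x * y \<in> place_field \<rho>" "x / y \<in> place_field \<rho>"
  using assms by (auto simp: place_field_def)

lemma of_real_in_place_field [simp]: "complex_of_real r \<in> place_field \<rho>"
  by (simp add: place_field_def)

lemma closed_place_field: "closed (place_field \<rho>)"
  by (simp add: place_field_def closed_complex_Reals)

lemma ex_rat_approx:
  assumes "(e::real) > 0"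
  obtains q :: rat where "\<bar>r - of_rat q\<bar> < e"
proof -
  obtain q where "q \<in> \<rat>" "r - e < q" "q < r + e"
    using Rats_dense_in_real[of "r - e" "r + e"] assms by auto
  then obtain p :: rat where "q = of_rat p" by (auto elim: Rats_cases)
  thus ?thesis using that[of p] \<open>r - e < q\<close> \<open>q < r + e\<close> by (auto simp: abs_less_iff)
qed

lemma of_real_of_rat: "complex_of_real (of_rat q) = of_rat q"
  by (cases q) (simp add: of_rat_rat)

text \<open>At a nonreal place some \<open>\<rho> w\<close> has nonzero imaginary part: a rational
  multiple of \<open>w\<close> corrects the imaginary part, and a rational number then corrects the
  real part.\<close>

lemma embedding_dense:
  assumes \<rho>: "\<rho> \<in> embeddings" and z: "z \<in> place_field \<rho>" and e: "e > 0"
  obtains x where "cmod (z - \<rho> x) < e"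
proof (cases "real_embedding \<rho>")
  case True
  then obtain r where r: "z = of_real r" using z by (auto simp: place_field_def elim: Reals_cases)
  obtain q :: rat where "\<bar>r - of_rat q\<bar> < e" using ex_rat_approx[OF e] .
  moreover have "z - \<rho> (of_rat q) = of_real (r - of_rat q)"
    by (simp only: r embedding_of_rat[OF \<rho>] of_real_diff of_real_of_rat)
  hence "cmod (z - \<rho> (of_rat q)) = \<bar>r - of_rat q\<bar>" by (simp only: norm_of_real)
  ultimately show ?thesis using that by metis
next
  case False
  then obtain w where "\<rho> w \<notin> \<real>" by (auto simp: real_embedding_def)
  hence w: "Im (\<rho> w) \<noteq> 0" by (auto simp: complex_is_Real_iff)
  have "e / 2 / \<bar>Im (\<rho> w)\<bar> > 0" using e w by simp
  then obtain q :: rat where "\<bar>Im z / Im (\<rho> w) - of_rat q\<bar> < e / 2 / \<bar>Im (\<rho> w)\<bar>"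
    using ex_rat_approx by metis
  hence "\<bar>Im z / Im (\<rho> w) - of_rat q\<bar> * \<bar>Im (\<rho> w)\<bar> < e / 2" using w by (simp add: field_simps)
  hence q: "\<bar>Im z - of_rat q * Im (\<rho> w)\<bar> < e / 2"
    using w by (simp add: abs_mult[symmetric] left_diff_distrib)
  have "e / 2 > 0" using e by simp
  then obtain p :: rat where p: "\<bar>(Re z - of_rat q * Re (\<rho> w)) - of_rat p\<bar> < e / 2"
    using ex_rat_approx by metis
  define x where "x = of_rat p + of_rat q * w"
  have "\<rho> x = of_real (of_rat p) + of_real (of_rat q) * \<rho> w"
    by (simp add: x_def embeddingsD[OF \<rho>] embedding_of_rat[OF \<rho>] of_real_of_rat)
  hence "Re (z - \<rho> x) = (Re z - of_rat q * Re (\<rho> w)) - of_rat p" "Im (z - \<rho> x) = Im z - of_rat q * Im (\<rho> w)"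
    by simp_all
  hence "cmod (z - \<rho> x) < e"
    using p q cmod_le[of "z - \<rho> x"] by linarith
  thus ?thesis using that by blast
qed

text \<open>A rational expression that separates large from small absolute values in the limit, the
  device of the Artin-Whaples proof of weak approximation.\<close>

lemma tendsto_power_ratio:
  fixes z :: complex
  shows "cmod z < 1 \<Longrightarrow> (\<lambda>n. z ^ n / (1 + z ^ n)) \<longlonglongrightarrow> 0"
    and "1 < cmod z \<Longrightarrow> (\<lambda>n. z ^ n / (1 + z ^ n)) \<longlonglongrightarrow> 1"
proof -
  assume "cmod z < 1"
  hence "(\<lambda>n. z ^ n) \<longlonglongrightarrow> 0" by (rule LIMSEQ_power_zero)
  hence "(\<lambda>n. z ^ n / (1 + z ^ n)) \<longlonglongrightarrow> 0 / (1 + 0)"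
    by (intro tendsto_divide tendsto_add tendsto_const) auto
  thus "(\<lambda>n. z ^ n / (1 + z ^ n)) \<longlonglongrightarrow> 0" by simp
next
  assume z: "1 < cmod z"
  hence "cmod (inverse z) < 1" by (simp add: norm_inverse inverse_less_1_iff)
  hence "(\<lambda>n. inverse z ^ n) \<longlonglongrightarrow> 0" by (rule LIMSEQ_power_zero)
  hence "(\<lambda>n. 1 / (inverse z ^ n + 1)) \<longlonglongrightarrow> 1 / (0 + 1)"
    by (intro tendsto_divide tendsto_add tendsto_const) auto
  moreover have "1 / (inverse z ^ n + 1) = z ^ n / (1 + z ^ n)" for n
  proof -
    have "z ^ n \<noteq> 0" using z by auto
    hence "inverse z ^ n + 1 = (1 + z ^ n) / z ^ n"
      by (simp add: power_inverse field_simps)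
    thus ?thesis by simp
  qed
  ultimately show "(\<lambda>n. z ^ n / (1 + z ^ n)) \<longlonglongrightarrow> 1" by simp
qed

section \<open>Weak approximation, cocompactness of the integers and dense modules\<close>

locale number_field_places =
  fixes S :: "('k::field_char_0 \<Rightarrow> complex) set"
  assumes number_field: "number_field TYPE('k)" and place_reps: "place_reps S"
begin

lemma embedding: "\<rho> \<in> S \<Longrightarrow> \<rho> \<in> embeddings"
  using place_reps by (auto simp: place_reps_def)

lemma finite_places: "finite S"
  by (rule finite_subset[OF subsetI finite_embeddings[OF number_field]]) (rule embedding)

lemmas emb_add = embeddingsD(2)[OF embedding]
  and emb_mult = embeddingsD(3)[OF embedding]
  and emb_1 = embeddingsD(1)[OF embedding]
  and emb_0 = embedding_0[OF embedding]
  and emb_diff = embedding_diff[OF embedding]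
  and emb_divide = embedding_divide[OF embedding]
  and emb_power = embedding_power[OF embedding]
  and emb_eq_0_iff = embedding_eq_0_iff[OF embedding]
  and emb_of_nat = embedding_of_nat[OF embedding]
  and emb_sum = embedding_sum[OF embedding]

text \<open>Two members of \<open>S\<close> are not conjugate, so their absolute values differ
  somewhere. Inversion corrects the order if necessary, and division by a rational number strictly
  between the two values moves the gap to 1.\<close>

lemma separate_places:
  assumes "\<sigma> \<in> S" "\<tau> \<in> S" "\<sigma> \<noteq> \<tau>"
  obtains x where "cmod (\<sigma> x) < 1" "1 < cmod (\<tau> x)"
proof -
  have "\<not> (\<tau> = \<sigma> \<or> \<tau> = cnj \<circ> \<sigma>)"
    using assms place_reps embedding[OF assms(1)] unfolding place_reps_def by metis
  then obtain x where x: "cmod (\<sigma> x) \<noteq> cmod (\<tau> x)"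
    using embedding_eqI_cmod embedding assms by metis
  have "\<exists>y. cmod (\<sigma> y) < cmod (\<tau> y)"
  proof (cases "cmod (\<sigma> x) < cmod (\<tau> x)")
    case False
    have "x \<noteq> 0" using x emb_0[OF assms(1)] emb_0[OF assms(2)] by auto
    hence "cmod (\<sigma> x) > 0" "cmod (\<tau> x) > 0" using emb_eq_0_iff assms by auto
    hence "cmod (\<sigma> (inverse x)) < cmod (\<tau> (inverse x))"
      using False x assms by (simp add: embedding_inverse[OF embedding] norm_inverse)
    thus ?thesis by blast
  qed blast
  then obtain y where y: "cmod (\<sigma> y) < cmod (\<tau> y)" by blast
  then obtain r where r: "r \<in> \<rat>" "cmod (\<sigma> y) < r" "r < cmod (\<tau> y)"
    using Rats_dense_in_real by blast
  then obtain q :: rat where q: "r = of_rat q" by (auto elim: Rats_cases)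
  have r0: "r > 0" using r(2) by (meson norm_ge_zero order_le_less_trans)
  have cm: "cmod (\<rho> (y / of_rat q)) = cmod (\<rho> y) / r" if "\<rho> \<in> S" for \<rho>
  proof -
    have "cmod (of_rat q) = r"
      using r0 unfolding q by (metis abs_of_pos norm_of_real of_real_of_rat)
    thus ?thesis by (simp add: emb_divide[OF that] embedding_of_rat[OF embedding[OF that]] norm_divide)
  qed
  show ?thesis
    using that[of "y / of_rat q"] cm assms r r0 by simp
qed

text \<open>Induction on \<open>T\<close>. If the element \<open>a\<close> found so far is at most 1
  at the new place \<open>\<tau>\<close>, then \<open>a ^ n * b\<close> works for large
  \<open>n\<close>. Otherwise \<open>a ^ n / (1 + a ^ n) * b\<close> tends to \<open>b\<close> at
  \<open>\<rho>0\<close> and \<open>\<tau>\<close> and to 0 at the places of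
  \<open>T\<close>.\<close>

lemma ex_dominant:
  assumes "\<rho>0 \<in> S" "T \<subseteq> S - {\<rho>0}"
  shows "\<exists>a. 1 < cmod (\<rho>0 a) \<and> (\<forall>\<rho>\<in>T. cmod (\<rho> a) < 1)"
proof -
  have "finite T" using assms finite_places finite_subset by blast
  thus ?thesis using assms(2)
  proof (induction T rule: finite_induct)
    case empty
    have "cmod (\<rho>0 (of_nat 2)) = 2" by (subst emb_of_nat[OF assms(1)]) simp
    thus ?case by (intro exI[of _ "of_nat 2"]) auto
  next
    case (insert \<tau> T)
    then obtain a where a: "1 < cmod (\<rho>0 a)" "\<And>\<rho>. \<rho> \<in> T \<Longrightarrow> cmod (\<rho> a) < 1" by auto
    have \<tau>: "\<tau> \<in> S" "\<tau> \<noteq> \<rho>0" and TS: "\<And>\<rho>. \<rho> \<in> T \<Longrightarrow> \<rho> \<in> S" using insert.prems by auto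
    obtain b where b: "cmod (\<tau> b) < 1" "1 < cmod (\<rho>0 b)"
      using separate_places[OF \<tau>(1) assms(1) \<tau>(2)] .
    show ?case
    proof (cases "cmod (\<tau> a) \<le> 1")
      case True
      have "\<forall>\<^sub>F n in sequentially. \<forall>\<rho>\<in>T. cmod (\<rho> (a ^ n * b)) < 1"
      proof (intro eventually_ball_finite insert.hyps ballI)
        fix \<rho> assume \<rho>: "\<rho> \<in> T"
        have "(\<lambda>n. cmod (\<rho> a) ^ n * cmod (\<rho> b)) \<longlonglongrightarrow> 0 * cmod (\<rho> b)"
          using a(2)[OF \<rho>] by (intro tendsto_intros LIMSEQ_power_zero) auto
        hence "\<forall>\<^sub>F n in sequentially. cmod (\<rho> a) ^ n * cmod (\<rho> b) < 1"
          by (rule order_tendstoD) simp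
        thus "\<forall>\<^sub>F n in sequentially. cmod (\<rho> (a ^ n * b)) < 1"
          by (simp add: emb_mult[OF TS[OF \<rho>]] emb_power[OF TS[OF \<rho>]] norm_mult norm_power)
      qed
      then obtain n where n: "\<forall>\<rho>\<in>T. cmod (\<rho> (a ^ n * b)) < 1"
        unfolding eventually_sequentially by blast
      have "1 < cmod (\<rho>0 a) ^ n * cmod (\<rho>0 b)"
        using a(1) b(2) by (metis less_1_mult less_eq_real_def mult_1 one_le_power order_le_less)
      moreover have "cmod (\<tau> a) ^ n * cmod (\<tau> b) < 1"
      proof -
        have "cmod (\<tau> a) ^ n * cmod (\<tau> b) \<le> 1 * cmod (\<tau> b)"
          using True by (intro mult_right_mono power_le_one) auto
        thus ?thesis using b(1) by simp
      qed
      ultimately show ?thesis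
        using n by (intro exI[of _ "a ^ n * b"])
          (auto simp: emb_mult[OF \<tau>(1)] emb_mult[OF assms(1)] emb_power[OF \<tau>(1)]
             emb_power[OF assms(1)] norm_mult norm_power)
    next
      case False
      define f where "f = (\<lambda>n. a ^ n / (1 + a ^ n) * b)"
      have f: "\<rho> (f n) = \<rho> a ^ n / (1 + \<rho> a ^ n) * \<rho> b" if "\<rho> \<in> S" for \<rho> n
        by (simp add: f_def emb_mult[OF that] emb_divide[OF that] emb_power[OF that]
            emb_add[OF that] emb_1[OF that])
      have lim1: "(\<lambda>n. cmod (\<rho> (f n))) \<longlonglongrightarrow> cmod (1 * \<rho> b)" if "\<rho> \<in> S" "1 < cmod (\<rho> a)" for \<rho>
        unfolding f[OF that(1)] using that(2) by (intro tendsto_intros tendsto_power_ratio)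
      have lim0: "(\<lambda>n. cmod (\<rho> (f n))) \<longlonglongrightarrow> cmod (0 * \<rho> b)" if "\<rho> \<in> S" "cmod (\<rho> a) < 1" for \<rho>
        unfolding f[OF that(1)] using that(2) by (intro tendsto_intros tendsto_power_ratio)
      have "\<forall>\<^sub>F n in sequentially. \<forall>\<rho>\<in>T. cmod (\<rho> (f n)) < 1"
        using insert.hyps(1) TS a(2) by (intro eventually_ball_finite ballI order_tendstoD(2)[OF lim0]) auto
      moreover have "\<forall>\<^sub>F n in sequentially. cmod (\<tau> (f n)) < 1"
        using \<tau> b(1) False by (intro order_tendstoD(2)[OF lim1]) auto
      moreover have "\<forall>\<^sub>F n in sequentially. 1 < cmod (\<rho>0 (f n))"
        using assms(1) b(2) a(1) by (intro order_tendstoD(1)[OF lim1]) auto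
      ultimately have "\<forall>\<^sub>F n in sequentially. 1 < cmod (\<rho>0 (f n)) \<and> (\<forall>\<rho>\<in>insert \<tau> T. cmod (\<rho> (f n)) < 1)"
        by eventually_elim auto
      thus ?thesis unfolding eventually_sequentially by blast
    qed
  qed
qed

text \<open>Each coordinate is approximated separately by some \<open>c \<rho>\<close>. The weights
  \<open>a \<sigma> ^ n / (1 + a \<sigma> ^ n)\<close> tend to 1 at \<open>\<sigma>\<close> and to 0
  at the other places, so the weighted sum approximates all coordinates at once.\<close>

lemma weak_approximation:
  assumes x: "\<And>\<rho>. \<rho> \<in> S \<Longrightarrow> x \<rho> \<in> place_field \<rho>" and e: "e > 0"
  obtains k where "\<And>\<rho>. \<rho> \<in> S \<Longrightarrow> cmod (x \<rho> - \<rho> k) < e"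
proof -
  have "\<forall>\<rho>\<in>S. \<exists>k. cmod (x \<rho> - \<rho> k) < e"
    using embedding_dense embedding x e by metis
  then obtain c where c: "\<And>\<rho>. \<rho> \<in> S \<Longrightarrow> cmod (x \<rho> - \<rho> (c \<rho>)) < e" by metis
  have "\<forall>\<sigma>\<in>S. \<exists>a. 1 < cmod (\<sigma> a) \<and> (\<forall>\<rho>\<in>S - {\<sigma>}. cmod (\<rho> a) < 1)"
    using ex_dominant by blast
  then obtain a where a: "\<And>\<sigma>. \<sigma> \<in> S \<Longrightarrow> 1 < cmod (\<sigma> (a \<sigma>))"
     "\<And>\<sigma> \<rho>. \<sigma> \<in> S \<Longrightarrow> \<rho> \<in> S \<Longrightarrow> \<rho> \<noteq> \<sigma> \<Longrightarrow> cmod (\<rho> (a \<sigma>)) < 1" by (metis DiffI singletonD)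
  define k where "k = (\<lambda>n. \<Sum>\<sigma>\<in>S. c \<sigma> * (a \<sigma> ^ n / (1 + a \<sigma> ^ n)))"
  have "\<forall>\<^sub>F n in sequentially. \<forall>\<rho>\<in>S. cmod (x \<rho> - \<rho> (k n)) < e"
  proof (intro eventually_ball_finite finite_places ballI)
    fix \<rho> assume \<rho>: "\<rho> \<in> S"
    have "(\<lambda>n. \<Sum>\<sigma>\<in>S. \<rho> (c \<sigma>) * (\<rho> (a \<sigma>) ^ n / (1 + \<rho> (a \<sigma>) ^ n)))
       \<longlonglongrightarrow> (\<Sum>\<sigma>\<in>S. \<rho> (c \<sigma>) * (if \<sigma> = \<rho> then 1 else 0))"
      using \<rho> a by (intro tendsto_intros) (auto intro: tendsto_power_ratio)
    also have "(\<Sum>\<sigma>\<in>S. \<rho> (c \<sigma>) * (if \<sigma> = \<rho> then 1 else 0)) = \<rho> (c \<rho>)"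
      using \<rho> finite_places by (simp add: if_distrib sum.delta cong: if_cong)
    also have "(\<lambda>n. \<Sum>\<sigma>\<in>S. \<rho> (c \<sigma>) * (\<rho> (a \<sigma>) ^ n / (1 + \<rho> (a \<sigma>) ^ n))) = (\<lambda>n. \<rho> (k n))"
      by (simp add: k_def emb_sum[OF \<rho>] emb_mult[OF \<rho>] emb_divide[OF \<rho>] emb_add[OF \<rho>]
          emb_1[OF \<rho>] emb_power[OF \<rho>])
    finally have "(\<lambda>n. cmod (x \<rho> - \<rho> (k n))) \<longlonglongrightarrow> cmod (x \<rho> - \<rho> (c \<rho>))"
      by (intro tendsto_intros)
    thus "\<forall>\<^sub>F n in sequentially. cmod (x \<rho> - \<rho> (k n)) < e"
      by (rule order_tendstoD) (rule c[OF \<rho>])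
  qed
  thus ?thesis using that unfolding eventually_sequentially by blast
qed

lemma finite_net:
  assumes "e > 0"
  obtains G :: "('k \<Rightarrow> complex) \<Rightarrow> complex set"
  where "\<And>\<rho>. finite (G \<rho>)" "\<And>\<rho>. G \<rho> \<subseteq> place_field \<rho>"
    "\<And>\<rho> z. z \<in> place_field \<rho> \<Longrightarrow> cmod z \<le> r \<Longrightarrow> \<exists>g\<in>G \<rho>. cmod (z - g) < e"
proof -
  have "\<exists>k. finite k \<and> k \<subseteq> place_field \<rho> \<inter> cball 0 r \<and> place_field \<rho> \<inter> cball 0 r \<subseteq> (\<Union>x\<in>k. ball x e)"
    for \<rho> :: "'k \<Rightarrow> complex"
  proof -
    have "compact (place_field \<rho> \<inter> cball 0 r)"
      by (intro closed_Int_compact closed_place_field compact_cball)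
    hence "seq_compact (place_field \<rho> \<inter> cball 0 r)" by (simp add: compact_eq_seq_compact_metric)
    thus ?thesis using seq_compact_imp_totally_bounded assms by blast
  qed
  then obtain G where G: "\<And>\<rho> :: 'k \<Rightarrow> complex. finite (G \<rho>)"
     "\<And>\<rho>. G \<rho> \<subseteq> place_field \<rho> \<inter> cball 0 r" "\<And>\<rho>. place_field \<rho> \<inter> cball 0 r \<subseteq> (\<Union>x\<in>G \<rho>. ball x e)"
    by metis
  show ?thesis
  proof (rule that[of G])
    fix \<rho> :: "'k \<Rightarrow> complex" and z assume "z \<in> place_field \<rho>" "cmod z \<le> r"
    hence "z \<in> place_field \<rho> \<inter> cball 0 r" by simp
    hence "z \<in> (\<Union>x\<in>G \<rho>. ball x e)" using G(3)[of \<rho>] by (rule subsetD[rotated])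
    thus "\<exists>g\<in>G \<rho>. cmod (z - g) < e" by (auto simp: dist_norm norm_minus_commute[of z])
  qed (use G in auto)
qed

lemma common_integral_multiple:
  assumes "finite A"
  shows "\<exists>m::nat. 0 < m \<and> (\<forall>k\<in>A. algebraic_int (of_nat m * k :: 'k))"
  using assms
proof (induction A rule: finite_induct)
  case empty
  thus ?case by auto
next
  case (insert k A)
  then obtain m :: nat where m: "0 < m" "\<forall>k\<in>A. algebraic_int (of_nat m * k)" by blast
  obtain n :: nat where n: "0 < n" "algebraic_int (of_nat n * k)"
    using number_field_integral_multiple[OF number_field] by blast
  have "algebraic_int (of_nat (n * m) * y)" if "y \<in> insert k A" for y
  proof (cases "y = k")
    case True
    have "of_nat (n * m) * y = of_nat m * (of_nat n * k)" using True by (simp add: mult_ac)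
    also have "algebraic_int \<dots>" using n(2) by (rule algebraic_int_add_mult(2)[rotated]) simp
    finally show ?thesis .
  next
    case False
    have "of_nat (n * m) * y = of_nat n * (of_nat m * y)" by (simp add: mult_ac)
    also have "algebraic_int \<dots>"
      using m(2) False that by (intro algebraic_int_add_mult(2)[of "of_nat n"]) auto
    finally show ?thesis .
  qed
  thus ?case using m(1) n(1) by (intro exI[of _ "n * m"]) auto
qed

text \<open>Finitely many field elements approximate the unit polydisc to within 1/2, and one
  positive integer \<open>m\<close> clears all their denominators. Rescaled, this halves a bound
  \<open>2 ^ Suc j * m\<close> by subtracting an integer; repetition ends at the bound
  \<open>m\<close>.\<close>

lemma integers_cocompact:
  obtains C where "C > 0"
    "\<And>x. (\<And>\<rho>. \<rho> \<in> S \<Longrightarrow> x \<rho> \<in> place_field \<rho>) \<Longrightarrow> \<exists>a. algebraic_int a \<and> (\<forall>\<rho>\<in>S. cmod (x \<rho> - \<rho> a) \<le> C)"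
proof -
  \<comment> \<open>Of the tolerance 1/2, one quarter is spent on the net and one quarter on
    approximating its points by field elements.\<close>
  obtain G :: "('k \<Rightarrow> complex) \<Rightarrow> complex set" where G: "\<And>\<rho>. finite (G \<rho>)" "\<And>\<rho>. G \<rho> \<subseteq> place_field \<rho>"
    "\<And>\<rho> z. z \<in> place_field \<rho> \<Longrightarrow> cmod z \<le> 1 \<Longrightarrow> \<exists>g\<in>G \<rho>. cmod (z - g) < 1 / 4"
    using finite_net[of "1/4" 1] by auto
  have "\<forall>g\<in>Pi\<^sub>E S G. \<exists>k. \<forall>\<rho>\<in>S. cmod (g \<rho> - \<rho> k) < 1 / 4"
  proof
    fix g assume g: "g \<in> Pi\<^sub>E S G"
    show "\<exists>k. \<forall>\<rho>\<in>S. cmod (g \<rho> - \<rho> k) < 1 / 4"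
      by (rule weak_approximation[of g "1/4"]) (use g G(2) in \<open>auto dest: PiE_mem\<close>)
  qed
  then obtain k where k: "\<And>g \<rho>. g \<in> Pi\<^sub>E S G \<Longrightarrow> \<rho> \<in> S \<Longrightarrow> cmod (g \<rho> - \<rho> (k g)) < 1 / 4" by metis
  have "finite (k ` Pi\<^sub>E S G)" using finite_places G(1) by (intro finite_imageI finite_PiE)
  then obtain m :: nat where m: "0 < m" "\<And>g. g \<in> Pi\<^sub>E S G \<Longrightarrow> algebraic_int (of_nat m * k g)"
    using common_integral_multiple by (metis image_eqI)
  have near: "\<exists>a. algebraic_int (of_nat m * a) \<and> (\<forall>\<rho>\<in>S. cmod (x \<rho> - \<rho> a) \<le> 1 / 2)"
    if x: "\<And>\<rho>. \<rho> \<in> S \<Longrightarrow> x \<rho> \<in> place_field \<rho> \<and> cmod (x \<rho>) \<le> 1" for x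
  proof -
    have "\<forall>\<rho>\<in>S. \<exists>g\<in>G \<rho>. cmod (x \<rho> - g) < 1 / 4" using x G(3) by blast
    then obtain g0 where g0: "\<And>\<rho>. \<rho> \<in> S \<Longrightarrow> g0 \<rho> \<in> G \<rho> \<and> cmod (x \<rho> - g0 \<rho>) < 1 / 4" by metis
    define g where "g = restrict g0 S"
    have g: "g \<in> Pi\<^sub>E S G" using g0 by (auto simp: g_def)
    have "cmod (x \<rho> - \<rho> (k g)) \<le> 1 / 2" if \<rho>: "\<rho> \<in> S" for \<rho>
    proof -
      have "cmod (x \<rho> - g \<rho>) < 1 / 4" using g0[OF \<rho>] \<rho> by (simp add: g_def)
      moreover have "cmod (x \<rho> - \<rho> (k g)) \<le> cmod (x \<rho> - g \<rho>) + cmod (g \<rho> - \<rho> (k g))"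
        by (metis diff_add_cancel add_diff_eq norm_triangle_ineq)
      ultimately show ?thesis using k[OF g \<rho>] by linarith
    qed
    thus ?thesis using m(2)[OF g] by blast
  qed
  have step: "\<forall>x. (\<forall>\<rho>\<in>S. x \<rho> \<in> place_field \<rho> \<and> cmod (x \<rho>) \<le> 2 ^ j * real m) \<longrightarrow>
      (\<exists>a. algebraic_int a \<and> (\<forall>\<rho>\<in>S. cmod (x \<rho> - \<rho> a) \<le> real m))" for j
  proof (induction j)
    case 0
    show ?case by (auto simp: emb_0 intro!: exI[of _ 0])
  next
    case (Suc j)
    show ?case
    proof (intro allI impI)
      fix x assume x: "\<forall>\<rho>\<in>S. x \<rho> \<in> place_field \<rho> \<and> cmod (x \<rho>) \<le> 2 ^ Suc j * real m"
      \<comment> \<open>The scale is a natural multiple of \<open>m\<close>, so that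
        \<open>R\<close> times the approximant \<open>b\<close> is an algebraic integer.\<close>
      define R where "R = 2 ^ Suc j * real m"
      have R: "R > 0" using m(1) by (simp add: R_def)
      have y: "x \<rho> / of_real R \<in> place_field \<rho> \<and> cmod (x \<rho> / of_real R) \<le> 1" if "\<rho> \<in> S" for \<rho>
        using x[folded R_def] R that by (auto intro!: place_field_closed simp: norm_divide)
      obtain b where b: "algebraic_int (of_nat m * b)"
        "\<forall>\<rho>\<in>S. cmod (x \<rho> / of_real R - \<rho> b) \<le> 1 / 2" using near[of "\<lambda>\<rho>. x \<rho> / of_real R"] y by blast
      define a where "a = of_nat (2 ^ Suc j * m) * b"
      have "a = of_nat (2 ^ Suc j) * (of_nat m * b)" by (simp add: a_def)
      also have "algebraic_int \<dots>"
        using b(1) by (rule algebraic_int_add_mult(2)[OF algebraic_int_of_nat])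
      finally have a: "algebraic_int a" .
      have \<rho>a: "\<rho> a = of_real R * \<rho> b" if "\<rho> \<in> S" for \<rho>
        unfolding a_def by (simp only: emb_mult[OF that] emb_of_nat[OF that] R_def) simp
      have "cmod (x \<rho> - \<rho> a) \<le> 2 ^ j * real m" if \<rho>: "\<rho> \<in> S" for \<rho>
      proof -
        have "x \<rho> - \<rho> a = of_real R * (x \<rho> / of_real R - \<rho> b)"
          using R by (simp add: \<rho>a[OF \<rho>] right_diff_distrib)
        hence "cmod (x \<rho> - \<rho> a) = R * cmod (x \<rho> / of_real R - \<rho> b)"
          using R by (simp add: norm_mult)
        also have "\<dots> \<le> R * (1 / 2)" using b(2) \<rho> R by (intro mult_left_mono) auto
        finally show ?thesis by (simp add: R_def)
      qed
      moreover have "x \<rho> - \<rho> a \<in> place_field \<rho>" if "\<rho> \<in> S" for \<rho>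
        using x that by (intro place_field_closed embedding_in_place_field) auto
      ultimately obtain c where c: "algebraic_int c" "\<forall>\<rho>\<in>S. cmod ((x \<rho> - \<rho> a) - \<rho> c) \<le> real m"
        using Suc.IH[rule_format, of "\<lambda>\<rho>. x \<rho> - \<rho> a"] by auto
      have "\<forall>\<rho>\<in>S. cmod (x \<rho> - \<rho> (a + c)) \<le> real m"
        using c(2) by (simp add: emb_add diff_diff_eq)
      thus "\<exists>a. algebraic_int a \<and> (\<forall>\<rho>\<in>S. cmod (x \<rho> - \<rho> a) \<le> real m)"
        using algebraic_int_add_mult(1)[OF a c(1)] by blast
    qed
  qed
  show ?thesis
  proof (rule that[of "real m"])
    fix x assume x: "\<And>\<rho>. \<rho> \<in> S \<Longrightarrow> x \<rho> \<in> place_field \<rho>"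
    have "\<forall>\<^sub>F j in sequentially. \<forall>\<rho>\<in>S. cmod (x \<rho>) \<le> 2 ^ j * real m"
    proof (intro eventually_ball_finite finite_places ballI)
      fix \<rho>
      show "\<forall>\<^sub>F j in sequentially. cmod (x \<rho>) \<le> 2 ^ j * real m"
      proof (rule eventually_sequentiallyI[of "nat \<lceil>cmod (x \<rho>)\<rceil>"])
        fix j assume "nat \<lceil>cmod (x \<rho>)\<rceil> \<le> j"
        hence "cmod (x \<rho>) \<le> real j" by linarith
        also have "\<dots> \<le> 2 ^ j" using of_nat_less_two_power[of j, where 'a = real] by simp
        also have "\<dots> \<le> 2 ^ j * real m" using m(1) by simp
        finally show "cmod (x \<rho>) \<le> 2 ^ j * real m" .
      qed
    qed
    then obtain j where "\<forall>\<rho>\<in>S. cmod (x \<rho>) \<le> 2 ^ j * real m"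
      unfolding eventually_sequentially by blast
    thus "\<exists>a. algebraic_int a \<and> (\<forall>\<rho>\<in>S. cmod (x \<rho> - \<rho> a) \<le> real m)"
      using step[of j] x by blast
  qed (use m in auto)
qed

text \<open>Pigeonhole: the completions being locally compact, a finite net covers the bounded
  region, and infinitely many points force two of them to share a net point.\<close>

lemma close_pair:
  assumes "T \<subseteq> S" "infinite A" "\<And>a \<rho>. a \<in> A \<Longrightarrow> \<rho> \<in> T \<Longrightarrow> cmod (\<rho> a) \<le> C" "e > 0"
  obtains a b where "a \<in> A" "b \<in> A" "a \<noteq> b" "\<And>\<rho>. \<rho> \<in> T \<Longrightarrow> cmod (\<rho> (a - b)) < e"
proof -
  obtain G :: "('k \<Rightarrow> complex) \<Rightarrow> complex set" where G: "\<And>\<rho>. finite (G \<rho>)"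
    "\<And>\<rho> z. z \<in> place_field \<rho> \<Longrightarrow> cmod z \<le> C \<Longrightarrow> \<exists>g\<in>G \<rho>. cmod (z - g) < e / 2"
    using finite_net[OF half_gt_zero[OF assms(4)], of C] by metis
  have T: "finite T" using assms(1) finite_places finite_subset by blast
  have "\<forall>a\<in>A. \<exists>g. g \<in> Pi\<^sub>E T G \<and> (\<forall>\<rho>\<in>T. cmod (\<rho> a - g \<rho>) < e / 2)"
  proof
    fix a assume a: "a \<in> A"
    have "\<forall>\<rho>\<in>T. \<exists>g\<in>G \<rho>. cmod (\<rho> a - g) < e / 2"
      using G(2) embedding_in_place_field assms(3)[OF a] by blast
    then obtain g where g: "\<forall>\<rho>\<in>T. g \<rho> \<in> G \<rho> \<and> cmod (\<rho> a - g \<rho>) < e / 2" by metis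
    thus "\<exists>g. g \<in> Pi\<^sub>E T G \<and> (\<forall>\<rho>\<in>T. cmod (\<rho> a - g \<rho>) < e / 2)"
      by (intro exI[of _ "restrict g T"]) auto
  qed
  then obtain g where g: "\<And>a. a \<in> A \<Longrightarrow> g a \<in> Pi\<^sub>E T G"
    "\<And>a \<rho>. a \<in> A \<Longrightarrow> \<rho> \<in> T \<Longrightarrow> cmod (\<rho> a - g a \<rho>) < e / 2" by metis
  have "finite (g ` A)"
    by (rule finite_subset[of _ "Pi\<^sub>E T G"]) (use g(1) T G(1) in \<open>auto intro!: finite_PiE\<close>)
  hence "\<not> inj_on g A" using assms(2) finite_imageD by blast
  then obtain a b where ab: "a \<in> A" "b \<in> A" "a \<noteq> b" "g a = g b" by (auto simp: inj_on_def)
  have "cmod (\<rho> (a - b)) < e" if \<rho>: "\<rho> \<in> T" for \<rho>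
  proof -
    have "\<rho> (a - b) = (\<rho> a - g a \<rho>) - (\<rho> b - g b \<rho>)"
      using ab(4) assms(1) \<rho> by (simp add: emb_diff subset_iff)
    hence "cmod (\<rho> (a - b)) \<le> cmod (\<rho> a - g a \<rho>) + cmod (\<rho> b - g b \<rho>)"
      by (metis norm_triangle_ineq4)
    thus ?thesis using g(2)[OF ab(1) \<rho>] g(2)[OF ab(2) \<rho>] by linarith
  qed
  thus ?thesis using that ab by blast
qed

text \<open>Integers near the points \<open>3 * C * j\<close> on the axis of \<open>\<rho>0\<close>
  are bounded at all other places. They are distinct because the spacing \<open>3 * C\<close>
  exceeds the sum of two errors \<open>C\<close>. Two of them that are close away from
  \<open>\<rho>0\<close> have the required difference.\<close>

lemma ex_small_integer:
  assumes \<rho>0: "\<rho>0 \<in> S" and e: "e > 0"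
  obtains a where "algebraic_int a" "a \<noteq> 0" "\<And>\<rho>. \<rho> \<in> S - {\<rho>0} \<Longrightarrow> cmod (\<rho> a) < e"
proof -
  obtain C where C: "C > 0"
    "\<And>x. (\<And>\<rho>. \<rho> \<in> S \<Longrightarrow> x \<rho> \<in> place_field \<rho>) \<Longrightarrow> \<exists>a. algebraic_int a \<and> (\<forall>\<rho>\<in>S. cmod (x \<rho> - \<rho> a) \<le> C)"
    using integers_cocompact by blast
  define x where "x = (\<lambda>(j::nat) \<rho>. if \<rho> = \<rho>0 then complex_of_real (3 * C * real j) else 0)"
  have "x j \<rho> \<in> place_field \<rho>" for j \<rho>
    using of_real_in_place_field[of 0 \<rho>] by (auto simp: x_def simp del: of_real_mult)
  hence "\<forall>j. \<exists>a. algebraic_int a \<and> (\<forall>\<rho>\<in>S. cmod (x j \<rho> - \<rho> a) \<le> C)"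
    using C(2) by blast
  then obtain a where a: "\<And>j. algebraic_int (a j)" "\<And>j \<rho>. \<rho> \<in> S \<Longrightarrow> cmod (x j \<rho> - \<rho> (a j)) \<le> C"
    by metis
  have "inj a"
  proof (rule injI, rule ccontr)
    fix i j assume ij: "a i = a j" "i \<noteq> j"
    have "x i \<rho>0 - x j \<rho>0 = of_real (3 * C * (real i - real j))"
      by (simp add: x_def algebra_simps)
    hence "cmod (x i \<rho>0 - x j \<rho>0) = 3 * C * \<bar>real i - real j\<bar>"
      using C(1) by (simp only: norm_of_real) (simp add: abs_mult)
    also have "\<dots> \<ge> 3 * C * 1" using ij(2) C(1) by (intro mult_left_mono) auto
    finally have "cmod (x i \<rho>0 - x j \<rho>0) \<ge> 3 * C" by simp
    moreover have "x i \<rho>0 - x j \<rho>0 = (x i \<rho>0 - \<rho>0 (a i)) - (x j \<rho>0 - \<rho>0 (a j))"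
      using ij(1) by simp
    hence "cmod (x i \<rho>0 - x j \<rho>0) \<le> cmod (x i \<rho>0 - \<rho>0 (a i)) + cmod (x j \<rho>0 - \<rho>0 (a j))"
      by (metis norm_triangle_ineq4)
    ultimately show False using a(2)[OF \<rho>0, of i] a(2)[OF \<rho>0, of j] C(1) by linarith
  qed
  hence inf: "infinite (range a)" by (simp add: range_inj_infinite)
  have bdd: "cmod (\<rho> b) \<le> C" if b: "b \<in> range a" "\<rho> \<in> S - {\<rho>0}" for b \<rho>
  proof -
    obtain j where "b = a j" using b by auto
    thus ?thesis using a(2)[of \<rho> j] b by (simp add: x_def)
  qed
  obtain b c where bc: "b \<in> range a" "c \<in> range a" "b \<noteq> c" "\<And>\<rho>. \<rho> \<in> S - {\<rho>0} \<Longrightarrow> cmod (\<rho> (b - c)) < e"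
    using close_pair[of "S - {\<rho>0}" "range a" C e] inf bdd e by blast
  show ?thesis using that[of "b - c"] bc a(1) by (auto intro: algebraic_int_diff)
qed

text \<open>The \<open>h j\<close> are pairwise incongruent modulo the integers, so reducing them to
  a bounded region keeps them distinct, and pigeonhole gives a nonzero \<open>d \<in> H\<close> of
  size below \<open>e / (2 * C)\<close> at every place. By cocompactness the integral multiples of
  \<open>d\<close> come within \<open>e / 2\<close> of every point.\<close>

lemma dense_module:
  assumes H_diff: "\<And>x y. x \<in> H \<Longrightarrow> y \<in> H \<Longrightarrow> x - y \<in> H"
    and H_mult: "\<And>x y. x \<in> H \<Longrightarrow> algebraic_int y \<Longrightarrow> x * y \<in> H"
    and H_1: "1 \<in> H"
    and inf: "\<And>j::nat. h j \<in> H" "\<And>i j. i < j \<Longrightarrow> \<not> algebraic_int (h i - h j)"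
    and x: "\<And>\<rho>. \<rho> \<in> S \<Longrightarrow> x \<rho> \<in> place_field \<rho>" and e: "e > 0"
  obtains y where "y \<in> H" "\<And>\<rho>. \<rho> \<in> S \<Longrightarrow> cmod (x \<rho> - \<rho> y) < e"
proof -
  obtain C where C: "C > 0"
    "\<And>x. (\<And>\<rho>. \<rho> \<in> S \<Longrightarrow> x \<rho> \<in> place_field \<rho>) \<Longrightarrow> \<exists>a. algebraic_int a \<and> (\<forall>\<rho>\<in>S. cmod (x \<rho> - \<rho> a) \<le> C)"
    using integers_cocompact by blast
  have "\<forall>j. \<exists>a. algebraic_int a \<and> (\<forall>\<rho>\<in>S. cmod (\<rho> (h j) - \<rho> a) \<le> C)"
    using C(2)[of "\<lambda>\<rho>. \<rho> (h _)"] embedding_in_place_field by blast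
  then obtain a where a: "\<And>j. algebraic_int (a j)" "\<And>j \<rho>. \<rho> \<in> S \<Longrightarrow> cmod (\<rho> (h j) - \<rho> (a j)) \<le> C"
    by metis
  define g where "g = (\<lambda>j. h j - a j)"
  have gH: "g j \<in> H" for j
    using H_diff[OF inf(1) H_mult[OF H_1 a(1)]] by (simp add: g_def)
  have neq: "g i \<noteq> g j" if "i < j" for i j
  proof
    assume "g i = g j"
    hence "h i - h j = a i - a j" by (simp add: g_def algebra_simps)
    thus False using inf(2)[OF that] a(1) algebraic_int_diff by metis
  qed
  have "inj g" by (rule injI) (metis linorder_neqE_nat neq)
  hence infg: "infinite (range g)" by (simp add: range_inj_infinite)
  have bdd: "cmod (\<rho> b) \<le> C" if "b \<in> range g" "\<rho> \<in> S" for b \<rho>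
    using a(2)[OF that(2)] that by (auto simp: g_def emb_diff)
  have "e / (2 * C) > 0" using e C(1) by simp
  then obtain b c where bc: "b \<in> range g" "c \<in> range g" "b \<noteq> c" "\<And>\<rho>. \<rho> \<in> S \<Longrightarrow> cmod (\<rho> (b - c)) < e / (2 * C)"
    using close_pair[of S "range g" C "e / (2 * C)"] infg bdd by blast
  define d where "d = b - c"
  have dH: "d \<in> H" using bc gH H_diff by (auto simp: d_def)
  have d0: "d \<noteq> 0" using bc by (simp add: d_def)
  have "\<exists>a. algebraic_int a \<and> (\<forall>\<rho>\<in>S. cmod (x \<rho> / \<rho> d - \<rho> a) \<le> C)"
    using C(2)[of "\<lambda>\<rho>. x \<rho> / \<rho> d"] x place_field_closed(4) embedding_in_place_field by blast
  then obtain y where y: "algebraic_int y" "\<And>\<rho>. \<rho> \<in> S \<Longrightarrow> cmod (x \<rho> / \<rho> d - \<rho> y) \<le> C" by blast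
  have "cmod (x \<rho> - \<rho> (d * y)) < e" if \<rho>: "\<rho> \<in> S" for \<rho>
  proof -
    have "x \<rho> - \<rho> (d * y) = \<rho> d * (x \<rho> / \<rho> d - \<rho> y)"
      using d0 emb_eq_0_iff[OF \<rho>] by (simp add: emb_mult[OF \<rho>] right_diff_distrib)
    hence "cmod (x \<rho> - \<rho> (d * y)) = cmod (\<rho> d) * cmod (x \<rho> / \<rho> d - \<rho> y)"
      by (simp add: norm_mult)
    also have "\<dots> \<le> e / (2 * C) * C"
      using bc(4)[OF \<rho>] y(2)[OF \<rho>] e C(1) by (intro mult_mono) (auto simp: d_def)
    also have "\<dots> < e" using C(1) e by simp
    finally show ?thesis .
  qed
  thus ?thesis using that H_mult[OF dH y(1)] by blast
qed

end

section \<open>Denominators\<close>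

text \<open>The ideal of multipliers that make \<open>g\<close> integral. Unlike \<open>dnm\<close>
  it is defined without a coprime factorization, so its behaviour under translation and
  multiplication can be read off elementwise.\<close>

definition den :: "'k::field_char_0 \<Rightarrow> 'k set" where
  "den g = {x. algebraic_int x \<and> algebraic_int (x * g)}"

lemma carrier_ring_of_integers [simp]: "carrier ring_of_integers = {x. algebraic_int x}"
  by (simp add: ring_of_integers_def)

lemma ring_of_integers_ops [simp]:
  "mult ring_of_integers = (*)" "one ring_of_integers = 1"
  "zero ring_of_integers = 0" "add ring_of_integers = (+)"
  by (simp_all add: ring_of_integers_def field_ring_def)

lemma cring_ring_of_integers: "cring (ring_of_integers :: 'k::field_char_0 ring)"
proof (rule cringI)
  show "abelian_group (ring_of_integers :: 'k ring)"
    by (rule abelian_groupI)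
      (auto simp: algebraic_int_add_mult add_ac intro: exI[of _ "- x" for x])
  show "comm_monoid (ring_of_integers :: 'k ring)"
    by (rule comm_monoidI) (auto simp: algebraic_int_add_mult mult_ac)
qed (auto simp: algebra_simps)

text \<open>Elementwise form of an ideal, which keeps the arithmetic in the field type and away from
  the record structure.\<close>

definition integer_ideal :: "'k::field_char_0 set \<Rightarrow> bool" where
  "integer_ideal I \<longleftrightarrow> (\<forall>x\<in>I. algebraic_int x) \<and> 0 \<in> I \<and> (\<forall>x\<in>I. \<forall>y\<in>I. x + y \<in> I) \<and>
     (\<forall>x\<in>I. \<forall>a. algebraic_int a \<longrightarrow> a * x \<in> I)"

lemma integer_idealD:
  assumes "integer_ideal I"
  shows "x \<in> I \<Longrightarrow> algebraic_int x" "0 \<in> I" "x \<in> I \<Longrightarrow> y \<in> I \<Longrightarrow> x + y \<in> I"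
    "algebraic_int a \<Longrightarrow> x \<in> I \<Longrightarrow> a * x \<in> I"
  using assms by (auto simp: integer_ideal_def)

lemma integer_ideal_diff:
  assumes "integer_ideal I" "x \<in> I" "y \<in> I"
  shows "x - y \<in> I"
  using integer_idealD(3)[OF assms(1,2) integer_idealD(4)[OF assms(1) _ assms(3), of "- 1"]] by simp

lemma ideal_imp_integer_ideal:
  fixes I :: "'k::field_char_0 set"
  assumes "ideal I ring_of_integers"
  shows "integer_ideal I"
proof -
  interpret I: ideal I ring_of_integers by fact
  show ?thesis
    unfolding integer_ideal_def
  proof (intro conjI ballI allI impI)
    show "algebraic_int x" if "x \<in> I" for x using I.Icarr[OF that] by simp
    show "0 \<in> I" using additive_subgroup.zero_closed[OF I.is_additive_subgroup] by simp
    show "x + y \<in> I" if "x \<in> I" "y \<in> I" for x y using additive_subgroup.a_closed[OF I.is_additive_subgroup that] by simp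
    show "a * x \<in> I" if "x \<in> I" "algebraic_int a" for a x using I.I_l_closed[of x a] that by simp
  qed
qed

lemma integer_ideal_imp_ideal:
  fixes I :: "'k::field_char_0 set"
  assumes I: "integer_ideal I"
  shows "ideal I ring_of_integers"
proof (rule idealI)
  show "ring (ring_of_integers :: 'k ring)"
    using cring_ring_of_integers by (rule cring.axioms)
  show "subgroup I (add_monoid ring_of_integers)"
  proof (rule group.subgroupI)
    show "group (add_monoid (ring_of_integers :: 'k ring))"
      using cring_ring_of_integers abelian_group.a_group ring.is_abelian_group cring.axioms(1) by blast
    fix a assume a: "a \<in> I"
    have "inv\<^bsub>add_monoid ring_of_integers\<^esub> a = - a"
    proof -
      have "\<ominus>\<^bsub>ring_of_integers\<^esub> a = - a"
        using integer_idealD(1)[OF I a] cring_ring_of_integers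
        by (intro abelian_group.minus_equality ring.is_abelian_group cring.axioms(1)) auto
      thus ?thesis by (simp add: a_inv_def)
    qed
    moreover have "- a \<in> I" using integer_ideal_diff[OF I integer_idealD(2)[OF I] a] by simp
    ultimately show "inv\<^bsub>add_monoid ring_of_integers\<^esub> a \<in> I" by simp
  qed (use I in \<open>auto simp: integer_ideal_def\<close>)
  fix a x :: 'k assume "a \<in> I" "x \<in> carrier ring_of_integers"
  hence "x * a \<in> I" using integer_idealD(4)[OF I] by simp
  thus "x \<otimes>\<^bsub>ring_of_integers\<^esub> a \<in> I" "a \<otimes>\<^bsub>ring_of_integers\<^esub> x \<in> I"
    by (simp_all add: mult.commute)
qed

lemma integer_ideal_den: "integer_ideal (den g)"
  unfolding integer_ideal_def den_def
  by (auto simp: distrib_right mult.assoc intro: algebraic_int_add_mult)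

lemma integral_ideals_iff: "I \<in> integral_ideals \<longleftrightarrow> integer_ideal I \<and> I \<noteq> {0}"
  unfolding integral_ideals_def using ideal_imp_integer_ideal integer_ideal_imp_ideal by blast

lemma integer_ideal_scale_den:
  shows "integer_ideal ((*) g ` den g)"
  unfolding integer_ideal_def
proof (intro conjI ballI allI impI)
  show "0 \<in> (*) g ` den g" using integer_idealD(2)[OF integer_ideal_den] by (auto intro!: image_eqI[of _ _ 0])
  fix x assume "x \<in> (*) g ` den g"
  then obtain u where u: "x = g * u" "u \<in> den g" by blast
  show "algebraic_int x" using u by (auto simp: den_def mult.commute)
  show "a * x \<in> (*) g ` den g" if "algebraic_int a" for a
    using integer_idealD(4)[OF integer_ideal_den that u(2)] u(1) by (auto intro!: image_eqI[of _ _ "a * u"])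
  fix y assume "y \<in> (*) g ` den g"
  then obtain v where v: "y = g * v" "v \<in> den g" by blast
  show "x + y \<in> (*) g ` den g"
    using integer_idealD(3)[OF integer_ideal_den u(2) v(2)] u(1) v(1)
    by (auto intro!: image_eqI[of _ _ "u + v"] simp: distrib_left)
qed

lemma coprime_ideals_iff:
  fixes I J :: "'k::field_char_0 set"
  assumes "integer_ideal I" "integer_ideal J"
  shows "coprime_ideals I J \<longleftrightarrow> (\<exists>x\<in>I. \<exists>y\<in>J. x + y = 1)"
proof -
  have sum: "I <+>\<^bsub>ring_of_integers\<^esub> J = {z. \<exists>x\<in>I. \<exists>y\<in>J. z = x + y}"
    by (auto simp: set_add_def set_mult_def)
  show ?thesis
    unfolding coprime_ideals_def sum carrier_ring_of_integers
  proof
    assume "{z. \<exists>x\<in>I. \<exists>y\<in>J. z = x + y} = {x. algebraic_int x}"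
    hence "1 \<in> {z. \<exists>x\<in>I. \<exists>y\<in>J. z = x + y}" by simp
    thus "\<exists>x\<in>I. \<exists>y\<in>J. x + y = 1" by force
  next
    assume "\<exists>x\<in>I. \<exists>y\<in>J. x + y = 1"
    then obtain x y where xy: "x \<in> I" "y \<in> J" "x + y = 1" by blast
    show "{z. \<exists>x\<in>I. \<exists>y\<in>J. z = x + y} = {x. algebraic_int x}"
    proof (intro equalityI subsetI)
      fix z assume "z \<in> {z. \<exists>x\<in>I. \<exists>y\<in>J. z = x + y}"
      thus "z \<in> {x. algebraic_int x}"
        using integer_idealD(1)[OF assms(1)] integer_idealD(1)[OF assms(2)]
        by (auto intro: algebraic_int_add_mult(1))
    next
      fix z :: 'k assume "z \<in> {x. algebraic_int x}"
      hence "z * x \<in> I" "z * y \<in> J"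
        using xy integer_idealD(4)[OF assms(1)] integer_idealD(4)[OF assms(2)] by auto
      moreover have "z = z * x + z * y" using xy(3) by (metis distrib_left mult.right_neutral)
      ultimately show "z \<in> {z. \<exists>x\<in>I. \<exists>y\<in>J. z = x + y}" by blast
    qed
  qed
qed

lemma ideal_prod_principal_frac_ideal:
  fixes N :: "'k::field_char_0 set"
  assumes "integer_ideal N"
  shows "ideal_prod field_ring (principal_frac_ideal g) N = (*) g ` N"
proof
  show "ideal_prod field_ring (principal_frac_ideal g) N \<subseteq> (*) g ` N"
  proof
    fix x assume "x \<in> ideal_prod field_ring (principal_frac_ideal g) N"
    thus "x \<in> (*) g ` N"
    proof (induction x rule: ideal_prod.induct)
      case (prod i j)
      then obtain a where "i = g * a" "algebraic_int a" by (auto simp: principal_frac_ideal_def)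
      moreover from this have "a * j \<in> N" using prod assms integer_idealD(4) by blast
      ultimately show ?case by (auto simp: field_ring_def mult.assoc)
    next
      case (sum s1 s2)
      then obtain u v where "s1 = g * u" "s2 = g * v" "u \<in> N" "v \<in> N" by blast
      thus ?case using integer_idealD(3)[OF assms]
        by (auto simp: field_ring_def intro!: image_eqI[of _ _ "u + v"] simp: distrib_left)
    qed
  qed
  show "(*) g ` N \<subseteq> ideal_prod field_ring (principal_frac_ideal g) N"
  proof
    fix x assume "x \<in> (*) g ` N"
    then obtain u where u: "x = g * u" "u \<in> N" by blast
    have "g \<in> principal_frac_ideal g"
      unfolding principal_frac_ideal_def by (rule image_eqI[of _ _ 1]) auto
    hence "g \<otimes>\<^bsub>field_ring\<^esub> u \<in> ideal_prod field_ring (principal_frac_ideal g) N"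
      using u(2) by (rule ideal_prod.prod)
    thus "x \<in> ideal_prod field_ring (principal_frac_ideal g) N" by (simp add: u field_ring_def)
  qed
qed

lemma den_nonzero:
  fixes g :: "'k::field_char_0"
  assumes "number_field TYPE('k)"
  obtains x where "x \<in> den g" "x \<noteq> 0"
proof -
  obtain n :: nat where "0 < n" "algebraic_int (of_nat n * g)"
    using number_field_integral_multiple[OF assms] .
  thus ?thesis using that[of "of_nat n"] by (simp add: den_def)
qed

lemma den_in_integral_ideals:
  fixes g :: "'k::field_char_0"
  assumes "number_field TYPE('k)"
  shows "den g \<in> integral_ideals"
proof -
  obtain x where "x \<in> den g" "x \<noteq> 0" using den_nonzero[OF assms] .
  hence "den g \<noteq> {0}" by (metis singletonD)
  thus ?thesis by (simp add: integral_ideals_iff integer_ideal_den)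
qed

text \<open>Existence is the comaximality of \<open>den g\<close> and \<open>g * den g\<close>. For
  uniqueness, a competitor \<open>N\<close> contains \<open>m\<close> and \<open>n\<close> with
  \<open>g * m + n = 1\<close>, and then every \<open>x \<in> den g\<close> equals
  \<open>(x * g) * m + x * n\<close>, an element of \<open>N\<close>.\<close>

lemma dnm_eq_den:
  fixes g :: "'k::field_char_0"
  assumes nf: "number_field TYPE('k)"
  shows "dnm g = den g"
proof (cases "g = 0")
  case True
  thus ?thesis by (simp add: dnm_def den_def)
next
  case False
  let ?P = "\<lambda>N. N \<in> integral_ideals \<and> (\<exists>A\<in>integral_ideals. coprime_ideals A N \<and>
        ideal_prod field_ring (principal_frac_ideal g) N = A)"
  have "?P (den g)"
  proof (intro conjI bexI)
    show "den g \<in> integral_ideals" by (rule den_in_integral_ideals[OF nf])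
    show "ideal_prod field_ring (principal_frac_ideal g) (den g) = (*) g ` den g"
      by (rule ideal_prod_principal_frac_ideal[OF integer_ideal_den])
    obtain x where "x \<in> den g" "x \<noteq> 0" using den_nonzero[OF nf] .
    hence "g * x \<in> (*) g ` den g" "g * x \<noteq> 0" using False by auto
    hence "(*) g ` den g \<noteq> {0}" by (metis singletonD)
    thus "(*) g ` den g \<in> integral_ideals"
      using integer_ideal_scale_den[of g] by (simp add: integral_ideals_iff)
    obtain u v where uv: "algebraic_int u" "algebraic_int v" "algebraic_int (u * g)" "algebraic_int (v * g)"
      "u + v * g = 1" using number_field_comaximal_denominator[OF nf] .
    have "u \<in> den g" "g * v \<in> (*) g ` den g" using uv by (auto simp: den_def)
    moreover have "g * v + u = 1" using uv(5) by (simp add: add.commute mult.commute)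
    ultimately show "coprime_ideals ((*) g ` den g) (den g)"
      unfolding coprime_ideals_iff[OF integer_ideal_scale_den integer_ideal_den] by blast
  qed
  moreover have "N = den g" if N: "?P N" for N
  proof -
    have ideal: "integer_ideal N" using N by (simp add: integral_ideals_iff)
    have A: "(*) g ` N \<in> integral_ideals" "coprime_ideals ((*) g ` N) N"
      using N by (auto simp: ideal_prod_principal_frac_ideal[OF ideal])
    hence A': "integer_ideal ((*) g ` N)" by (simp add: integral_ideals_iff)
    obtain m n where mn: "m \<in> N" "n \<in> N" "g * m + n = 1"
      using A(2) unfolding coprime_ideals_iff[OF A' ideal] by blast
    show "N = den g"
    proof (intro equalityI subsetI)
      fix x assume "x \<in> N"
      hence "algebraic_int x" "algebraic_int (g * x)"
        using integer_idealD(1)[OF ideal] integer_idealD(1)[OF A'] by blast+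
      thus "x \<in> den g" by (simp add: den_def mult.commute)
    next
      fix x assume x: "x \<in> den g"
      have "x = (x * g) * m + x * n"
        using mn(3) by (metis distrib_left mult.assoc mult.right_neutral)
      moreover have "(x * g) * m \<in> N" "x * n \<in> N"
        using x mn integer_idealD(4)[OF ideal] by (auto simp: den_def)
      ultimately show "x \<in> N" using integer_idealD(3)[OF ideal] by metis
    qed
  qed
  ultimately have "(THE N. ?P N) = den g" by (rule the_equality)
  thus ?thesis using False by (simp add: dnm_def)
qed

section \<open>Denominators under translation and multiplication\<close>

lemma den_add_integer:
  assumes "algebraic_int b"
  shows "den (g + b) = den g"
proof -
  have "algebraic_int (y * (g + b)) \<longleftrightarrow> algebraic_int (y * g)" if "algebraic_int y" for y
    using algebraic_int_add_mult(1)[of "y * g" "y * b"] algebraic_int_diff[of "y * (g + b)" "y * b"]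
      algebraic_int_add_mult(2)[of y b] that assms
    by (auto simp: distrib_left)
  thus ?thesis by (auto simp: den_def)
qed

lemma den_power_mono:
  assumes "algebraic_int a"
  shows "den (a ^ M * g) \<subseteq> den (a ^ (M + i) * g)"
proof
  fix y assume y: "y \<in> den (a ^ M * g)"
  have "y * (a ^ (M + i) * g) = a ^ i * (y * (a ^ M * g))" by (simp add: power_add mult_ac)
  moreover have "algebraic_int (a ^ i * (y * (a ^ M * g)))"
    using y by (intro algebraic_int_add_mult(2)[OF algebraic_int_power[OF assms]]) (simp add: den_def)
  ultimately have "algebraic_int (y * (a ^ (M + i) * g))" by (simp only:)
  thus "y \<in> den (a ^ (M + i) * g)" using y by (simp add: den_def)
qed

text \<open>For integral \<open>a\<close>: the element \<open>1 - a * u\<close> lies in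
  \<open>den g\<close>, so \<open>a\<close> is a unit modulo the denominator of
  \<open>g\<close>.\<close>

definition den_coprime :: "'k::field_char_0 \<Rightarrow> 'k \<Rightarrow> bool" where
  "den_coprime a g \<longleftrightarrow> (\<exists>u. algebraic_int u \<and> algebraic_int ((1 - a * u) * g))"

text \<open>A unit modulo \<open>den g\<close> has unit powers; \<open>c\<close> is the multiplier
  witnessing this for \<open>a ^ M\<close>. The induction step multiplies the deficiency
  \<open>1 - a * u\<close> into the old relation.\<close>

lemma den_coprime_power:
  assumes "algebraic_int a" "den_coprime a g"
  obtains c v where "algebraic_int c" "algebraic_int v" "1 = a ^ M * v + c" "algebraic_int (c * g)"
proof -
  obtain u where u: "algebraic_int u" "algebraic_int ((1 - a * u) * g)"
    using assms(2) by (auto simp: den_coprime_def)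
  have "\<exists>c v. algebraic_int c \<and> algebraic_int v \<and> 1 = a ^ M * v + c \<and> algebraic_int (c * g)"
  proof (induction M)
    case 0
    show ?case by (intro exI[of _ 0] exI[of _ 1]) auto
  next
    case (Suc M)
    then obtain c v where cv: "algebraic_int c" "algebraic_int v" "1 = a ^ M * v + c" "algebraic_int (c * g)"
      by blast
    define c' where "c' = c + a ^ M * v * (1 - a * u)"
    have "algebraic_int c'" unfolding c'_def
      using cv u assms(1) by (intro algebraic_int_add_mult algebraic_int_power algebraic_int_diff) auto
    moreover have "algebraic_int (c' * g)"
    proof -
      have "c' * g = c * g + a ^ M * v * ((1 - a * u) * g)"
        by (simp add: c'_def algebra_simps)
      moreover have "algebraic_int (a ^ M * v)"
        using cv(2) assms(1) by (intro algebraic_int_add_mult(2) algebraic_int_power)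
      ultimately show ?thesis
        using algebraic_int_add_mult(1)[OF cv(4) algebraic_int_add_mult(2)[OF _ u(2)]] by simp
    qed
    moreover have "1 = a ^ Suc M * (v * u) + c'" using cv(3) by (simp add: c'_def algebra_simps)
    moreover have "algebraic_int (v * u)" using cv u by (intro algebraic_int_add_mult)
    ultimately show ?case by blast
  qed
  thus ?thesis using that by blast
qed

lemma den_coprime_add:
  assumes "den_coprime a g" "algebraic_int y" "algebraic_int a"
  shows "den_coprime a (g + y)"
proof -
  obtain u where u: "algebraic_int u" "algebraic_int ((1 - a * u) * g)"
    using assms(1) by (auto simp: den_coprime_def)
  have "(1 - a * u) * (g + y) = (1 - a * u) * g + (1 - a * u) * y" by (simp add: distrib_left)
  moreover have "algebraic_int ((1 - a * u) * y)"
    using u(1) assms by (intro algebraic_int_add_mult(2) algebraic_int_diff) auto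
  hence "algebraic_int ((1 - a * u) * g + (1 - a * u) * y)"
    by (rule algebraic_int_add_mult(1)[OF u(2)])
  ultimately show ?thesis using u(1) unfolding den_coprime_def by metis
qed

lemma den_coprime_mult:
  assumes "den_coprime a g" "algebraic_int y"
  shows "den_coprime a (y * g)"
proof -
  obtain u where u: "algebraic_int u" "algebraic_int ((1 - a * u) * g)"
    using assms(1) by (auto simp: den_coprime_def)
  have "(1 - a * u) * (y * g) = y * ((1 - a * u) * g)" by (simp add: mult_ac)
  moreover have "algebraic_int (y * ((1 - a * u) * g))" using assms(2) u(2) by (rule algebraic_int_add_mult(2))
  ultimately show ?thesis using u(1) unfolding den_coprime_def by metis
qed

text \<open>The inverse \<open>u\<close> of \<open>a\<close> modulo the denominator undoes the
  multiplication: \<open>x * g\<close> is \<open>u * (x * (a * g))\<close> up to the integer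
  \<open>x * ((1 - a * u) * g)\<close>.\<close>

lemma den_mult_coprime:
  assumes "den_coprime a g" "algebraic_int a"
  shows "den (a * g) = den g"
proof -
  obtain u where u: "algebraic_int u" "algebraic_int ((1 - a * u) * g)"
    using assms(1) by (auto simp: den_coprime_def)
  have "algebraic_int (x * g)" if x: "algebraic_int x" "algebraic_int (x * (a * g))" for x
  proof -
    have "x * g = u * (x * (a * g)) + x * ((1 - a * u) * g)" by (simp add: algebra_simps)
    thus ?thesis
      using algebraic_int_add_mult(1)[OF algebraic_int_add_mult(2)[OF u(1) x(2)]
          algebraic_int_add_mult(2)[OF x(1) u(2)]] by simp
  qed
  moreover have "algebraic_int (x * (a * g))" if "algebraic_int (x * g)" for x
    using algebraic_int_add_mult(2)[OF assms(2) that] by (simp add: mult_ac)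
  ultimately show ?thesis by (auto simp: den_def)
qed

text \<open>Coprime parts of a denominator cannot cancel: in \<open>1 = a ^ M * v + c\<close> the
  first summand clears the denominator of \<open>d\<close> and the second that of
  \<open>g\<close>.\<close>

lemma den_add_coprime:
  assumes "den_coprime a g" "algebraic_int a" "algebraic_int (a ^ M * d)"
  shows "den (g + d) = den g \<inter> den d"
proof -
  obtain c v where cv: "algebraic_int c" "algebraic_int v" "1 = a ^ M * v + c" "algebraic_int (c * g)"
    using den_coprime_power[OF assms(2,1)] .
  have xd: "algebraic_int (x * d)" if x: "algebraic_int x" "algebraic_int (x * (g + d))" for x
  proof -
    have "x * d = (a ^ M * v + c) * (x * d)" using cv(3) by simp
    also have "\<dots> = v * x * (a ^ M * d) + (c * (x * (g + d)) - x * (c * g))"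
      by (simp add: algebra_simps)
    also have "algebraic_int \<dots>"
      by (rule algebraic_int_add_mult(1)[OF
          algebraic_int_add_mult(2)[OF algebraic_int_add_mult(2)[OF cv(2) x(1)] assms(3)]
          algebraic_int_diff[OF algebraic_int_add_mult(2)[OF cv(1) x(2)]
            algebraic_int_add_mult(2)[OF x(1) cv(4)]]])
    finally show ?thesis .
  qed
  have "algebraic_int (x * g)" if x: "algebraic_int x" "algebraic_int (x * (g + d))" for x
    using algebraic_int_diff[OF x(2) xd[OF x]] by (simp add: distrib_left)
  moreover have "algebraic_int (x * (g + d))" if "algebraic_int (x * g)" "algebraic_int (x * d)" for x
    using algebraic_int_add_mult(1)[OF that] by (simp add: distrib_left)
  ultimately show ?thesis using xd by (auto simp: den_def)
qed

text \<open>Both denominators are \<open>den g \<inter> den d\<close>. Thus multiplication by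
  \<open>a\<close> about the centre \<open>d\<close> preserves denominators, although the
  denominator of \<open>d\<close> itself need not be prime to \<open>a\<close>.\<close>

lemma den_coprime_shift:
  assumes "den_coprime a g" "algebraic_int a" "algebraic_int (a ^ M * d)"
  shows "den (a * g + d) = den (g + d)"
  using den_add_coprime[OF assms] den_add_coprime[OF den_coprime_mult[OF assms(1,2)] assms(2,3)]
    den_mult_coprime[OF assms(1,2)] by simp

text \<open>Partial fractions: the relation \<open>1 = a ^ M * v + c\<close>, multiplied by
  \<open>g\<close>, splits off the summand annihilated by \<open>a ^ M\<close> modulo the
  integers.\<close>

lemma coprime_decomposition:
  assumes "algebraic_int a" "den_coprime a (a ^ M * g)"
  obtains g' d where "g = g' + d" "algebraic_int (a ^ M * d)" "den_coprime a g'"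
proof -
  obtain c v where cv: "algebraic_int c" "algebraic_int v" "1 = a ^ M * v + c" "algebraic_int (c * (a ^ M * g))"
    using den_coprime_power[OF assms] .
  show ?thesis
  proof (rule that[of "v * (a ^ M * g)" "c * g"])
    have "g = (a ^ M * v + c) * g" using cv(3) by simp
    thus "g = v * (a ^ M * g) + c * g" by (simp add: algebra_simps)
    show "algebraic_int (a ^ M * (c * g))" using cv(4) by (simp add: mult_ac)
    show "den_coprime a (v * (a ^ M * g))" using assms(2) cv(2) by (rule den_coprime_mult)
  qed
qed

section \<open>Denominators at a single prime over a fixed integer\<close>

definition maximal_ideals_over :: "'k::field_char_0 \<Rightarrow> 'k set set" where
  "maximal_ideals_over a = {q. integer_ideal q \<and> a \<in> q \<and> 1 \<notin> q \<and>
     (\<forall>J. integer_ideal J \<longrightarrow> q \<subseteq> J \<longrightarrow> 1 \<notin> J \<longrightarrow> J = q)}"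

lemma integer_ideal_add_principal:
  assumes "integer_ideal I" "algebraic_int s"
  shows "integer_ideal {x + b * s | x b. x \<in> I \<and> algebraic_int b}"
  unfolding integer_ideal_def
proof (intro conjI ballI allI impI)
  show "0 \<in> {x + b * s | x b. x \<in> I \<and> algebraic_int b}"
    using integer_idealD(2)[OF assms(1)] by force
  fix x assume "x \<in> {x + b * s | x b. x \<in> I \<and> algebraic_int b}"
  then obtain u b where u: "x = u + b * s" "u \<in> I" "algebraic_int b" by blast
  show "algebraic_int x" using u assms integer_idealD(1) by (auto intro!: algebraic_int_add_mult)
  fix a :: 'a assume a: "algebraic_int a"
  have "a * x = a * u + (a * b) * s" using u by (simp add: algebra_simps)
  thus "a * x \<in> {x + b * s | x b. x \<in> I \<and> algebraic_int b}"
    using u a integer_idealD(4)[OF assms(1) a] algebraic_int_add_mult(2) by blast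
next
  fix x y assume "x \<in> {x + b * s | x b. x \<in> I \<and> algebraic_int b}" "y \<in> {x + b * s | x b. x \<in> I \<and> algebraic_int b}"
  then obtain u b v c where "x = u + b * s" "u \<in> I" "algebraic_int b" "y = v + c * s" "v \<in> I" "algebraic_int c"
    by blast
  moreover from this have "x + y = (u + v) + (b + c) * s" by (simp add: algebra_simps)
  ultimately show "x + y \<in> {x + b * s | x b. x \<in> I \<and> algebraic_int b}"
    using integer_idealD(3)[OF assms(1)] algebraic_int_add_mult(1) by blast
qed

lemma maximal_ideal_prime:
  assumes q: "q \<in> maximal_ideals_over a" and "algebraic_int s" "algebraic_int t" "s * t \<in> q" "s \<notin> q"
  shows "t \<in> q"
proof -
  have ideal: "integer_ideal q" using q by (simp add: maximal_ideals_over_def)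
  define J where "J = {x + b * s | x b. x \<in> q \<and> algebraic_int b}"
  have J: "integer_ideal J" unfolding J_def by (rule integer_ideal_add_principal[OF ideal assms(2)])
  have "q \<subseteq> J" unfolding J_def by force
  moreover have "s \<in> J" unfolding J_def using integer_idealD(2)[OF ideal] by force
  ultimately have "1 \<in> J" using q J assms(5) unfolding maximal_ideals_over_def by blast
  then obtain x b where "1 = x + b * s" "x \<in> q" "algebraic_int b" unfolding J_def by blast
  moreover from this have "t = t * x + b * (s * t)"
    by (metis distrib_left mult.assoc mult.commute mult.right_neutral)
  ultimately show ?thesis using integer_idealD(3,4)[OF ideal] assms by metis
qed

text \<open>A common element outside \<open>q\<close> of the finitely many ideals containing \<open>a\<^bsup>M\<^esup>\<close> that are not
  contained in \<open>q\<close>; multiplication by it removes from \<open>K / \<O>\<close> the \<open>a\<^bsup>M\<^esup>\<close>-torsion away from \<open>q\<close>.\<close>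

lemma ex_local_element:
  assumes q: "q \<in> maximal_ideals_over a" and fin: "finite {I. integer_ideal I \<and> a ^ M \<in> I}"
  obtains e where "algebraic_int e" "e \<notin> q" "\<And>I. integer_ideal I \<Longrightarrow> a ^ M \<in> I \<Longrightarrow> \<not> I \<subseteq> q \<Longrightarrow> e \<in> I"
proof -
  define F where "F = {I. integer_ideal I \<and> a ^ M \<in> I \<and> \<not> I \<subseteq> q}"
  have "finite F" using fin by (rule rev_finite_subset) (auto simp: F_def)
  have "\<exists>t. \<forall>I\<in>F. t I \<in> I \<and> t I \<notin> q" unfolding F_def by (intro bchoice) blast
  then obtain t where t: "\<And>I. I \<in> F \<Longrightarrow> t I \<in> I" "\<And>I. I \<in> F \<Longrightarrow> t I \<notin> q" by blast
  have tint: "algebraic_int (t I)" if "I \<in> F" for I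
    using t(1)[OF that] that integer_idealD(1) by (auto simp: F_def)
  have prod: "prod t G \<notin> q \<and> algebraic_int (prod t G)" if "G \<subseteq> F" for G
  proof -
    have "finite G" using that \<open>finite F\<close> finite_subset by blast
    thus ?thesis using that
    proof (induction G rule: finite_induct)
      case empty
      show ?case using q by (simp add: maximal_ideals_over_def)
    next
      case (insert I G)
      hence "t I * prod t G \<notin> q"
        using maximal_ideal_prime[OF q tint[of I], of "prod t G"] t(2)[of I] by auto
      moreover have "algebraic_int (t I * prod t G)"
        using insert tint[of I] by (intro algebraic_int_add_mult(2)) auto
      ultimately show ?case using insert.hyps by simp
    qed
  qed
  show ?thesis
  proof (rule that[of "prod t F"])
    fix I assume "integer_ideal I" "a ^ M \<in> I" "\<not> I \<subseteq> q"
    hence I: "I \<in> F" "integer_ideal I" by (auto simp: F_def)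
    have "prod t F = prod t (F - {I}) * t I"
      using I(1) \<open>finite F\<close> by (simp add: prod.remove mult.commute)
    thus "prod t F \<in> I"
      using integer_idealD(4)[OF I(2) _ t(1)[OF I(1)]] prod[of "F - {I}"] by auto
  qed (use prod[of F] in auto)
qed

text \<open>In terms of valuations, the hypothesis on \<open>g\<close> says that the denominator of
  \<open>g\<close> is divisible by a higher power of \<open>q\<close> than \<open>a ^ M\<close> is.
  So \<open>y\<close> absorbs the \<open>q\<close>-part of \<open>a ^ M\<close>, while
  \<open>e\<close> absorbs the part prime to \<open>q\<close>. The argument applies the comaximal
  relation to \<open>y / a ^ M\<close>.\<close>

lemma den_local_subset:
  fixes a :: "'k::field_char_0"
  assumes nf: "number_field TYPE('k)" and q: "q \<in> maximal_ideals_over a"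
    and a: "algebraic_int a" "a \<noteq> 0"
    and e: "\<And>I. integer_ideal I \<Longrightarrow> a ^ M \<in> I \<Longrightarrow> \<not> I \<subseteq> q \<Longrightarrow> e \<in> I"
    and g: "den (a ^ M * g) \<subseteq> q" and y: "y \<in> den g"
  shows "algebraic_int (y * (e / a ^ M))"
proof -
  have ideal: "integer_ideal q" "1 \<notin> q" using q by (auto simp: maximal_ideals_over_def)
  define r where "r = y / a ^ M"
  have ar: "a ^ M * r = y" using a(2) by (simp add: r_def)
  obtain u v where uv: "algebraic_int u" "algebraic_int v" "algebraic_int (u * r)" "algebraic_int (v * r)"
    "u + v * r = 1" using number_field_comaximal_denominator[OF nf] .
  \<comment> \<open>The multiplier \<open>v * r\<close> belongs to \<open>den (a ^ M * g)\<close>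
    and so to \<open>q\<close>; as \<open>u + v * r = 1\<close>, the element \<open>u\<close> cannot
    lie there too.\<close>
  have "u \<notin> q"
  proof
    assume "u \<in> q"
    have "(v * r) * (a ^ M * g) = v * (y * g)" using ar by (metis mult.assoc mult.commute)
    moreover have "algebraic_int (v * (y * g))"
      using y by (intro algebraic_int_add_mult(2)[OF uv(2)]) (simp add: den_def)
    ultimately have "algebraic_int ((v * r) * (a ^ M * g))" by (simp only:)
    hence "v * r \<in> den (a ^ M * g)" using uv(4) by (simp add: den_def)
    hence "v * r \<in> q" using g by blast
    thus False using \<open>u \<in> q\<close> integer_idealD(3)[OF ideal(1), of u "v * r"] uv(5) ideal(2) by simp
  qed
  moreover have "u \<in> den r" using uv by (simp add: den_def)
  moreover have "a ^ M \<in> den r"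
    using a y by (simp add: den_def ar algebraic_int_power)
  ultimately have "e \<in> den r" using e[OF integer_ideal_den] by blast
  thus ?thesis by (simp add: den_def r_def mult_ac)
qed

text \<open>Every multiplier of \<open>g\<close>, or of the translate, also makes the translation
  vector integral, so the two multiplier sets agree. The second equation shows that the translate
  satisfies the same hypothesis at level \<open>j\<close>, so that the translation can be
  reversed.\<close>

lemma den_local_translate:
  fixes a :: "'k::field_char_0"
  assumes nf: "number_field TYPE('k)" and q: "q \<in> maximal_ideals_over a"
    and a: "algebraic_int a" "a \<noteq> 0"
    and e: "\<And>I. integer_ideal I \<Longrightarrow> a ^ M \<in> I \<Longrightarrow> \<not> I \<subseteq> q \<Longrightarrow> e \<in> I"
    and ei: "algebraic_int e" and x: "algebraic_int x" and "M \<le> j"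
    and g: "den (a ^ j * g) \<subseteq> q"
  shows "den (g + x * e / a ^ M) = den g" "den (a ^ j * (g + x * e / a ^ M)) = den (a ^ j * g)"
proof -
  define b where "b = x * e / a ^ M"
  have jb: "algebraic_int (a ^ j * b)" if "M \<le> j" for j
  proof -
    have "a ^ j * b = a ^ (j - M) * (x * e)"
      using a(2) that by (simp add: b_def power_diff)
    also have "algebraic_int \<dots>" using a x ei by (intro algebraic_int_add_mult algebraic_int_power)
    finally show ?thesis .
  qed
  have shift: "den (a ^ i * (h + b)) = den (a ^ i * h)" if "M \<le> i" for i h
    using den_add_integer[OF jb[OF that], of "a ^ i * h"] by (simp add: distrib_left)
  have sub: "den (a ^ M * h) \<subseteq> den (a ^ j * h)" for h
    using den_power_mono[OF a(1), of M h "j - M"] \<open>M \<le> j\<close> by simp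
  have yb: "algebraic_int (y * b)" if "den (a ^ M * h) \<subseteq> q" "y \<in> den h" for y h
    using algebraic_int_add_mult(2)[OF x den_local_subset[OF nf q a e that]]
    by (simp add: b_def mult_ac)
  have gM: "den (a ^ M * g) \<subseteq> q" using sub g by blast
  hence gM': "den (a ^ M * (g + b)) \<subseteq> q" using shift[of M g] by simp
  show "den (g + x * e / a ^ M) = den g"
    unfolding b_def[symmetric]
  proof (intro equalityI subsetI)
    fix y assume y: "y \<in> den (g + b)"
    thus "y \<in> den g"
      using algebraic_int_diff[OF _ yb[OF gM' y], of "y * (g + b)"] by (auto simp: den_def distrib_left)
  next
    fix y assume y: "y \<in> den g"
    thus "y \<in> den (g + b)"
      using algebraic_int_add_mult(1)[OF _ yb[OF gM y], of "y * g"] by (auto simp: den_def distrib_left)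
  qed
  show "den (a ^ j * (g + x * e / a ^ M)) = den (a ^ j * g)"
    unfolding b_def[symmetric] by (rule shift[OF \<open>M \<le> j\<close>])
qed

section \<open>Lebesgue measure on the product of the completions\<close>

text \<open>At a real place the measure of the line is carried to the real axis of the complex
  plane; it is then invariant under translations by \<open>place_field \<rho>\<close>.\<close>

definition place_measure :: "('k::field_char_0 \<Rightarrow> complex) \<Rightarrow> complex measure" where
  "place_measure \<rho> = (if real_embedding \<rho> then distr lborel borel complex_of_real else lborel)"

lemma sets_place_measure [simp, measurable_cong]: "sets (place_measure \<rho>) = sets borel"
  by (simp add: place_measure_def)

lemma space_place_measure [simp]: "space (place_measure \<rho>) = UNIV"
  by (simp add: place_measure_def)

lemma emeasure_place_measure_real:
  assumes "real_embedding \<rho>" "A \<in> sets borel"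
  shows "emeasure (place_measure \<rho>) A = emeasure lborel (complex_of_real -` A)"
  using assms by (simp add: place_measure_def emeasure_distr)

lemma emeasure_place_measure_ball_finite: "emeasure (place_measure \<rho>) (cball c r) < \<infinity>"
proof (cases "real_embedding \<rho>")
  case True
  have "complex_of_real -` cball c r \<subseteq> cball (Re c) r"
  proof
    fix x assume "x \<in> complex_of_real -` cball c r"
    hence "cmod (c - of_real x) \<le> r" by (simp add: dist_norm)
    moreover have "\<bar>Re (c - of_real x)\<bar> \<le> cmod (c - of_real x)" by (rule abs_Re_le_cmod)
    ultimately show "x \<in> cball (Re c) r" by (simp add: dist_real_def)
  qed
  hence "emeasure lborel (complex_of_real -` cball c r) \<le> emeasure lborel (cball (Re c) r)"
    by (rule emeasure_mono) simp
  also have "\<dots> < \<infinity>" by (rule emeasure_lborel_cball_finite)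
  finally show ?thesis using True by (simp add: emeasure_place_measure_real)
next
  case False
  thus ?thesis using emeasure_lborel_cball_finite[of c r] by (simp add: place_measure_def)
qed

lemma emeasure_place_measure_ball_pos:
  assumes "r > 0"
  shows "emeasure (place_measure \<rho>) (cball 0 r) > 0"
proof (cases "real_embedding \<rho>")
  case True
  have "complex_of_real -` cball 0 r = {- r..r}" by auto
  thus ?thesis using True assms by (simp add: emeasure_place_measure_real)
next
  case False
  have "emeasure lborel (cball (0::complex) r) \<noteq> 0"
    using content_cball_pos[OF assms, of "0::complex"] by (auto simp: measure_def)
  thus ?thesis using False by (simp add: place_measure_def zero_less_iff_neq_zero)
qed

lemma sigma_finite_place_measure: "sigma_finite_measure (place_measure \<rho>)"
proof
  have "(\<Union>n::nat. cball 0 (real n)) = (UNIV :: complex set)"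
    by (auto intro: real_arch_simple)
  thus "\<exists>A. countable A \<and> A \<subseteq> sets (place_measure \<rho>) \<and> \<Union>A = space (place_measure \<rho>) \<and>
    (\<forall>a\<in>A. emeasure (place_measure \<rho>) a \<noteq> \<infinity>)"
    using emeasure_place_measure_ball_finite[of \<rho>]
    by (intro exI[of _ "range (\<lambda>n::nat. cball 0 (real n))"]) (auto simp: less_top)
qed

lemma borel_place_field [measurable]: "place_field \<rho> \<in> sets borel"
  by (rule borel_closed[OF closed_place_field])

lemma place_measure_Compl_place_field: "emeasure (place_measure \<rho>) (- place_field \<rho>) = 0"
proof (cases "real_embedding \<rho>")
  case True
  have "complex_of_real -` (- \<real>) = {}" by auto
  thus ?thesis
    using True closed_complex_Reals by (subst emeasure_place_measure_real) (auto simp: place_field_def)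
qed (simp add: place_field_def)

lemma place_measure_translate:
  assumes "v \<in> place_field \<rho>" "A \<in> sets borel"
  shows "emeasure (place_measure \<rho>) ((\<lambda>z. z + v) -` A) = emeasure (place_measure \<rho>) A"
proof (cases "real_embedding \<rho>")
  case True
  then obtain r where r: "v = of_real r" using assms(1) by (auto simp: place_field_def elim: Reals_cases)
  have [measurable]: "A \<in> sets borel" by fact
  have "emeasure (place_measure \<rho>) ((\<lambda>z. z + v) -` A) = emeasure lborel (complex_of_real -` ((\<lambda>z. z + v) -` A))"
    using measurable_sets_borel[of "\<lambda>z. z + v" borel A]
    by (intro emeasure_place_measure_real True) auto
  also have "complex_of_real -` ((\<lambda>z. z + v) -` A) = (+) r -` (complex_of_real -` A) \<inter> space lborel"
    by (auto simp: r add.commute)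
  also have "emeasure lborel \<dots> = emeasure (distr lborel borel ((+) r)) (complex_of_real -` A)"
    using measurable_sets_borel[of complex_of_real borel A] by (intro emeasure_distr[symmetric]) auto
  also have "\<dots> = emeasure (place_measure \<rho>) A"
    using True by (simp add: lborel_distr_plus emeasure_place_measure_real)
  finally show ?thesis .
next
  case False
  have "(\<lambda>z. z + v) -` A = (+) v -` A \<inter> space lborel" by (auto simp: add.commute)
  also have "emeasure lborel \<dots> = emeasure (distr lborel borel ((+) v)) A"
    using assms by (intro emeasure_distr[symmetric]) auto
  finally show ?thesis using False by (simp add: place_measure_def lborel_distr_plus)
qed

section \<open>Translations, scalings and boxes in coordinate space\<close>

context number_field_places
begin

definition N :: "(('k \<Rightarrow> complex) \<Rightarrow> complex) measure" where
  "N = PiM S place_measure"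

text \<open>The Minkowski space proper inside the product of complex planes; it carries all of the
  measure and supplies the admissible translations.\<close>

definition W :: "(('k \<Rightarrow> complex) \<Rightarrow> complex) set" where
  "W = Pi\<^sub>E S place_field"

definition translate :: "(('k \<Rightarrow> complex) \<Rightarrow> complex) \<Rightarrow> (('k \<Rightarrow> complex) \<Rightarrow> complex) \<Rightarrow> ('k \<Rightarrow> complex) \<Rightarrow> complex" where
  "translate v x = (\<lambda>\<rho>\<in>S. x \<rho> + v \<rho>)"

definition scale :: "(('k \<Rightarrow> complex) \<Rightarrow> complex) \<Rightarrow> (('k \<Rightarrow> complex) \<Rightarrow> complex) \<Rightarrow> ('k \<Rightarrow> complex) \<Rightarrow> complex" where
  "scale c x = (\<lambda>\<rho>\<in>S. c \<rho> * x \<rho>)"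

definition emb :: "'k \<Rightarrow> ('k \<Rightarrow> complex) \<Rightarrow> complex" where
  "emb a = (\<lambda>\<rho>\<in>S. \<rho> a)"

definition centred_box :: "(('k \<Rightarrow> complex) \<Rightarrow> real) \<Rightarrow> (('k \<Rightarrow> complex) \<Rightarrow> complex) set" where
  "centred_box r = Pi\<^sub>E S (\<lambda>\<rho>. cball 0 (r \<rho>))"

sublocale product_sigma_finite place_measure
  by (rule product_sigma_finite.intro) (rule sigma_finite_place_measure)

sublocale finite_product_sigma_finite place_measure S
  by standard (rule finite_places)

sublocale N: sigma_finite_measure N
  unfolding N_def
  by (rule product_sigma_finite.sigma_finite[OF product_sigma_finite_axioms finite_places])

lemma space_N: "space N = Pi\<^sub>E S (\<lambda>_. UNIV)"
  by (simp add: N_def space_PiM)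

lemma W_subset: "W \<subseteq> space N"
  by (auto simp: W_def space_N)

lemma measurable_coord [measurable]: "\<rho> \<in> S \<Longrightarrow> (\<lambda>x. x \<rho>) \<in> borel_measurable N"
  using measurable_component_singleton[of \<rho> S place_measure]
  by (simp add: N_def cong: measurable_cong_sets)

lemma measurable_N_I:
  assumes "\<And>\<rho>. \<rho> \<in> S \<Longrightarrow> (\<lambda>x. f x \<rho>) \<in> borel_measurable M"
  shows "(\<lambda>x. \<lambda>\<rho>\<in>S. f x \<rho>) \<in> M \<rightarrow>\<^sub>M N"
  unfolding N_def using assms by (intro measurable_restrict) (simp cong: measurable_cong_sets)

lemma measurable_translate [measurable]: "translate v \<in> N \<rightarrow>\<^sub>M N"
  unfolding translate_def by (rule measurable_N_I) measurable

lemma measurable_translate_pair [measurable]: "(\<lambda>p. translate (fst p) (snd p)) \<in> N \<Otimes>\<^sub>M N \<rightarrow>\<^sub>M N"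
  unfolding translate_def by (rule measurable_N_I) measurable

lemma measurable_scale [measurable]: "scale c \<in> N \<rightarrow>\<^sub>M N"
  unfolding scale_def by (rule measurable_N_I) measurable

lemma rect_in_sets [measurable]: "(\<And>\<rho>. \<rho> \<in> S \<Longrightarrow> A \<rho> \<in> sets borel) \<Longrightarrow> Pi\<^sub>E S A \<in> sets N"
  unfolding N_def using finite_places by (intro sets_PiM_I_finite) auto

lemma emeasure_rect:
  "(\<And>\<rho>. \<rho> \<in> S \<Longrightarrow> A \<rho> \<in> sets borel) \<Longrightarrow> emeasure N (Pi\<^sub>E S A) = (\<Prod>\<rho>\<in>S. emeasure (place_measure \<rho>) (A \<rho>))"
  unfolding N_def using finite_places by (intro emeasure_PiM) auto

lemma centred_box_sets [measurable]: "centred_box r \<in> sets N"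
  unfolding centred_box_def by (rule rect_in_sets) auto

lemma emeasure_centred_box_finite: "emeasure N (centred_box r) < \<infinity>"
proof -
  have "emeasure (place_measure \<rho>) (cball 0 (r \<rho>)) \<noteq> \<infinity>" for \<rho>
    using emeasure_place_measure_ball_finite[of \<rho> 0 "r \<rho>"] by auto
  thus ?thesis
    unfolding centred_box_def
    by (subst emeasure_rect) (auto simp: ennreal_prod_eq_top less_top[symmetric])
qed

lemma emeasure_centred_box_pos:
  assumes "\<And>\<rho>. \<rho> \<in> S \<Longrightarrow> r \<rho> > 0"
  shows "emeasure N (centred_box r) > 0"
proof -
  have "emeasure (place_measure \<rho>) (cball 0 (r \<rho>)) \<noteq> 0" if "\<rho> \<in> S" for \<rho>
    using emeasure_place_measure_ball_pos[OF assms[OF that], of \<rho>] by auto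
  hence "emeasure N (centred_box r) \<noteq> 0"
    unfolding centred_box_def using finite_places by (subst emeasure_rect) auto
  thus ?thesis by (simp add: zero_less_iff_neq_zero)
qed

lemma AE_in_W: "AE x in N. x \<in> W"
proof -
  have "AE x in N. x \<rho> \<in> place_field \<rho>" if \<rho>: "\<rho> \<in> S" for \<rho>
  proof (rule AE_I')
    let ?A = "Pi\<^sub>E S (\<lambda>\<sigma>. if \<sigma> = \<rho> then - place_field \<rho> else UNIV)"
    have "emeasure N ?A = (\<Prod>\<sigma>\<in>S. emeasure (place_measure \<sigma>) (if \<sigma> = \<rho> then - place_field \<rho> else UNIV))"
      by (intro emeasure_rect) (auto intro: borel_comp)
    also have "\<dots> = 0"
      using \<rho> finite_places by (auto simp: place_measure_Compl_place_field intro!: bexI[of _ \<rho>])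
    finally show "?A \<in> null_sets N"
      by (intro null_setsI rect_in_sets) (auto intro: borel_comp)
    show "{x \<in> space N. \<not> x \<rho> \<in> place_field \<rho>} \<subseteq> ?A"
      by (auto simp: space_N)
  qed
  hence "AE x in N. \<forall>\<rho>\<in>S. x \<rho> \<in> place_field \<rho>"
    using finite_places by (simp add: AE_finite_all)
  thus ?thesis using AE_space by eventually_elim (auto simp: W_def space_N PiE_iff)
qed

lemma translate_in_space [simp]: "translate v x \<in> space N"
  by (auto simp: translate_def space_N)

lemma scale_in_space [simp]: "scale v x \<in> space N"
  by (auto simp: scale_def space_N)

lemma emb_in_W: "emb a \<in> W"
  by (auto simp: emb_def W_def embedding_in_place_field)

lemma uminus_in_W: "v \<in> W \<Longrightarrow> (\<lambda>\<rho>\<in>S. - v \<rho>) \<in> W"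
  by (auto simp: W_def place_field_def PiE_iff)

lemma distr_translate:
  assumes "v \<in> W"
  shows "distr N N (translate v) = N"
proof -
  have "distr N N (translate v) = PiM S place_measure"
  proof (rule PiM_eqI[OF finite_places])
    show "sets (distr N N (translate v)) = sets (PiM S place_measure)" by (simp add: N_def)
    fix A assume "\<And>\<rho>. \<rho> \<in> S \<Longrightarrow> A \<rho> \<in> sets (place_measure \<rho>)"
    hence A: "\<And>\<rho>. \<rho> \<in> S \<Longrightarrow> A \<rho> \<in> sets borel" by simp
    have "emeasure (distr N N (translate v)) (Pi\<^sub>E S A) = emeasure N (translate v -` Pi\<^sub>E S A \<inter> space N)"
      using A by (intro emeasure_distr rect_in_sets) auto
    also have "translate v -` Pi\<^sub>E S A \<inter> space N = Pi\<^sub>E S (\<lambda>\<rho>. (\<lambda>z. z + v \<rho>) -` A \<rho>)"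
      by (auto simp: translate_def space_N PiE_iff)
    also have "emeasure N \<dots> = (\<Prod>\<rho>\<in>S. emeasure (place_measure \<rho>) ((\<lambda>z. z + v \<rho>) -` A \<rho>))"
    proof (rule emeasure_rect)
      fix \<rho> assume "\<rho> \<in> S"
      thus "(\<lambda>z. z + v \<rho>) -` A \<rho> \<in> sets borel"
        using A by (intro measurable_sets_borel[where f = "\<lambda>z. z + v \<rho>" and M = borel]) auto
    qed
    also have "\<dots> = (\<Prod>\<rho>\<in>S. emeasure (place_measure \<rho>) (A \<rho>))"
      using assms A by (intro prod.cong place_measure_translate) (auto simp: W_def)
    finally show "emeasure (distr N N (translate v)) (Pi\<^sub>E S A) = (\<Prod>\<rho>\<in>S. emeasure (place_measure \<rho>) (A \<rho>))" .
  qed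
  thus ?thesis by (simp add: N_def)
qed

lemma emeasure_translate:
  assumes "v \<in> W" "A \<in> sets N"
  shows "emeasure N (translate v -` A \<inter> space N) = emeasure N A"
  using emeasure_distr[of "translate v" N N A] distr_translate[OF assms(1)] assms(2) by simp

lemma AE_translate:
  assumes "v \<in> W" "AE x in N. P x"
  shows "AE x in N. P (translate v x)"
proof (rule AE_distrD[OF measurable_translate])
  show "AE x in distr N N (translate v). P x"
    unfolding distr_translate[OF assms(1)] by (rule assms(2))
qed

lemma Union_centred_box: "(\<Union>n::nat. centred_box (\<lambda>_. real n)) = space N"
proof (intro equalityI subsetI)
  fix x assume x: "x \<in> space N"
  obtain n :: nat where n: "(\<Sum>\<rho>\<in>S. cmod (x \<rho>)) \<le> real n" using real_arch_simple by blast
  have "cmod (x \<rho>) \<le> real n" if "\<rho> \<in> S" for \<rho>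
    using member_le_sum[OF that, of "\<lambda>\<rho>. cmod (x \<rho>)"] finite_places n by simp
  thus "x \<in> (\<Union>n::nat. centred_box (\<lambda>_. real n))"
    using x by (auto simp: centred_box_def space_N PiE_iff)
qed (auto simp: centred_box_def space_N)

lemma emeasure_centred_box_Int_pos:
  assumes "A \<in> sets N" "emeasure N A \<noteq> 0"
  obtains n :: nat where "emeasure N (A \<inter> centred_box (\<lambda>_. real n)) \<noteq> 0"
proof (rule ccontr)
  assume "\<not> thesis"
  hence "\<And>n::nat. emeasure N (A \<inter> centred_box (\<lambda>_. real n)) = 0" using that by blast
  hence "(\<Union>n::nat. A \<inter> centred_box (\<lambda>_. real n)) \<in> null_sets N"
    using assms(1) by (intro null_sets_UN null_setsI) auto
  moreover have "(\<Union>n::nat. A \<inter> centred_box (\<lambda>_. real n)) = A"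
    using Union_centred_box sets.sets_into_space[OF assms(1)] by blast
  ultimately show False using assms(2) by auto
qed

text \<open>Uniqueness of Haar measure: compute \<open>\<integral>\<integral> 1\<^sub>Q(x) 1\<^sub>B(x + y)\<close> in both orders for the
  symmetric box \<open>Q\<close>.\<close>

lemma translation_invariant_unique:
  assumes sf: "sigma_finite_measure \<mu>" and sets [measurable_cong]: "sets \<mu> = sets N"
    and inv: "\<And>v B. v \<in> W \<Longrightarrow> B \<in> sets N \<Longrightarrow> emeasure \<mu> (translate v -` B \<inter> space N) = emeasure \<mu> B"
    and AE_W: "AE y in \<mu>. y \<in> W"
    and B [measurable]: "B \<in> sets N"
  shows "emeasure N (centred_box (\<lambda>_. 1)) * emeasure \<mu> B = emeasure N B * emeasure \<mu> (centred_box (\<lambda>_. 1))"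
proof -
  let ?Q = "centred_box (\<lambda>_. 1)"
  interpret \<mu>: sigma_finite_measure \<mu> by fact
  interpret P: pair_sigma_finite N \<mu> ..
  have space: "space \<mu> = space N" using sets by (rule sets_eq_imp_space_eq)
  have [measurable]: "(\<lambda>p. translate (fst p) (snd p)) \<in> N \<Otimes>\<^sub>M \<mu> \<rightarrow>\<^sub>M N"
    "(\<lambda>p. translate (fst p) (snd p)) \<in> \<mu> \<Otimes>\<^sub>M N \<rightarrow>\<^sub>M N"
    using measurable_translate_pair by (simp_all add: sets cong: measurable_cong_sets sets_pair_measure_cong)
  have m: "emeasure \<mu> (translate v -` A \<inter> space \<mu>) = (\<integral>\<^sup>+ y. indicator A (translate v y) \<partial>\<mu>)"
    if "A \<in> sets N" for v A
  proof -
    have "translate v -` A \<inter> space \<mu> \<in> sets \<mu>"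
      using measurable_sets[OF measurable_translate that] by (simp add: space sets)
    hence "emeasure \<mu> (translate v -` A \<inter> space \<mu>) = (\<integral>\<^sup>+ y. indicator (translate v -` A \<inter> space \<mu>) y \<partial>\<mu>)"
      by simp
    also have "\<dots> = (\<integral>\<^sup>+ y. indicator A (translate v y) \<partial>\<mu>)"
      by (intro nn_integral_cong) (auto split: split_indicator)
    finally show ?thesis .
  qed
  have "(\<integral>\<^sup>+ x. \<integral>\<^sup>+ y. indicator ?Q x * indicator B (translate x y) \<partial>\<mu> \<partial>N)
      = (\<integral>\<^sup>+ x. indicator ?Q x * emeasure \<mu> B \<partial>N)"
  proof (rule nn_integral_cong_AE)
    show "AE x in N. (\<integral>\<^sup>+ y. indicator ?Q x * indicator B (translate x y) \<partial>\<mu>) = indicator ?Q x * emeasure \<mu> B"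
      using AE_in_W
    proof eventually_elim
      case (elim x)
      have [measurable]: "translate x \<in> \<mu> \<rightarrow>\<^sub>M N" using measurable_translate by (simp add: sets cong: measurable_cong_sets)
      have "(\<integral>\<^sup>+ y. indicator ?Q x * indicator B (translate x y) \<partial>\<mu>)
          = indicator ?Q x * (\<integral>\<^sup>+ y. indicator B (translate x y) \<partial>\<mu>)"
        by (rule nn_integral_cmult) measurable
      also have "(\<integral>\<^sup>+ y. indicator B (translate x y) \<partial>\<mu>) = emeasure \<mu> B"
        using inv[OF elim B] m[OF B, of x] by (simp add: space)
      finally show ?case .
    qed
  qed
  also have "\<dots> = emeasure N ?Q * emeasure \<mu> B"
    by (subst nn_integral_multc) auto
  finally have left: "(\<integral>\<^sup>+ x. \<integral>\<^sup>+ y. indicator ?Q x * indicator B (translate x y) \<partial>\<mu> \<partial>N)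
      = emeasure N ?Q * emeasure \<mu> B" .
  define neg where "neg = (\<lambda>v::('k \<Rightarrow> complex) \<Rightarrow> complex. \<lambda>\<rho>\<in>S. - v \<rho>)"
  have neg_W: "neg v \<in> W" if "v \<in> W" for v using uminus_in_W[OF that] by (simp add: neg_def)
  have [measurable]: "neg \<in> N \<rightarrow>\<^sub>M N" unfolding neg_def by (rule measurable_N_I) measurable
  have [measurable]: "(\<lambda>p. translate (neg (fst p)) (snd p)) \<in> N \<Otimes>\<^sub>M N \<rightarrow>\<^sub>M N"
    unfolding translate_def neg_def by (rule measurable_N_I) simp
  have [measurable]: "neg \<in> \<mu> \<rightarrow>\<^sub>M N" using \<open>neg \<in> N \<rightarrow>\<^sub>M N\<close> by (simp add: sets cong: measurable_cong_sets)
  have "(\<integral>\<^sup>+ x. \<integral>\<^sup>+ y. indicator ?Q x * indicator B (translate x y) \<partial>\<mu> \<partial>N)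
      = (\<integral>\<^sup>+ y. \<integral>\<^sup>+ x. indicator ?Q x * indicator B (translate x y) \<partial>N \<partial>\<mu>)"
    by (rule P.Fubini'[symmetric]) measurable
  also have "\<dots> = (\<integral>\<^sup>+ y. \<integral>\<^sup>+ x. indicator ?Q (translate (neg x) y) * indicator B x \<partial>N \<partial>\<mu>)"
  proof (rule nn_integral_cong_AE)
    show "AE y in \<mu>. (\<integral>\<^sup>+ x. indicator ?Q x * indicator B (translate x y) \<partial>N)
        = (\<integral>\<^sup>+ x. indicator ?Q (translate (neg x) y) * indicator B x \<partial>N)"
      using AE_W
    proof eventually_elim
      case (elim y)
      have [measurable]: "(\<lambda>x. translate x y) \<in> N \<rightarrow>\<^sub>M N"
        unfolding translate_def by (rule measurable_N_I) measurable
      have "(\<integral>\<^sup>+ x. indicator ?Q x * indicator B (translate x y) \<partial>N)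
          = (\<integral>\<^sup>+ x. indicator ?Q x * indicator B (translate x y) \<partial>distr N N (translate (neg y)))"
        by (simp add: distr_translate[OF neg_W[OF elim]])
      also have "\<dots> = (\<integral>\<^sup>+ x. indicator ?Q (translate (neg y) x) * indicator B (translate (translate (neg y) x) y) \<partial>N)"
        by (rule nn_integral_distr) measurable
      also have "\<dots> = (\<integral>\<^sup>+ x. indicator ?Q (translate (neg x) y) * indicator B x \<partial>N)"
      proof (rule nn_integral_cong)
        fix x assume x: "x \<in> space N"
        have "translate (translate (neg y) x) y = x"
        proof
          show "translate (translate (neg y) x) y \<rho> = x \<rho>" for \<rho>
            using PiE_arb[OF x[unfolded space_N], of \<rho>] by (simp add: translate_def neg_def)
        qed
        moreover have "translate (neg v) w \<in> ?Q \<longleftrightarrow> (\<forall>\<rho>\<in>S. cmod (w \<rho> - v \<rho>) \<le> 1)" for v w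
          by (simp add: centred_box_def translate_def neg_def PiE_iff)
        \<comment> \<open>After \<open>x\<close> is replaced by \<open>x - y\<close> the box is
          evaluated at \<open>x - y\<close>; its symmetry turns this into \<open>y - x\<close>, a
          translation in the variable of \<open>\<mu>\<close>.\<close>
        hence "translate (neg y) x \<in> ?Q \<longleftrightarrow> translate (neg x) y \<in> ?Q"
          by (metis norm_minus_commute)
        ultimately show "indicator ?Q (translate (neg y) x) * indicator B (translate (translate (neg y) x) y)
            = (indicator ?Q (translate (neg x) y) * indicator B x :: ennreal)"
          by (simp add: indicator_def)
      qed
      finally show ?case .
    qed
  qed
  also have "\<dots> = (\<integral>\<^sup>+ x. \<integral>\<^sup>+ y. indicator ?Q (translate (neg x) y) * indicator B x \<partial>\<mu> \<partial>N)"
    by (rule P.Fubini') measurable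
  also have "\<dots> = (\<integral>\<^sup>+ x. emeasure \<mu> ?Q * indicator B x \<partial>N)"
  proof (rule nn_integral_cong_AE)
    show "AE x in N. (\<integral>\<^sup>+ y. indicator ?Q (translate (neg x) y) * indicator B x \<partial>\<mu>) = emeasure \<mu> ?Q * indicator B x"
      using AE_in_W
    proof eventually_elim
      case (elim x)
      have [measurable]: "translate (neg x) \<in> \<mu> \<rightarrow>\<^sub>M N" using measurable_translate by (simp add: sets cong: measurable_cong_sets)
      have "(\<integral>\<^sup>+ y. indicator ?Q (translate (neg x) y) * indicator B x \<partial>\<mu>)
          = (\<integral>\<^sup>+ y. indicator ?Q (translate (neg x) y) \<partial>\<mu>) * indicator B x"
        by (rule nn_integral_multc) measurable
      also have "(\<integral>\<^sup>+ y. indicator ?Q (translate (neg x) y) \<partial>\<mu>) = emeasure \<mu> ?Q"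
        using inv[OF neg_W[OF elim] centred_box_sets] m[OF centred_box_sets, of "neg x"] by (simp add: space)
      finally show ?case .
    qed
  qed
  also have "\<dots> = emeasure \<mu> ?Q * emeasure N B"
    by (subst nn_integral_cmult) auto
  finally show ?thesis using left by (simp add: mult.commute)
qed

section \<open>The measure under coordinatewise scaling\<close>

lemma scale_vimage_centred_box:
  assumes "\<And>\<rho>. \<rho> \<in> S \<Longrightarrow> c \<rho> \<noteq> 0"
  shows "scale c -` centred_box r \<inter> space N = centred_box (\<lambda>\<rho>. r \<rho> / cmod (c \<rho>))"
  using assms by (auto simp: scale_def centred_box_def space_N PiE_iff norm_mult field_simps)

text \<open>The image measure under a scaling is again translation invariant, hence proportional to
  \<open>N\<close>. The factor is positive and finite because the preimage of the unit box is a box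
  with positive radii.\<close>

lemma scale_measure:
  assumes c: "\<And>\<rho>. \<rho> \<in> S \<Longrightarrow> c \<rho> \<in> place_field \<rho>" "\<And>\<rho>. \<rho> \<in> S \<Longrightarrow> c \<rho> \<noteq> 0"
  obtains k where "0 < k" "k < \<infinity>"
    "\<And>A. A \<in> sets N \<Longrightarrow> emeasure N (scale c -` A \<inter> space N) = k * emeasure N A"
proof -
  define \<mu> where "\<mu> = distr N N (scale c)"
  have sets_\<mu>: "sets \<mu> = sets N" and space_\<mu>: "space \<mu> = space N" by (simp_all add: \<mu>_def)
  have \<mu>: "emeasure \<mu> A = emeasure N (scale c -` A \<inter> space N)" if "A \<in> sets N" for A
    unfolding \<mu>_def using that by (intro emeasure_distr) auto
  note pre_box = scale_vimage_centred_box[OF c(2)]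
  have inv: "emeasure \<mu> (translate v -` B \<inter> space N) = emeasure \<mu> B" if v: "v \<in> W" and B: "B \<in> sets N" for v B
  proof -
    \<comment> \<open>Translating by \<open>w = v / c\<close> before the scaling is translating by
      \<open>v\<close> after it.\<close>
    define w where "w = (\<lambda>\<rho>\<in>S. v \<rho> / c \<rho>)"
    have w: "w \<in> W" using v c(1) by (auto simp: w_def W_def PiE_iff intro!: place_field_closed)
    have "scale c -` (translate v -` B \<inter> space N) \<inter> space N = translate w -` (scale c -` B \<inter> space N) \<inter> space N"
    proof -
      have "translate v (scale c x) = scale c (translate w x)" for x
        using c(2) by (auto simp: translate_def scale_def w_def fun_eq_iff distrib_left)
      thus ?thesis by auto
    qed
    moreover have "scale c -` B \<inter> space N \<in> sets N" using B by simp
    moreover have "translate v -` B \<inter> space N \<in> sets N" using B by simp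
    ultimately show ?thesis using \<mu> B emeasure_translate[OF w, of "scale c -` B \<inter> space N"] by simp
  qed
  have sf: "sigma_finite_measure \<mu>"
  proof
    show "\<exists>A. countable A \<and> A \<subseteq> sets \<mu> \<and> \<Union>A = space \<mu> \<and> (\<forall>a\<in>A. emeasure \<mu> a \<noteq> \<infinity>)"
      using Union_centred_box emeasure_centred_box_finite
      by (intro exI[of _ "range (\<lambda>n::nat. centred_box (\<lambda>_. real n))"])
        (auto simp: \<mu> pre_box less_top sets_\<mu> space_\<mu>)
  qed
  have AE_W: "AE y in \<mu>. y \<in> W"
  proof -
    have "AE x in N. scale c x \<in> W"
      using AE_in_W by eventually_elim (auto simp: W_def scale_def PiE_iff c(1) intro: place_field_closed(3))
    moreover have "{x \<in> space N. x \<in> W} \<in> sets N"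
    proof -
      have "W \<in> sets N" unfolding W_def by (intro rect_in_sets borel_place_field)
      thus ?thesis using W_subset by (simp add: Int_absorb1 Collect_conj_eq)
    qed
    ultimately show ?thesis unfolding \<mu>_def by (subst AE_distr_iff) auto
  qed
  let ?Q = "centred_box (\<lambda>_. 1)"
  define k where "k = emeasure \<mu> ?Q / emeasure N ?Q"
  have Q: "0 < emeasure N ?Q" "emeasure N ?Q < \<infinity>"
    using emeasure_centred_box_pos[of "\<lambda>_. 1"] emeasure_centred_box_finite[of "\<lambda>_. 1"] by auto
  have "emeasure \<mu> ?Q = emeasure N (centred_box (\<lambda>\<rho>. 1 / cmod (c \<rho>)))"
    by (simp add: \<mu> pre_box)
  hence \<mu>Q: "0 < emeasure \<mu> ?Q" "emeasure \<mu> ?Q < \<infinity>"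
    using emeasure_centred_box_pos[of "\<lambda>\<rho>. 1 / cmod (c \<rho>)"] emeasure_centred_box_finite c(2) by auto
  show ?thesis
  proof (rule that)
    show "0 < k" "k < \<infinity>"
      using Q \<mu>Q
      by (simp_all add: k_def ennreal_divide_eq_top_iff less_top[symmetric] zero_less_iff_neq_zero
          ennreal_divide_eq_0_iff)
    fix A assume A: "A \<in> sets N"
    have "emeasure N ?Q * emeasure \<mu> A = emeasure N A * emeasure \<mu> ?Q"
      by (rule translation_invariant_unique[OF sf sets_\<mu> inv AE_W A])
    moreover have "emeasure \<mu> A = emeasure \<mu> A * emeasure N ?Q / emeasure N ?Q"
      using Q by (intro ennreal_mult_divide_eq[symmetric]) auto
    ultimately have "emeasure \<mu> A = emeasure N A * emeasure \<mu> ?Q / emeasure N ?Q"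
      by (simp only: mult.commute)
    thus "emeasure N (scale c -` A \<inter> space N) = k * emeasure N A"
      unfolding \<mu>[OF A] k_def by (metis ennreal_times_divide mult.commute)
  qed
qed

end

section \<open>Zero-one laws for invariant sets\<close>

context number_field_places
begin

text \<open>Open rectangles form the generator used below because membership in them is stable under
  small translations.\<close>

lemma sigma_sets_open_rect:
  "sets N = sigma_sets (space N) {Pi\<^sub>E S U | U. \<forall>\<rho>\<in>S. open (U \<rho>)}" (is "_ = sigma_sets _ ?R")
proof
  have sub: "?R \<subseteq> Pow (space N)" by (auto simp: space_N)
  have "(\<lambda>x. x) \<in> sigma (space N) ?R \<rightarrow>\<^sub>M PiM S place_measure"
  proof (rule measurable_PiM_single')
    show "(\<lambda>x. x) \<in> space (sigma (space N) ?R) \<rightarrow> (\<Pi>\<^sub>E i\<in>S. space (place_measure i))"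
      using sub by (simp add: space_measure_of space_N)
    fix \<rho> assume \<rho>: "\<rho> \<in> S"
    have "(\<lambda>x. x \<rho>) \<in> borel_measurable (sigma (space N) ?R)"
    proof (rule borel_measurableI)
      fix U :: "complex set" assume U: "open U"
      have "(\<lambda>x. x \<rho>) -` U \<inter> space (sigma (space N) ?R) = Pi\<^sub>E S (\<lambda>\<sigma>. if \<sigma> = \<rho> then U else UNIV)"
        using sub \<rho> by (auto simp: space_measure_of space_N PiE_iff split: if_splits dest!: bspec[of _ _ \<rho>])
      also have "\<dots> \<in> ?R" using U by auto
      finally show "(\<lambda>x. x \<rho>) -` U \<inter> space (sigma (space N) ?R) \<in> sets (sigma (space N) ?R)"
        using sub by (auto simp: sets_measure_of)
    qed
    thus "(\<lambda>x. x \<rho>) \<in> sigma (space N) ?R \<rightarrow>\<^sub>M place_measure \<rho>"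
      by (simp cong: measurable_cong_sets)
  qed
  hence id: "(\<lambda>x. x) \<in> sigma (space N) ?R \<rightarrow>\<^sub>M N" by (simp add: N_def)
  show "sets N \<subseteq> sigma_sets (space N) ?R"
  proof
    fix A assume A: "A \<in> sets N"
    have "(\<lambda>x. x) -` A \<inter> space (sigma (space N) ?R) \<in> sets (sigma (space N) ?R)"
      by (rule measurable_sets[OF id A])
    moreover have "(\<lambda>x. x) -` A \<inter> space (sigma (space N) ?R) = A"
      using sets.sets_into_space[OF A] sub by (auto simp: space_measure_of)
    ultimately show "A \<in> sigma_sets (space N) ?R" using sub by (simp add: sets_measure_of)
  qed
  have "?R \<subseteq> sets N" by (auto intro!: rect_in_sets)
  thus "sigma_sets (space N) ?R \<subseteq> sets N" by (rule sets.sigma_sets_subset)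
qed

text \<open>The restriction \<open>\<mu>\<close> of \<open>N\<close> to \<open>E\<close> is
  invariant under the translations from \<open>H\<close>. Fatou's lemma on open rectangles extends
  this to all translations in \<open>W\<close>. By uniqueness \<open>\<mu>\<close> is a multiple of
  \<open>N\<close>; it vanishes on the complement of \<open>E\<close>, so either the complement is
  null or the multiple is 0.\<close>

lemma dense_translation_zero_one:
  assumes E [measurable]: "E \<in> sets N"
    and dense: "\<And>x e. x \<in> W \<Longrightarrow> e > 0 \<Longrightarrow> \<exists>h\<in>H. \<forall>\<rho>\<in>S. cmod (x \<rho> - \<rho> h) < e"
    and inv: "\<And>h. h \<in> H \<Longrightarrow> AE x in N. translate (emb h) x \<in> E \<longleftrightarrow> x \<in> E"
  shows "emeasure N E = 0 \<or> emeasure N (space N - E) = 0"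
proof -
  define \<mu> where "\<mu> = density N (indicator E)"
  have \<mu>: "emeasure \<mu> A = emeasure N (E \<inter> A)" if "A \<in> sets N" for A
  proof -
    have "emeasure \<mu> A = (\<integral>\<^sup>+ x. indicator E x * indicator A x \<partial>N)"
      unfolding \<mu>_def using that by (intro emeasure_density) auto
    also have "\<dots> = (\<integral>\<^sup>+ x. indicator (E \<inter> A) x \<partial>N)"
      by (intro nn_integral_cong) (simp add: indicator_inter_arith)
    finally show ?thesis using that by simp
  qed
  have sets_\<mu>: "sets \<mu> = sets N" and space_\<mu>: "space \<mu> = space N" by (simp_all add: \<mu>_def)
  have invH: "emeasure N (E \<inter> (translate (emb h) -` B \<inter> space N)) = emeasure N (E \<inter> B)"
    if h: "h \<in> H" and B [measurable]: "B \<in> sets N" for h B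
  proof -
    have "emeasure N (E \<inter> (translate (emb h) -` B \<inter> space N))
        = emeasure N (translate (emb h) -` (E \<inter> B) \<inter> space N)"
      using inv[OF h] by (intro emeasure_eq_AE) (auto elim!: eventually_mono)
    also have "\<dots> = emeasure N (E \<inter> B)" by (intro emeasure_translate emb_in_W) auto
    finally show ?thesis .
  qed
  have le: "emeasure N (E \<inter> (translate v -` Pi\<^sub>E S U \<inter> space N)) \<le> emeasure N (E \<inter> Pi\<^sub>E S U)"
    if v: "v \<in> W" and U: "\<And>\<rho>. \<rho> \<in> S \<Longrightarrow> open (U \<rho>)" for v U
  proof -
    let ?B = "Pi\<^sub>E S U"
    have B [measurable]: "?B \<in> sets N" using U by (intro rect_in_sets) auto
    have "\<forall>n. \<exists>h\<in>H. \<forall>\<rho>\<in>S. cmod (v \<rho> - \<rho> h) < 1 / real (Suc n)"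
      using dense[OF v] by simp
    then obtain h where h: "\<And>n. h n \<in> H" "\<And>n \<rho>. \<rho> \<in> S \<Longrightarrow> cmod (v \<rho> - \<rho> (h n)) < 1 / real (Suc n)"
      by metis
    have lim: "(\<lambda>n. \<rho> (h n)) \<longlonglongrightarrow> v \<rho>" if "\<rho> \<in> S" for \<rho>
    proof -
      have "(\<lambda>n. v \<rho> - \<rho> (h n)) \<longlonglongrightarrow> 0" using h(2)[OF that] by (rule LIMSEQ_norm_0)
      hence "(\<lambda>n. v \<rho> - (v \<rho> - \<rho> (h n))) \<longlonglongrightarrow> v \<rho> - 0" by (intro tendsto_diff tendsto_const)
      thus ?thesis by simp
    qed
    have "emeasure N (E \<inter> (translate v -` ?B \<inter> space N)) = (\<integral>\<^sup>+ x. indicator (E \<inter> (translate v -` ?B \<inter> space N)) x \<partial>N)"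
      by simp
    also have "\<dots> \<le> (\<integral>\<^sup>+ x. liminf (\<lambda>n. indicator (E \<inter> (translate (emb (h n)) -` ?B \<inter> space N)) x) \<partial>N)"
    proof (rule nn_integral_mono)
      fix x assume x: "x \<in> space N"
      show "indicator (E \<inter> (translate v -` ?B \<inter> space N)) x
        \<le> (liminf (\<lambda>n. indicator (E \<inter> (translate (emb (h n)) -` ?B \<inter> space N)) x) :: ennreal)"
      proof (cases "x \<in> E \<and> translate v x \<in> ?B")
        case True
        have "\<forall>\<^sub>F n in sequentially. \<forall>\<rho>\<in>S. x \<rho> + \<rho> (h n) \<in> U \<rho>"
        proof (intro eventually_ball_finite finite_places ballI)
          fix \<rho> assume \<rho>: "\<rho> \<in> S"
          have "(\<lambda>n. x \<rho> + \<rho> (h n)) \<longlonglongrightarrow> x \<rho> + v \<rho>"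
            by (intro tendsto_add tendsto_const lim \<rho>)
          moreover have "x \<rho> + v \<rho> \<in> U \<rho>"
            using True \<rho> by (auto simp: translate_def PiE_iff)
          ultimately show "\<forall>\<^sub>F n in sequentially. x \<rho> + \<rho> (h n) \<in> U \<rho>"
            using U[OF \<rho>] topological_tendstoD by blast
        qed
        hence "\<forall>\<^sub>F n in sequentially. (1::ennreal) \<le> indicator (E \<inter> (translate (emb (h n)) -` ?B \<inter> space N)) x"
          by eventually_elim (use True x in \<open>auto simp: translate_def emb_def PiE_iff\<close>)
        thus ?thesis using True x by (simp add: Liminf_bounded)
      next
        case False
        hence "indicator (E \<inter> (translate v -` ?B \<inter> space N)) x = (0::ennreal)" by (auto simp: indicator_def)
        thus ?thesis by simp
      qed
    qed
    also have "\<dots> \<le> liminf (\<lambda>n. \<integral>\<^sup>+ x. indicator (E \<inter> (translate (emb (h n)) -` ?B \<inter> space N)) x \<partial>N)"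
      by (rule nn_integral_liminf) simp
    also have "\<dots> = liminf (\<lambda>n. emeasure N (E \<inter> ?B))"
      using invH[OF h(1) B] by simp
    finally show ?thesis by (simp add: Liminf_const)
  qed
  have eq: "emeasure N (E \<inter> (translate v -` Pi\<^sub>E S U \<inter> space N)) = emeasure N (E \<inter> Pi\<^sub>E S U)"
    if v: "v \<in> W" and U: "\<And>\<rho>. \<rho> \<in> S \<Longrightarrow> open (U \<rho>)" for v U
  proof (rule antisym)
    show "emeasure N (E \<inter> (translate v -` Pi\<^sub>E S U \<inter> space N)) \<le> emeasure N (E \<inter> Pi\<^sub>E S U)"
      by (rule le[OF v U])
    \<comment> \<open>The reverse inequality is the one already shown, applied to the opposite
      translation and the shifted rectangle, which is open as well.\<close>
    define V where "V = (\<lambda>\<rho>. (\<lambda>z. z + v \<rho>) -` U \<rho>)"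
    have pre: "translate v -` Pi\<^sub>E S U \<inter> space N = Pi\<^sub>E S V"
      by (auto simp: V_def translate_def space_N PiE_iff)
    have pre': "translate (\<lambda>\<rho>\<in>S. - v \<rho>) -` Pi\<^sub>E S V \<inter> space N = Pi\<^sub>E S U"
      by (auto simp: V_def translate_def space_N PiE_iff)
    have "open (V \<rho>)" if "\<rho> \<in> S" for \<rho>
      unfolding V_def using U[OF that] by (intro continuous_open_vimage continuous_intros) auto
    thus "emeasure N (E \<inter> Pi\<^sub>E S U) \<le> emeasure N (E \<inter> (translate v -` Pi\<^sub>E S U \<inter> space N))"
      using le[OF uminus_in_W[OF v], of V] by (simp add: pre pre')
  qed
  have \<mu>_inv: "emeasure \<mu> (translate v -` B \<inter> space N) = emeasure \<mu> B" if v: "v \<in> W" and B: "B \<in> sets N" for v B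
  proof -
    let ?R = "{Pi\<^sub>E S U | U. \<forall>\<rho>\<in>S. open (U \<rho> :: complex set)}"
    have meas: "translate v \<in> \<mu> \<rightarrow>\<^sub>M N" using measurable_translate by (simp add: sets_\<mu> cong: measurable_cong_sets)
    have distr: "emeasure (distr \<mu> N (translate v)) A = emeasure \<mu> (translate v -` A \<inter> space N)" if "A \<in> sets N" for A
      using emeasure_distr[OF meas that] by (simp add: space_\<mu>)
    have R_sets: "?R \<subseteq> sets N" by (auto intro!: rect_in_sets)
    have "\<mu> = distr \<mu> N (translate v)"
    proof (rule measure_eqI_generator_eq[where E = ?R and \<Omega> = "space N" and A = "\<lambda>n. Pi\<^sub>E S (\<lambda>_. ball 0 (real n))"])
      show "Int_stable ?R"
      proof (rule Int_stableI)
        fix a b :: "(('k \<Rightarrow> complex) \<Rightarrow> complex) set" assume "a \<in> ?R" "b \<in> ?R"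
        then obtain U V where UV: "a = Pi\<^sub>E S U" "b = Pi\<^sub>E S V" "\<forall>\<rho>\<in>S. open (U \<rho>)" "\<forall>\<rho>\<in>S. open (V \<rho>)" by blast
        have "a \<inter> b = Pi\<^sub>E S (\<lambda>\<rho>. U \<rho> \<inter> V \<rho>)" unfolding UV by (rule PiE_Int)
        moreover have "\<forall>\<rho>\<in>S. open (U \<rho> \<inter> V \<rho>)" using UV by blast
        ultimately show "a \<inter> b \<in> ?R" by blast
      qed
      show "?R \<subseteq> Pow (space N)" by (auto simp: space_N)
      show "emeasure \<mu> X = emeasure (distr \<mu> N (translate v)) X" if XR: "X \<in> ?R" for X
      proof -
        obtain U where U: "X = Pi\<^sub>E S U" "\<forall>\<rho>\<in>S. open (U \<rho>)" using XR by blast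
        have X: "X \<in> sets N" using XR R_sets by blast
        moreover have "translate v -` X \<inter> space N \<in> sets N" using X by simp
        ultimately show ?thesis using eq[OF v, of U] U by (simp add: distr \<mu>)
      qed
      show "sets \<mu> = sigma_sets (space N) ?R" "sets (distr \<mu> N (translate v)) = sigma_sets (space N) ?R"
        by (simp_all add: sets_\<mu> sigma_sets_open_rect)
      show "range (\<lambda>n. Pi\<^sub>E S (\<lambda>_. ball 0 (real n))) \<subseteq> ?R" by auto
      show "(\<Union>i. Pi\<^sub>E S (\<lambda>_. ball 0 (real i))) = space N"
      proof (intro equalityI subsetI)
        fix x assume "x \<in> space N"
        then obtain n :: nat where "x \<in> centred_box (\<lambda>_. real n)" using Union_centred_box by blast
        hence "x \<in> Pi\<^sub>E S (\<lambda>_. ball 0 (real (Suc n)))" by (force simp: centred_box_def PiE_iff)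
        thus "x \<in> (\<Union>i. Pi\<^sub>E S (\<lambda>_. ball 0 (real i)))" by blast
      qed (auto simp: space_N)
      fix n :: nat
      have "Pi\<^sub>E S (\<lambda>_. ball 0 (real n)) \<in> sets N" by (intro rect_in_sets) auto
      hence "emeasure \<mu> (Pi\<^sub>E S (\<lambda>_. ball 0 (real n))) \<le> emeasure N (centred_box (\<lambda>_. real n))"
        by (auto simp: \<mu> centred_box_def PiE_iff less_imp_le intro!: emeasure_mono rect_in_sets)
      thus "emeasure \<mu> (Pi\<^sub>E S (\<lambda>_. ball 0 (real n))) \<noteq> \<infinity>"
        using emeasure_centred_box_finite[of "\<lambda>_. real n"] by (auto simp: top_unique)
    qed
    thus ?thesis using distr[OF B] by simp
  qed
  have sf: "sigma_finite_measure \<mu>"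
  proof
    have "emeasure \<mu> (centred_box r) \<noteq> \<infinity>" for r
    proof -
      have "emeasure \<mu> (centred_box r) \<le> emeasure N (centred_box r)"
        by (auto simp: \<mu> intro!: emeasure_mono)
      thus ?thesis using emeasure_centred_box_finite[of r] by (auto simp: top_unique)
    qed
    thus "\<exists>A. countable A \<and> A \<subseteq> sets \<mu> \<and> \<Union>A = space \<mu> \<and> (\<forall>a\<in>A. emeasure \<mu> a \<noteq> \<infinity>)"
      using Union_centred_box
      by (intro exI[of _ "range (\<lambda>n::nat. centred_box (\<lambda>_. real n))"]) (auto simp: sets_\<mu> space_\<mu>)
  qed
  have AE: "AE y in \<mu>. y \<in> W"
    unfolding \<mu>_def using AE_in_W by (subst AE_density) auto
  have Q: "emeasure N (centred_box (\<lambda>_. 1)) \<noteq> 0" using emeasure_centred_box_pos[of "\<lambda>_. 1"] by auto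
  have unique: "emeasure N (centred_box (\<lambda>_. 1)) * emeasure \<mu> B = emeasure N B * emeasure \<mu> (centred_box (\<lambda>_. 1))"
    if "B \<in> sets N" for B
    by (rule translation_invariant_unique[OF sf sets_\<mu> \<mu>_inv AE that])
  have "emeasure \<mu> (space N - E) = 0" by (simp add: \<mu> Int_Diff)
  hence "emeasure N (space N - E) = 0 \<or> emeasure \<mu> (centred_box (\<lambda>_. 1)) = 0"
    using unique[of "space N - E"] by auto
  moreover have "emeasure N E = 0" if "emeasure \<mu> (centred_box (\<lambda>_. 1)) = 0"
    using unique[of "space N"] that Q sets.sets_into_space[OF E] by (simp add: \<mu> Int_absorb2)
  ultimately show ?thesis by blast
qed

text \<open>By periodicity and cocompactness, a box of radius \<open>2 * C\<close> about any point
  of \<open>W\<close> contains at least the measure of \<open>Z \<inter> Q\<close>. Averaging over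
  the centres in the box of half the radii gives a density bound that depends only on a lower bound
  for the radii and not on the eccentricity of the box.\<close>

lemma periodic_positive_density:
  assumes Z [measurable]: "Z \<in> sets N" and pos: "emeasure N Z \<noteq> 0"
    and per: "\<And>a x. algebraic_int a \<Longrightarrow> x \<in> space N \<Longrightarrow> translate (emb a) x \<in> Z \<longleftrightarrow> x \<in> Z"
  obtains L d where "d > 0" "L > 0"
    "\<And>r. (\<And>\<rho>. \<rho> \<in> S \<Longrightarrow> L \<le> r \<rho>) \<Longrightarrow> d * measure N (centred_box r) \<le> measure N (Z \<inter> centred_box r)"
proof -
  obtain C where C: "C > 0"
    "\<And>x. (\<And>\<rho>. \<rho> \<in> S \<Longrightarrow> x \<rho> \<in> place_field \<rho>) \<Longrightarrow> \<exists>a. algebraic_int a \<and> (\<forall>\<rho>\<in>S. cmod (x \<rho> - \<rho> a) \<le> C)"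
    using integers_cocompact by blast
  define Q where "Q = centred_box (\<lambda>_. C)"
  define Q2 where "Q2 = centred_box (\<lambda>_. 2 * C)"
  have [measurable]: "Q \<in> sets N" "Q2 \<in> sets N" by (simp_all add: Q_def Q2_def)
  have sets_x: "A \<subseteq> space N" if "A \<in> sets N" for A using that by (rule sets.sets_into_space)
  have translated: "emeasure N (translate (emb (- a)) -` (Z \<inter> Q) \<inter> space N) = emeasure N (Z \<inter> Q)" for a
    by (intro emeasure_translate emb_in_W) simp
  \<comment> \<open>Otherwise the countably many integral translates of the null set
    \<open>Z \<inter> Q\<close> would cover almost all of \<open>Z\<close>.\<close>
  have z: "emeasure N (Z \<inter> Q) \<noteq> 0"
  proof
    assume 0: "emeasure N (Z \<inter> Q) = 0"
    let ?U = "\<Union>a\<in>{a. algebraic_int a}. translate (emb (- a)) -` (Z \<inter> Q) \<inter> space N"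
    have "countable {a :: 'k. algebraic_int a}"
      using number_field_countable[OF number_field] by (rule countable_subset[rotated]) simp
    moreover have "translate (emb (- a)) -` (Z \<inter> Q) \<inter> space N \<in> null_sets N" for a
      using translated[of a] 0 by (intro null_setsI) auto
    ultimately have "?U \<in> null_sets N" by (rule null_sets_UN')
    hence "AE x in N. x \<notin> ?U" by (rule AE_not_in)
    hence "AE x in N. x \<notin> Z"
      using AE_in_W
    proof eventually_elim
      case (elim x)
      obtain a where a: "algebraic_int a" "\<forall>\<rho>\<in>S. cmod (x \<rho> - \<rho> a) \<le> C"
        using C(2)[of x] elim(2) by (auto simp: W_def PiE_iff)
      have x: "x \<in> space N" using elim(2) W_subset by blast
      have "translate (emb (- a)) x \<in> Q"
        using a(2) by (auto simp: Q_def centred_box_def translate_def emb_def PiE_iff embedding_minus[OF embedding])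
      thus ?case using elim(1) a(1) x per[of "- a" x] by auto
    qed
    hence "emeasure N Z = 0" using AE_iff_measurable[of Z N "\<lambda>x. x \<notin> Z"] sets_x[OF Z] by auto
    thus False using pos by simp
  qed
  define neg where "neg = (\<lambda>v::('k \<Rightarrow> complex) \<Rightarrow> complex. \<lambda>\<rho>\<in>S. - v \<rho>)"
  have neg_W: "neg v \<in> W" if "v \<in> W" for v using uminus_in_W[OF that] by (simp add: neg_def)
  have [measurable]: "(\<lambda>p. translate (neg (fst p)) (snd p)) \<in> N \<Otimes>\<^sub>M N \<rightarrow>\<^sub>M N"
    unfolding translate_def neg_def by (rule measurable_N_I) simp
  have [measurable]: "(\<lambda>p. translate (neg (snd p)) (fst p)) \<in> N \<Otimes>\<^sub>M N \<rightarrow>\<^sub>M N"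
    unfolding translate_def neg_def by (rule measurable_N_I) simp
  have in_Q2: "translate (neg x) y \<in> Q2 \<longleftrightarrow> (\<forall>\<rho>\<in>S. cmod (y \<rho> - x \<rho>) \<le> 2 * C)" for x y
    by (simp add: Q2_def centred_box_def translate_def neg_def PiE_iff)
  hence Q2_sym: "translate (neg x) y \<in> Q2 \<longleftrightarrow> translate (neg y) x \<in> Q2" for x y
    by (simp add: norm_minus_commute)
  interpret P: pair_sigma_finite N N ..
  have local: "emeasure N (Z \<inter> Q) \<le> (\<integral>\<^sup>+ y. indicator Z y * indicator Q2 (translate (neg x) y) \<partial>N)"
    if x: "x \<in> W" for x
  proof -
    obtain a where a: "algebraic_int a" "\<forall>\<rho>\<in>S. cmod (x \<rho> - \<rho> a) \<le> C"
      using C(2)[of x] x by (auto simp: W_def PiE_iff)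
    have "emeasure N (Z \<inter> Q) = (\<integral>\<^sup>+ y. indicator (translate (emb (- a)) -` (Z \<inter> Q) \<inter> space N) y \<partial>N)"
      using translated[of a] by simp
    also have "\<dots> \<le> (\<integral>\<^sup>+ y. indicator Z y * indicator Q2 (translate (neg x) y) \<partial>N)"
    proof (rule nn_integral_mono)
      fix y assume y: "y \<in> space N"
      have "y \<in> Z \<and> translate (neg x) y \<in> Q2" if "translate (emb (- a)) y \<in> Z \<inter> Q"
      proof
        show "y \<in> Z" using per[of "- a" y] a(1) y that by simp
        show "translate (neg x) y \<in> Q2"
          unfolding in_Q2
        proof
          fix \<rho> assume \<rho>: "\<rho> \<in> S"
          have "cmod (y \<rho> - \<rho> a) \<le> C"
            using that \<rho> by (auto simp: Q_def centred_box_def translate_def emb_def PiE_iff embedding_minus[OF embedding])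
          moreover have "cmod (y \<rho> - x \<rho>) \<le> cmod (y \<rho> - \<rho> a) + cmod (x \<rho> - \<rho> a)"
            using norm_triangle_ineq4[of "y \<rho> - \<rho> a" "x \<rho> - \<rho> a"] by simp
          ultimately show "cmod (y \<rho> - x \<rho>) \<le> 2 * C" using a(2) \<rho> by fastforce
        qed
      qed
      thus "indicator (translate (emb (- a)) -` (Z \<inter> Q) \<inter> space N) y
          \<le> (indicator Z y * indicator Q2 (translate (neg x) y) :: ennreal)"
        by (auto split: split_indicator)
    qed
    finally show ?thesis .
  qed
  have main: "emeasure N (centred_box r') * emeasure N (Z \<inter> Q) \<le> emeasure N (Z \<inter> centred_box r) * emeasure N Q2"
    if r: "\<And>\<rho>. \<rho> \<in> S \<Longrightarrow> r' \<rho> + 2 * C \<le> r \<rho>" for r r'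
  proof -
    have "emeasure N (centred_box r') * emeasure N (Z \<inter> Q)
        = (\<integral>\<^sup>+ x. indicator (centred_box r') x * emeasure N (Z \<inter> Q) \<partial>N)"
      by (subst nn_integral_multc) auto
    also have "\<dots> \<le> (\<integral>\<^sup>+ x. indicator (centred_box r') x * (\<integral>\<^sup>+ y. indicator Z y * indicator Q2 (translate (neg x) y) \<partial>N) \<partial>N)"
    proof (rule nn_integral_mono_AE)
      show "AE x in N. indicator (centred_box r') x * emeasure N (Z \<inter> Q)
          \<le> indicator (centred_box r') x * (\<integral>\<^sup>+ y. indicator Z y * indicator Q2 (translate (neg x) y) \<partial>N)"
        using AE_in_W by eventually_elim (intro mult_left_mono local, auto)
    qed
    also have "\<dots> = (\<integral>\<^sup>+ x. \<integral>\<^sup>+ y. indicator (centred_box r') x * (indicator Z y * indicator Q2 (translate (neg x) y)) \<partial>N \<partial>N)"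
    proof (intro nn_integral_cong)
      fix x assume "x \<in> space N"
      hence [measurable]: "(\<lambda>y. translate (neg x) y) \<in> N \<rightarrow>\<^sub>M N" by simp
      show "indicator (centred_box r') x * (\<integral>\<^sup>+ y. indicator Z y * indicator Q2 (translate (neg x) y) \<partial>N)
          = (\<integral>\<^sup>+ y. indicator (centred_box r') x * (indicator Z y * indicator Q2 (translate (neg x) y)) \<partial>N)"
        by (subst nn_integral_cmult) auto
    qed
    also have "\<dots> = (\<integral>\<^sup>+ y. \<integral>\<^sup>+ x. indicator (centred_box r') x * (indicator Z y * indicator Q2 (translate (neg x) y)) \<partial>N \<partial>N)"
      by (rule P.Fubini'[symmetric]) measurable
    also have "\<dots> \<le> (\<integral>\<^sup>+ y. indicator (Z \<inter> centred_box r) y * emeasure N Q2 \<partial>N)"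
    proof (rule nn_integral_mono_AE)
      show "AE y in N. (\<integral>\<^sup>+ x. indicator (centred_box r') x * (indicator Z y * indicator Q2 (translate (neg x) y)) \<partial>N)
          \<le> indicator (Z \<inter> centred_box r) y * emeasure N Q2"
        using AE_in_W
      proof eventually_elim
        case (elim y)
        have [measurable]: "translate (neg y) \<in> N \<rightarrow>\<^sub>M N" by simp
        have "(\<integral>\<^sup>+ x. indicator (centred_box r') x * (indicator Z y * indicator Q2 (translate (neg x) y)) \<partial>N)
            \<le> (\<integral>\<^sup>+ x. indicator (Z \<inter> centred_box r) y * indicator (translate (neg y) -` Q2 \<inter> space N) x \<partial>N)"
        proof (rule nn_integral_mono)
          fix x assume x: "x \<in> space N"
          have "y \<in> centred_box r" if "x \<in> centred_box r'" "translate (neg x) y \<in> Q2"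
          proof -
            have "cmod (y \<rho>) \<le> r \<rho>" if \<rho>: "\<rho> \<in> S" for \<rho>
            proof -
              have "cmod (y \<rho>) \<le> cmod (x \<rho>) + cmod (y \<rho> - x \<rho>)"
                using norm_triangle_ineq[of "x \<rho>" "y \<rho> - x \<rho>"] by simp
              moreover have "cmod (x \<rho>) \<le> r' \<rho>"
                using \<open>x \<in> centred_box r'\<close> \<rho> by (auto simp: centred_box_def PiE_iff)
              moreover have "cmod (y \<rho> - x \<rho>) \<le> 2 * C"
                using \<open>translate (neg x) y \<in> Q2\<close> \<rho> in_Q2 by blast
              ultimately show ?thesis using r[OF \<rho>] by linarith
            qed
            thus ?thesis using elim W_subset by (auto simp: centred_box_def space_N PiE_iff)
          qed
          thus "indicator (centred_box r') x * (indicator Z y * indicator Q2 (translate (neg x) y))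
              \<le> (indicator (Z \<inter> centred_box r) y * indicator (translate (neg y) -` Q2 \<inter> space N) x :: ennreal)"
            using x Q2_sym[of x y] by (auto split: split_indicator)
        qed
        also have "\<dots> = indicator (Z \<inter> centred_box r) y * emeasure N (translate (neg y) -` Q2 \<inter> space N)"
          by (subst nn_integral_cmult) auto
        also have "\<dots> = indicator (Z \<inter> centred_box r) y * emeasure N Q2"
          by (subst emeasure_translate[OF neg_W[OF elim]]) auto
        finally show ?case .
      qed
    qed
    also have "\<dots> = emeasure N (Z \<inter> centred_box r) * emeasure N Q2"
      by (subst nn_integral_multc) auto
    finally show ?thesis .
  qed
  obtain k where k: "0 < k" "k < \<infinity>"
    "\<And>A. A \<in> sets N \<Longrightarrow> emeasure N (scale (\<lambda>_. of_real 2) -` A \<inter> space N) = k * emeasure N A"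
    using scale_measure[of "\<lambda>_. of_real 2"] of_real_in_place_field by (metis of_real_eq_0_iff zero_neq_numeral)
  have half: "emeasure N (centred_box (\<lambda>\<rho>. r \<rho> / 2)) = k * emeasure N (centred_box r)" for r
    using k(3)[of "centred_box r"] scale_vimage_centred_box[of "\<lambda>_. of_real 2" r] by simp
  have fin: "emeasure N A = ennreal (measure N A)" if "A \<subseteq> centred_box r" "A \<in> sets N" for A r
  proof (rule emeasure_eq_ennreal_measure)
    have "emeasure N A \<le> emeasure N (centred_box r)" using that(1) by (rule emeasure_mono) simp
    thus "emeasure N A \<noteq> top_class.top" using emeasure_centred_box_finite[of r] by (auto simp: top_unique)
  qed
  define kr where "kr = enn2real k"
  have kr: "k = ennreal kr" "kr > 0" using k(1,2) by (auto simp: kr_def enn2real_positive_iff less_top)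
  define d where "d = kr * measure N (Z \<inter> Q) / measure N Q2"
  have zQ: "measure N (Z \<inter> Q) > 0"
    using fin[of "Z \<inter> Q" "\<lambda>_. C"] z by (auto simp: Q_def zero_less_measure_iff)
  have Q2pos: "measure N Q2 > 0"
    using fin[of Q2 "\<lambda>_. 2 * C"] emeasure_centred_box_pos[of "\<lambda>_. 2 * C"] C(1)
    by (auto simp: Q2_def zero_less_measure_iff)
  show ?thesis
  proof (rule that[of d "4 * C"])
    show "d > 0" using kr zQ Q2pos by (simp add: d_def)
    show "4 * C > 0" using C(1) by simp
    fix r assume r: "\<And>\<rho>. \<rho> \<in> S \<Longrightarrow> 4 * C \<le> r \<rho>"
    \<comment> \<open>This is the origin of \<open>4 * C\<close>: half of a radius must leave room
      for the local box of radius \<open>2 * C\<close>.\<close>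
    have "r \<rho> / 2 + 2 * C \<le> r \<rho>" if "\<rho> \<in> S" for \<rho> using r[OF that] by simp
    hence "k * emeasure N (centred_box r) * emeasure N (Z \<inter> Q) \<le> emeasure N (Z \<inter> centred_box r) * emeasure N Q2"
      using main[of "\<lambda>\<rho>. r \<rho> / 2" r] by (simp add: half)
    hence "ennreal (kr * measure N (centred_box r) * measure N (Z \<inter> Q)) \<le> ennreal (measure N (Z \<inter> centred_box r) * measure N Q2)"
      using kr(2) fin[of "centred_box r" r] fin[of "Z \<inter> Q" "\<lambda>_. C"] fin[of "Z \<inter> centred_box r" r] fin[of Q2 "\<lambda>_. 2 * C"]
      by (simp add: kr(1) Q_def Q2_def ennreal_mult)
    hence "kr * measure N (centred_box r) * measure N (Z \<inter> Q) \<le> measure N (Z \<inter> centred_box r) * measure N Q2"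
      by (subst (asm) ennreal_le_iff) auto
    thus "d * measure N (centred_box r) \<le> measure N (Z \<inter> centred_box r)"
      using Q2pos by (simp add: d_def field_simps)
  qed
qed

text \<open>
  Multiplication by \<open>a\<close> maps \<open>E\<close> into itself.  If \<open>a\<^sup>-\<^sup>1 E - E\<close> were not null, it would have
  positive density in all large boxes, and passing from a box to its preimages would lower the
  density of \<open>E\<close> by a fixed amount each time.
\<close>

lemma multiplication_invariant:
  assumes E [measurable]: "E \<in> sets N" and a: "algebraic_int a" "a \<noteq> 0"
    and per: "\<And>b x. algebraic_int b \<Longrightarrow> x \<in> space N \<Longrightarrow> translate (emb b) x \<in> E \<longleftrightarrow> x \<in> E"
    and sub: "AE x in N. x \<in> E \<longrightarrow> scale (\<lambda>\<rho>. \<rho> a) x \<in> E"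
  shows "AE x in N. scale (\<lambda>\<rho>. \<rho> a) x \<in> E \<longleftrightarrow> x \<in> E"
proof -
  define T where "T = scale (\<lambda>\<rho>. \<rho> a)"
  have [measurable]: "T \<in> N \<rightarrow>\<^sub>M N" by (simp add: T_def)
  have T_space: "T x \<in> space N" for x by (simp add: T_def)
  have nz: "\<rho> a \<noteq> 0" if "\<rho> \<in> S" for \<rho> using emb_eq_0_iff[OF that] a(2) by simp
  define Z where "Z = {x \<in> space N. T x \<in> E \<and> x \<notin> E}"
  have [measurable]: "Z \<in> sets N" unfolding Z_def by measurable
  have T_translate: "T (translate (emb b) x) = translate (emb (a * b)) (T x)" for b x
    by (auto simp: T_def scale_def translate_def emb_def fun_eq_iff distrib_left emb_mult)
  have perZ: "translate (emb b) x \<in> Z \<longleftrightarrow> x \<in> Z" if "algebraic_int b" "x \<in> space N" for b x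
    using per[OF that] per[OF algebraic_int_add_mult(2)[OF a(1) that(1)] T_space] that(2)
    by (simp add: Z_def T_translate)
  have "emeasure N Z = 0"
  proof (rule ccontr)
    assume "emeasure N Z \<noteq> 0"
    then obtain L d where Ld: "d > 0" "L > 0"
      "\<And>r. (\<And>\<rho>. \<rho> \<in> S \<Longrightarrow> L \<le> r \<rho>) \<Longrightarrow> d * measure N (centred_box r) \<le> measure N (Z \<inter> centred_box r)"
      using periodic_positive_density[of Z] perZ by (metis \<open>Z \<in> sets N\<close>)
    obtain k where k: "0 < k" "k < \<infinity>" "\<And>A. A \<in> sets N \<Longrightarrow> emeasure N (T -` A \<inter> space N) = k * emeasure N A"
      using scale_measure[of "\<lambda>\<rho>. \<rho> a"] nz embedding_in_place_field unfolding T_def by metis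
    define kr where "kr = enn2real k"
    have kr: "k = ennreal kr" "kr > 0" using k(1,2) by (auto simp: kr_def enn2real_positive_iff less_top)
    have mk: "measure N (T -` A \<inter> space N) = kr * measure N A" if "A \<in> sets N" for A
      using k(3)[OF that] by (simp add: measure_def enn2real_mult kr_def)
    have box_fin: "emeasure N A \<noteq> \<infinity>" if "A \<subseteq> centred_box r" for A r
    proof -
      have "emeasure N A \<le> emeasure N (centred_box r)" using that by (rule emeasure_mono) simp
      thus ?thesis using emeasure_centred_box_finite[of r] by (auto simp: top_unique)
    qed
    \<comment> \<open>After \<open>n\<close> drops of size \<open>d\<close> a density would have to
      exceed 1 at the start.\<close>
    obtain n :: nat where n: "1 < real n * d" using Ld(1) reals_Archimedean3 by blast
    \<comment> \<open>Consecutive boxes are preimages of each other under \<open>T\<close>. The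
      maximum with 1, raised to the power \<open>n\<close>, keeps the first \<open>n + 1\<close> of
      them above \<open>L\<close> in every direction, whether \<open>a\<close> expands or contracts
      there.\<close>
    define r where "r = (\<lambda>j \<rho>. L * max 1 (cmod (\<rho> a)) ^ n / cmod (\<rho> a) ^ j)"
    have r_ge: "L \<le> r j \<rho>" if "j \<le> n" "\<rho> \<in> S" for j \<rho>
    proof -
      have c: "cmod (\<rho> a) > 0" using nz[OF that(2)] by simp
      have "cmod (\<rho> a) ^ j \<le> max 1 (cmod (\<rho> a)) ^ j" by (intro power_mono) auto
      also have "\<dots> \<le> max 1 (cmod (\<rho> a)) ^ n" using that by (intro power_increasing) auto
      finally have "L * cmod (\<rho> a) ^ j \<le> L * max 1 (cmod (\<rho> a)) ^ n"
        using Ld(2) by (intro mult_left_mono) auto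
      thus ?thesis using c by (simp add: r_def le_divide_eq)
    qed
    have pre: "T -` centred_box (r j) \<inter> space N = centred_box (r (Suc j))" for j
      unfolding T_def by (subst scale_vimage_centred_box) (auto simp: nz r_def mult.commute)
    define D where "D j = measure N (E \<inter> centred_box (r j)) / measure N (centred_box (r j))" for j
    have box_pos: "measure N (centred_box (r j)) > 0" if "j \<le> n" for j
    proof -
      have "emeasure N (centred_box (r j)) > 0"
        using r_ge[OF that] Ld(2) by (intro emeasure_centred_box_pos) (meson less_le_trans)
      thus ?thesis using box_fin[of "centred_box (r j)" "r j"]
        by (simp add: zero_less_measure_iff measure_def enn2real_positive_iff less_top)
    qed
    have step: "D (Suc j) + d \<le> D j" if "Suc j \<le> n" for j
    proof -
      let ?B = "centred_box (r (Suc j))"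
      have "kr * measure N (E \<inter> centred_box (r j)) = measure N (T -` (E \<inter> centred_box (r j)) \<inter> space N)"
        by (subst mk) auto
      also have "T -` (E \<inter> centred_box (r j)) \<inter> space N = (T -` E \<inter> space N) \<inter> ?B"
        using pre[of j] by auto
      \<comment> \<open>Up to a null set the preimage of \<open>E\<close> contains \<open>E\<close>
        and, disjointly from it, \<open>Z\<close>; the latter accounts for the drop
        \<open>d\<close>.\<close>
      also have "measure N ((E \<union> Z) \<inter> ?B) \<le> measure N ((T -` E \<inter> space N) \<inter> ?B)"
        unfolding measure_def
      proof (intro enn2real_mono)
        show "emeasure N ((E \<union> Z) \<inter> ?B) \<le> emeasure N ((T -` E \<inter> space N) \<inter> ?B)"
          using sub AE_space by (intro emeasure_mono_AE) (auto simp: Z_def T_def elim!: eventually_mono)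
        show "emeasure N ((T -` E \<inter> space N) \<inter> ?B) < top_class.top"
          using box_fin[of "(T -` E \<inter> space N) \<inter> ?B" "r (Suc j)"] by (auto simp: less_top)
      qed
      moreover have "measure N ((E \<union> Z) \<inter> ?B) = measure N (E \<inter> ?B) + measure N (Z \<inter> ?B)"
      proof -
        have "measure N ((E \<inter> ?B) \<union> (Z \<inter> ?B)) = measure N (E \<inter> ?B) + measure N (Z \<inter> ?B)"
          using box_fin[of "E \<inter> ?B" "r (Suc j)"] box_fin[of "Z \<inter> ?B" "r (Suc j)"]
          by (intro measure_Union) (auto simp: Z_def)
        thus ?thesis by (simp add: Int_Un_distrib2)
      qed
      moreover have "d * measure N ?B \<le> measure N (Z \<inter> ?B)" using r_ge that by (intro Ld(3)) auto
      ultimately have "measure N (E \<inter> ?B) + d * measure N ?B \<le> kr * measure N (E \<inter> centred_box (r j))"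
        by linarith
      moreover have B: "measure N ?B = kr * measure N (centred_box (r j))"
        using mk[of "centred_box (r j)"] pre[of j] by simp
      ultimately have "(measure N (E \<inter> ?B) + d * measure N ?B) / measure N ?B
          \<le> kr * measure N (E \<inter> centred_box (r j)) / measure N ?B"
        by (intro divide_right_mono measure_nonneg)
      moreover have "kr * measure N (E \<inter> centred_box (r j)) / measure N ?B = D j"
        unfolding B D_def using kr(2) by simp
      moreover have "(measure N (E \<inter> ?B) + d * measure N ?B) / measure N ?B = D (Suc j) + d"
        unfolding D_def using box_pos[OF that] by (simp add: add_divide_distrib)
      ultimately show ?thesis by simp
    qed
    have "real j * d \<le> D (n - j)" if "j \<le> n" for j
      using that
    proof (induction j)
      case 0
      show ?case by (simp add: D_def)
    next
      case (Suc j)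
      hence "D (n - j) + d \<le> D (n - Suc j)" using step[of "n - Suc j"] by (simp add: Suc_diff_Suc)
      thus ?case using Suc by (simp add: algebra_simps)
    qed
    from this[of n] have "real n * d \<le> D 0" by simp
    also have "\<dots> \<le> 1"
    proof -
      have "measure N (E \<inter> centred_box (r 0)) \<le> measure N (centred_box (r 0))"
        unfolding measure_def using box_fin[of "centred_box (r 0)" "r 0"]
        by (intro enn2real_mono emeasure_mono) (auto simp: less_top)
      thus ?thesis using box_pos[of 0] by (simp add: D_def)
    qed
    finally show False using n by simp
  qed
  hence "AE x in N. x \<notin> Z" using \<open>Z \<in> sets N\<close> by (intro AE_not_in null_setsI)
  thus ?thesis using sub AE_space by eventually_elim (auto simp: Z_def T_def)
qed

end

section \<open>Cassels' lemma\<close>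

text \<open>Infinitude as a statement about all finite exceptional sets; a countable
  \<open>J\<close> has only countably many of these, which yields measurability.\<close>

lemma infinite_Collect_iff:
  "infinite {i\<in>J. P i} \<longleftrightarrow> (\<forall>G\<in>{G. finite G \<and> G \<subseteq> J}. \<exists>i\<in>J. i \<notin> G \<and> P i)"
proof
  assume inf: "infinite {i\<in>J. P i}"
  show "\<forall>G\<in>{G. finite G \<and> G \<subseteq> J}. \<exists>i\<in>J. i \<notin> G \<and> P i"
  proof
    fix G assume "G \<in> {G. finite G \<and> G \<subseteq> J}"
    hence "infinite ({i\<in>J. P i} - G)" using inf by (simp add: Diff_infinite_finite)
    hence "{i\<in>J. P i} - G \<noteq> {}" by (metis finite.emptyI)
    thus "\<exists>i\<in>J. i \<notin> G \<and> P i" by blast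
  qed
next
  assume *: "\<forall>G\<in>{G. finite G \<and> G \<subseteq> J}. \<exists>i\<in>J. i \<notin> G \<and> P i"
  show "infinite {i\<in>J. P i}"
  proof
    assume "finite {i\<in>J. P i}"
    hence "\<exists>i\<in>J. i \<notin> {i\<in>J. P i} \<and> P i" by (intro bspec[OF *]) auto
    thus False by blast
  qed
qed

lemma sets_Collect_infinite:
  assumes "countable J" "\<And>i. i \<in> J \<Longrightarrow> {x\<in>space M. P i x} \<in> sets M"
  shows "{x\<in>space M. infinite {i\<in>J. P i x}} \<in> sets M"
proof -
  have "countable {G. finite G \<and> G \<subseteq> J}" using assms(1) by (rule countable_Collect_finite_subset)
  moreover have "{x \<in> space M. \<exists>i\<in>J. i \<notin> G \<and> P i x} \<in> sets M" for G
  proof -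
    have "(\<Union>i\<in>J - G. {x\<in>space M. P i x}) \<in> sets M"
      using assms by (intro sets.countable_UN') (auto intro: countable_subset)
    moreover have "(\<Union>i\<in>J - G. {x\<in>space M. P i x}) = {x \<in> space M. \<exists>i\<in>J. i \<notin> G \<and> P i x}" by blast
    ultimately show ?thesis by simp
  qed
  ultimately show ?thesis
    unfolding infinite_Collect_iff by (intro sets.sets_Collect_countable_All') auto
qed

text \<open>
  Cassels' lemma.  A point of \<open>Z\<close> lies in no ball of radius \<open>r i\<close> with \<open>i \<notin> G\<close>, but in
  arbitrarily small balls of radius \<open>K r i\<close>.  A Vitali subcover of \<open>Z\<close> inside an open
  \<open>U \<supseteq> Z\<close> shows that \<open>\<lambda>(Z)\<close> is at most a constant times \<open>\<lambda>(U - Z)\<close>.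
\<close>

lemma cassels_lborel:
  fixes c :: "'i \<Rightarrow> 'a::euclidean_space"
  assumes J: "countable J" and r: "\<And>i. i \<in> J \<Longrightarrow> 0 \<le> r i" and K: "1 \<le> K"
    and shrink: "\<And>x e. 0 < e \<Longrightarrow> finite {i\<in>J. dist x (c i) \<le> K * r i \<and> e \<le> r i}"
  shows "AE x in lborel. infinite {i\<in>J. dist x (c i) \<le> K * r i} \<longrightarrow> infinite {i\<in>J. dist x (c i) \<le> r i}"
proof -
  define Z where "Z G = {x. infinite {i\<in>J. dist x (c i) \<le> K * r i} \<and> (\<forall>i\<in>J - G. \<not> dist x (c i) \<le> r i)}" for G
  have null: "Z G \<in> null_sets lborel" if G: "finite G" for G
  proof -
    have "{x\<in>space lborel. infinite {i\<in>J. dist x (c i) \<le> K * r i}} \<in> sets lborel"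
      using J by (rule sets_Collect_infinite) simp
    moreover have "{x\<in>space lborel. \<forall>i\<in>J - G. \<not> dist x (c i) \<le> r i} \<in> sets lborel"
      using J by (intro sets.sets_Collect_countable_All') (auto intro: countable_subset)
    ultimately have "{x\<in>space lborel. infinite {i\<in>J. dist x (c i) \<le> K * r i}} \<inter>
        {x\<in>space lborel. \<forall>i\<in>J - G. \<not> dist x (c i) \<le> r i} \<in> sets lborel" by (rule sets.Int)
    also have "{x\<in>space lborel. infinite {i\<in>J. dist x (c i) \<le> K * r i}} \<inter>
        {x\<in>space lborel. \<forall>i\<in>J - G. \<not> dist x (c i) \<le> r i} = Z G"
      by (auto simp: Z_def)
    finally have Z: "Z G \<in> sets borel" by simp
    define n where "n = DIM('a)"
    have bound: "emeasure lborel (Z G) \<le> ennreal e" if e: "e > 0" for e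
    proof -
      have Kn: "K ^ n > 0" using K by simp
      \<comment> \<open>The factor \<open>K ^ n\<close> is the volume ratio of balls of radii
        \<open>K * r i\<close> and \<open>r i\<close>, so this margin becomes exactly
        \<open>e\<close> at the end.\<close>
      obtain U where U: "open U" "Z G \<subseteq> U" "emeasure lborel (U - Z G) < ennreal (e / K ^ n)"
        using outer_regular_lborel[OF Z, of "e / K ^ n"] e Kn by auto
      define I where "I = {i\<in>J - G. 0 < r i \<and> cball (c i) (K * r i) \<subseteq> U}"
      have fine: "\<exists>i. i \<in> I \<and> x \<in> cball (c i) (K * r i) \<and> K * r i < d" if x: "x \<in> Z G" and d: "0 < d" for x d
      proof -
        obtain \<delta> where \<delta>: "\<delta> > 0" "ball x \<delta> \<subseteq> U" using U(1,2) x by (meson open_contains_ball subsetD)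
        \<comment> \<open>Radii below \<open>e'\<close> give enlarged balls of radius less than
          \<open>d\<close> and less than \<open>\<delta> / 2\<close>; a ball of the latter size
          containing \<open>x\<close> stays inside \<open>U\<close>.\<close>
        define e' where "e' = min d (\<delta> / 2) / K"
        have e': "e' > 0" using d \<delta>(1) K by (simp add: e'_def)
        have "infinite {i\<in>J. dist x (c i) \<le> K * r i}" using x by (simp add: Z_def)
        hence inf: "infinite ({i\<in>J. dist x (c i) \<le> K * r i} - (G \<union> {i\<in>J. dist x (c i) \<le> K * r i \<and> e' \<le> r i}))"
          using G shrink[OF e'] by (intro Diff_infinite_finite) auto
        obtain i where
          "i \<in> {i\<in>J. dist x (c i) \<le> K * r i} - (G \<union> {i\<in>J. dist x (c i) \<le> K * r i \<and> e' \<le> r i})"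
          using infinite_imp_nonempty[OF inf, folded ex_in_conv] by (elim exE)
        hence i: "i \<in> J" "dist x (c i) \<le> K * r i" "i \<notin> G" "r i < e'" by auto
        have "\<not> dist x (c i) \<le> r i" using x i(1,3) unfolding Z_def by blast
        hence "r i < dist x (c i)" by simp
        \<comment> \<open>A ball of radius 0 equals its own enlargement, so a point of the
          enlargement outside the ball excludes it.\<close>
        hence "0 < r i" using i r[of i] K by (metis less_eq_real_def mult_zero_right not_less)
        have Kr: "K * r i < min d (\<delta> / 2)" using i(4) K by (simp add: e'_def field_simps)
        have "cball (c i) (K * r i) \<subseteq> ball x \<delta>"
        proof
          fix y assume "y \<in> cball (c i) (K * r i)"
          hence "dist x y \<le> K * r i + K * r i" using i(2) dist_triangle[of x y "c i"] by simp
          thus "y \<in> ball x \<delta>" using Kr by simp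
        qed
        thus ?thesis using i Kr \<open>0 < r i\<close> \<delta>(2) by (auto simp: I_def dist_commute intro!: exI[of _ i])
      qed
      have rpos: "0 < K * r i" if "i \<in> I" for i using that K by (simp add: I_def)
      obtain C where C: "countable C" "C \<subseteq> I"
        "pairwise (\<lambda>i j. disjnt (cball (c i) (K * r i)) (cball (c j) (K * r j))) C"
        "negligible (Z G - (\<Union>i\<in>C. cball (c i) (K * r i)))"
        by (rule Vitali_covering_theorem_cballs[where K = I and r = "\<lambda>i. K * r i" and a = c and S = "Z G",
              OF rpos fine]) (assumption | rule that)+
      have disj: "disjoint_family_on (\<lambda>i. cball (c i) (K * r i)) C"
        using C(3) by (auto simp: disjoint_family_on_def pairwise_def disjnt_def)
      have sub: "cball (c i) (r i) \<subseteq> cball (c i) (K * r i)" if "i \<in> C" for i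
      proof -
        have "0 \<le> r i" using that C(2) by (auto simp: I_def)
        hence "r i \<le> K * r i" using mult_right_mono[OF K, of "r i"] by simp
        thus ?thesis by (rule subset_cball)
      qed
      have disj': "disjoint_family_on (\<lambda>i. cball (c i) (r i)) C"
        using disj sub unfolding disjoint_family_on_def by fast
      have borel: "(\<Union>i\<in>C. cball (c i) (K * r i)) \<in> sets borel" using C(1) by (intro sets.countable_UN') auto
      have "Z G - (\<Union>i\<in>C. cball (c i) (K * r i)) \<in> null_sets lborel"
        using C(4) Z borel by (subst (asm) negligible_iff_null_sets) (auto simp: null_sets_completion_iff)
      hence "emeasure lborel (Z G) \<le> emeasure lborel (\<Union>i\<in>C. cball (c i) (K * r i))"
        using Z borel by (intro emeasure_mono_AE) (auto dest!: AE_not_in elim!: eventually_mono)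
      also have "\<dots> = (\<integral>\<^sup>+ i. emeasure lborel (cball (c i) (K * r i)) \<partial>count_space C)"
        using C(1) disj by (intro emeasure_UN_countable) auto
      also have "\<dots> = (\<integral>\<^sup>+ i. ennreal (K ^ n) * emeasure lborel (cball (c i) (r i)) \<partial>count_space C)"
      proof (intro nn_integral_cong)
        fix i assume "i \<in> space (count_space C)"
        hence ri: "0 \<le> r i" using C(2) by (auto simp: I_def)
        have Kr: "0 \<le> K * r i" using ri K by simp
        show "emeasure lborel (cball (c i) (K * r i)) = ennreal (K ^ n) * emeasure lborel (cball (c i) (r i))"
          unfolding emeasure_cball[OF ri] emeasure_cball[OF Kr] using K ri
          by (simp add: n_def power_mult_distrib flip: ennreal_mult)
      qed
      also have "\<dots> = ennreal (K ^ n) * (\<integral>\<^sup>+ i. emeasure lborel (cball (c i) (r i)) \<partial>count_space C)"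
        by (rule nn_integral_cmult) simp
      also have "(\<integral>\<^sup>+ i. emeasure lborel (cball (c i) (r i)) \<partial>count_space C) = emeasure lborel (\<Union>i\<in>C. cball (c i) (r i))"
        using C(1) disj' by (intro emeasure_UN_countable[symmetric]) auto
      also have "\<dots> \<le> emeasure lborel (U - Z G)"
      proof (rule emeasure_mono)
        \<comment> \<open>The unenlarged balls with index outside \<open>G\<close> avoid
          \<open>Z G\<close> by its definition, while their enlargements lie in
          \<open>U\<close>.\<close>
        show "(\<Union>i\<in>C. cball (c i) (r i)) \<subseteq> U - Z G"
          using sub C(2) by (fastforce simp: I_def Z_def dist_commute)
      qed (use U(1) Z in auto)
      also have "\<dots> \<le> ennreal (e / K ^ n)" using U(3) by simp
      finally have "emeasure lborel (Z G) \<le> ennreal (K ^ n) * ennreal (e / K ^ n)"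
        by (simp add: mult_left_mono)
      also have "\<dots> = ennreal (K ^ n * (e / K ^ n))" using Kn e by (intro ennreal_mult[symmetric]) auto
      also have "K ^ n * (e / K ^ n) = e" using K by auto
      finally show ?thesis .
    qed
    have "emeasure lborel (Z G) \<le> 0"
    proof (rule ennreal_le_epsilon)
      fix e :: real assume "0 < e"
      thus "emeasure lborel (Z G) \<le> 0 + ennreal e" using bound[of e] by simp
    qed
    hence "emeasure lborel (Z G) = 0" by simp
    thus ?thesis using Z by (intro null_setsI) simp_all
  qed
  have "countable {G. finite G \<and> G \<subseteq> J}" using J by (rule countable_Collect_finite_subset)
  hence "AE x in lborel. \<forall>G\<in>{G. finite G \<and> G \<subseteq> J}. x \<notin> Z G"
    using null by (subst AE_ball_countable) (auto intro: AE_not_in)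
  thus ?thesis
  proof eventually_elim
    case (elim x)
    define G where "G = {i\<in>J. dist x (c i) \<le> r i}"
    have G: "G \<subseteq> J" "\<forall>i\<in>J - G. \<not> dist x (c i) \<le> r i" by (auto simp: G_def)
    have "infinite G" if "infinite {i\<in>J. dist x (c i) \<le> K * r i}"
    proof
      assume "finite G"
      hence "x \<notin> Z G" using elim G(1) by blast
      thus False using that G(2) by (simp add: Z_def)
    qed
    from this[unfolded G_def] show ?case by (intro impI)
  qed
qed

text \<open>At a real place the centres lie on the real axis, where the distance in the plane is the
  distance on the line, so the one-dimensional statement applies.\<close>

lemma cassels_place:
  assumes J: "countable J" and r: "\<And>i. i \<in> J \<Longrightarrow> 0 \<le> r i" and K: "1 \<le> K"
    and c: "\<And>i. i \<in> J \<Longrightarrow> c i \<in> place_field \<rho>"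
    and shrink: "\<And>z e. 0 < e \<Longrightarrow> finite {i\<in>J. cmod (z - c i) \<le> K * r i \<and> e \<le> r i}"
  shows "AE z in place_measure \<rho>. infinite {i\<in>J. cmod (z - c i) \<le> K * r i} \<longrightarrow> infinite {i\<in>J. cmod (z - c i) \<le> r i}"
proof (cases "real_embedding \<rho>")
  case False
  have "AE z in lborel. infinite {i\<in>J. dist z (c i) \<le> K * r i} \<longrightarrow> infinite {i\<in>J. dist z (c i) \<le> r i}"
    by (rule cassels_lborel[OF J r K]) (use shrink in \<open>auto simp: dist_norm\<close>)
  hence "AE z in lborel. infinite {i\<in>J. cmod (z - c i) \<le> K * r i} \<longrightarrow> infinite {i\<in>J. cmod (z - c i) \<le> r i}"
    by (simp only: dist_norm)
  moreover have "place_measure \<rho> = lborel" using False by (simp add: place_measure_def)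
  ultimately show ?thesis by (simp only:)
next
  case True
  have cr: "cmod (of_real x - c i) = dist x (Re (c i))" if "i \<in> J" for x i
  proof -
    have "c i = of_real (Re (c i))" using c[OF that] True by (simp add: place_field_def of_real_Re)
    hence "of_real x - c i = of_real (x - Re (c i))" by simp
    thus ?thesis by (simp only: norm_of_real dist_real_def)
  qed
  have eq: "{i\<in>J. cmod (of_real x - c i) \<le> k * r i \<and> P i} = {i\<in>J. dist x (Re (c i)) \<le> k * r i \<and> P i}" for x k P
    using cr by auto
  have "AE x in lborel. infinite {i\<in>J. dist x (Re (c i)) \<le> K * r i} \<longrightarrow> infinite {i\<in>J. dist x (Re (c i)) \<le> r i}"
  proof (rule cassels_lborel[OF J r K])
    fix x e :: real assume "0 < e"
    thus "finite {i\<in>J. dist x (Re (c i)) \<le> K * r i \<and> e \<le> r i}" using shrink[of e "of_real x"] by (simp add: eq)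
  qed
  hence AE: "AE x in lborel. infinite {i\<in>J. cmod (of_real x - c i) \<le> K * r i} \<longrightarrow> infinite {i\<in>J. cmod (of_real x - c i) \<le> r i}"
    using eq[of _ K "\<lambda>_. True"] eq[of _ 1 "\<lambda>_. True"] by simp
  have sets: "{z\<in>space borel. infinite {i\<in>J. cmod (z - c i) \<le> k * r i}} \<in> sets borel" for k
    using J by (rule sets_Collect_infinite) simp
  have "{z\<in>space borel. infinite {i\<in>J. cmod (z - c i) \<le> K * r i} \<longrightarrow> infinite {i\<in>J. cmod (z - c i) \<le> r i}} \<in> sets borel"
    using sets[of K] sets[of 1] by (intro sets.sets_Collect_imp) auto
  hence "AE z in distr lborel borel complex_of_real. infinite {i\<in>J. cmod (z - c i) \<le> K * r i} \<longrightarrow> infinite {i\<in>J. cmod (z - c i) \<le> r i}"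
    using AE by (subst AE_distr_iff) auto
  moreover have "place_measure \<rho> = distr lborel borel complex_of_real" using True by (simp add: place_measure_def)
  ultimately show ?thesis by (simp only:)
qed

context number_field_places
begin

text \<open>
  Only the radius at \<open>\<rho>0\<close> is enlarged, so that no differentiation theorem for boxes of
  unbounded eccentricity is needed: on each line in direction \<open>\<rho>0\<close> this is Cassels' lemma.
\<close>

lemma cassels_coordinate:
  fixes w :: "'k \<Rightarrow> ('k \<Rightarrow> complex) \<Rightarrow> real"
  assumes \<rho>0: "\<rho>0 \<in> S" and w: "\<And>g \<rho>. g \<in> J \<Longrightarrow> \<rho> \<in> S \<Longrightarrow> 0 \<le> w g \<rho>" and K: "1 \<le> K"
    and shrink: "\<And>x e. x \<in> space N \<Longrightarrow> 0 < e \<Longrightarrow>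
      finite {g\<in>J. (\<forall>\<rho>\<in>S. cmod (x \<rho> - \<rho> g) \<le> (if \<rho> = \<rho>0 then K else 1) * w g \<rho>) \<and> e \<le> w g \<rho>0}"
  shows "AE x in N. infinite {g\<in>J. \<forall>\<rho>\<in>S. cmod (x \<rho> - \<rho> g) \<le> (if \<rho> = \<rho>0 then K else 1) * w g \<rho>} \<longrightarrow>
     infinite {g\<in>J. \<forall>\<rho>\<in>S. cmod (x \<rho> - \<rho> g) \<le> w g \<rho>}"
proof -
  have J: "countable J" using number_field_countable[OF number_field] by (rule countable_subset[rotated]) simp
  let ?A = "\<lambda>K x. {g\<in>J. \<forall>\<rho>\<in>S. cmod (x \<rho> - \<rho> g) \<le> (if \<rho> = \<rho>0 then K else 1) * w g \<rho>}"
  have sets: "{x\<in>space N. infinite (?A K x)} \<in> sets N" for K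
    using J
  proof (rule sets_Collect_infinite)
    fix g
    show "{x \<in> space N. \<forall>\<rho>\<in>S. cmod (x \<rho> - \<rho> g) \<le> (if \<rho> = \<rho>0 then K else 1) * w g \<rho>} \<in> sets N"
      using finite_places by (intro sets.sets_Collect_finite_All) auto
  qed
  define B where "B = {x\<in>space N. infinite (?A K x)} - {x\<in>space N. infinite (?A 1 x)}"
  have B: "B \<in> sets N" unfolding B_def by (intro sets.Diff sets)
  define S' where "S' = S - {\<rho>0}"
  have S: "insert \<rho>0 S' = S" "\<rho>0 \<notin> S'" "finite S'" using \<rho>0 finite_places by (auto simp: S'_def)
  have "emeasure N B = (\<integral>\<^sup>+ x. indicator B x \<partial>PiM (insert \<rho>0 S') place_measure)"
    using B by (simp add: S(1) N_def)
  also have "\<dots> = (\<integral>\<^sup>+ x. (\<integral>\<^sup>+ z. indicator B (x(\<rho>0 := z)) \<partial>place_measure \<rho>0) \<partial>PiM S' place_measure)"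
    using B by (intro product_nn_integral_insert S) (simp add: S(1) N_def)
  also have "\<dots> = (\<integral>\<^sup>+ x. 0 \<partial>PiM S' place_measure)"
  proof (rule nn_integral_cong)
    fix x assume "x \<in> space (PiM S' place_measure)"
    hence x: "x(\<rho>0 := z) \<in> space N" for z
      using S by (auto simp: space_PiM space_N PiE_iff extensional_def)
    \<comment> \<open>With the coordinates other than \<open>\<rho>0\<close> frozen, the
      approximants that satisfy the remaining conditions form a fixed index set, common to the
      enlarged and the original radius.\<close>
    define J' where "J' = {g\<in>J. \<forall>\<rho>\<in>S'. cmod (x \<rho> - \<rho> g) \<le> w g \<rho>}"
    have A: "?A k (x(\<rho>0 := z)) = {g\<in>J'. cmod (z - \<rho>0 g) \<le> k * w g \<rho>0}" for k z
    proof -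
      have "(\<forall>\<rho>\<in>S. cmod ((x(\<rho>0 := z)) \<rho> - \<rho> g) \<le> (if \<rho> = \<rho>0 then k else 1) * w g \<rho>) \<longleftrightarrow>
         cmod (z - \<rho>0 g) \<le> k * w g \<rho>0 \<and> (\<forall>\<rho>\<in>S'. cmod (x \<rho> - \<rho> g) \<le> w g \<rho>)" for g
        unfolding S(1)[symmetric] using S(2) by (auto simp: ball_simps)
      thus ?thesis by (auto simp: J'_def)
    qed
    have "AE z in place_measure \<rho>0. infinite {g\<in>J'. cmod (z - \<rho>0 g) \<le> K * w g \<rho>0} \<longrightarrow>
       infinite {g\<in>J'. cmod (z - \<rho>0 g) \<le> w g \<rho>0}"
    proof (rule cassels_place[OF _ _ K])
      show "countable J'" using J by (rule countable_subset[rotated]) (auto simp: J'_def)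
      show "0 \<le> w g \<rho>0" if "g \<in> J'" for g using that w \<rho>0 by (auto simp: J'_def)
      show "\<rho>0 g \<in> place_field \<rho>0" for g by (rule embedding_in_place_field)
      fix z and e :: real assume e: "0 < e"
      have "{g\<in>J'. cmod (z - \<rho>0 g) \<le> K * w g \<rho>0 \<and> e \<le> w g \<rho>0} = {g \<in> ?A K (x(\<rho>0 := z)). e \<le> w g \<rho>0}"
        unfolding A by auto
      thus "finite {g\<in>J'. cmod (z - \<rho>0 g) \<le> K * w g \<rho>0 \<and> e \<le> w g \<rho>0}"
        using shrink[OF x e] by simp
    qed
    hence "AE z in place_measure \<rho>0. indicator B (x(\<rho>0 := z)) = (0 :: ennreal)"
    proof eventually_elim
      case (elim z)
      hence "x(\<rho>0 := z) \<notin> B" unfolding B_def Diff_iff mem_Collect_eq A mult_1 using x by blast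
      thus ?case by simp
    qed
    moreover have "(\<lambda>z. indicator B (x(\<rho>0 := z)) :: ennreal) \<in> borel_measurable (place_measure \<rho>0)"
    proof -
      have "(\<lambda>z. x(\<rho>0 := z)) \<in> place_measure \<rho>0 \<rightarrow>\<^sub>M PiM (insert \<rho>0 S') place_measure"
        using measurable_component_update[of x S' place_measure \<rho>0] \<open>x \<in> space (PiM S' place_measure)\<close> S(2) by simp
      hence "(\<lambda>z. x(\<rho>0 := z)) \<in> place_measure \<rho>0 \<rightarrow>\<^sub>M N" by (simp add: S(1) N_def)
      thus ?thesis using B by measurable
    qed
    ultimately show "(\<integral>\<^sup>+ z. indicator B (x(\<rho>0 := z)) \<partial>place_measure \<rho>0) = 0"
      by (subst nn_integral_0_iff_AE) auto
  qed
  finally have "emeasure N B = 0" by simp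
  hence "AE x in N. x \<notin> B" using B by (intro AE_not_in null_setsI)
  thus ?thesis
    using AE_space
  proof eventually_elim
    case (elim x)
    have "?A 1 x = {g\<in>J. \<forall>\<rho>\<in>S. cmod (x \<rho> - \<rho> g) \<le> w g \<rho>}" by simp
    thus ?case using elim unfolding B_def Diff_iff mem_Collect_eq by metis
  qed
qed

end

section \<open>Limsup sets and finiteness of ideals\<close>

context number_field_places
begin

lemma AE_scale:
  assumes c: "\<And>\<rho>. \<rho> \<in> S \<Longrightarrow> c \<rho> \<in> place_field \<rho>" "\<And>\<rho>. \<rho> \<in> S \<Longrightarrow> c \<rho> \<noteq> 0"
    and P: "AE x in N. P x"
  shows "AE x in N. P (scale c x)"
proof -
  obtain k where k: "\<And>A. A \<in> sets N \<Longrightarrow> emeasure N (scale c -` A \<inter> space N) = k * emeasure N A"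
    using scale_measure[OF c] by metis
  obtain A where A: "{x\<in>space N. \<not> P x} \<subseteq> A" "A \<in> sets N" "emeasure N A = 0"
    using P by (rule AE_E)
  have "scale c -` A \<inter> space N \<in> null_sets N"
    using A k by (intro null_setsI) auto
  moreover have "{x\<in>space N. \<not> P (scale c x)} \<subseteq> scale c -` A \<inter> space N"
    using subsetD[OF A(1)] by force
  ultimately show ?thesis by (rule AE_I')
qed

section \<open>Limsup sets of boxes and the zero-one property\<close>

definition limsup_boxes :: "'k set \<Rightarrow> ('k \<Rightarrow> ('k \<Rightarrow> complex) \<Rightarrow> real) \<Rightarrow> (('k \<Rightarrow> complex) \<Rightarrow> complex) set" where
  "limsup_boxes J f = {x\<in>space N. infinite {g\<in>J. \<forall>\<rho>\<in>S. cmod (x \<rho> - \<rho> g) \<le> f g \<rho>}}"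

lemma limsup_boxes_sets [measurable]: "limsup_boxes J f \<in> sets N"
  unfolding limsup_boxes_def
proof (rule sets_Collect_infinite)
  show "countable J" using number_field_countable[OF number_field] by (rule countable_subset[rotated]) simp
  show "{x \<in> space N. \<forall>\<rho>\<in>S. cmod (x \<rho> - \<rho> g) \<le> f g \<rho>} \<in> sets N" for g
    using finite_places by (intro sets.sets_Collect_finite_All) auto
qed

lemma limsup_boxes_Un: "limsup_boxes (J \<union> J') f = limsup_boxes J f \<union> limsup_boxes J' f"
proof -
  have "{g\<in>J \<union> J'. P g} = {g\<in>J. P g} \<union> {g\<in>J'. P g}" for P by blast
  thus ?thesis unfolding limsup_boxes_def by auto
qed

lemma limsup_boxes_empty [simp]: "limsup_boxes {} f = {}"
  by (simp add: limsup_boxes_def)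

lemma limsup_boxes_UN:
  assumes "finite I"
  shows "limsup_boxes (\<Union>i\<in>I. J i) f = (\<Union>i\<in>I. limsup_boxes (J i) f)"
  using assms by (induction I rule: finite_induct) (auto simp: limsup_boxes_Un)

lemma limsup_boxes_mono: "J \<subseteq> J' \<Longrightarrow> limsup_boxes J f \<subseteq> limsup_boxes J' f"
  unfolding limsup_boxes_def by (auto elim!: contrapos_nn finite_subset[rotated])

lemma limsup_boxes_shift:
  assumes x: "x \<in> limsup_boxes J f"
    and J: "\<And>g. g \<in> J \<Longrightarrow> g + h \<in> J'" and f: "\<And>g. g \<in> J \<Longrightarrow> f' (g + h) = f g"
  shows "translate (emb h) x \<in> limsup_boxes J' f'"
proof -
  let ?A = "{g\<in>J. \<forall>\<rho>\<in>S. cmod (x \<rho> - \<rho> g) \<le> f g \<rho>}"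
  have "infinite ?A" using x by (simp add: limsup_boxes_def)
  hence "infinite ((\<lambda>g. g + h) ` ?A)" by (subst finite_image_iff) (auto simp: inj_on_def)
  moreover have "(\<lambda>g. g + h) ` ?A \<subseteq> {g\<in>J'. \<forall>\<rho>\<in>S. cmod (translate (emb h) x \<rho> - \<rho> g) \<le> f' g \<rho>}"
    using J f by (auto simp: translate_def emb_def emb_add)
  ultimately have "infinite {g\<in>J'. \<forall>\<rho>\<in>S. cmod (translate (emb h) x \<rho> - \<rho> g) \<le> f' g \<rho>}"
    using finite_subset by blast
  thus ?thesis by (simp add: limsup_boxes_def)
qed

lemma translate_emb_minus:
  assumes "x \<in> space N"
  shows "translate (emb (- h)) (translate (emb h) x) = x"
proof
  show "translate (emb (- h)) (translate (emb h) x) \<rho> = x \<rho>" for \<rho>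
    using PiE_arb[OF assms[unfolded space_N], of \<rho>]
    by (simp add: translate_def emb_def embedding_minus[OF embedding])
qed

lemma limsup_boxes_shift_iff:
  assumes x: "x \<in> space N"
    and J: "\<And>g. g \<in> J \<longleftrightarrow> g + h \<in> J'" and f: "\<And>g. g \<in> J \<Longrightarrow> f' (g + h) = f g"
  shows "translate (emb h) x \<in> limsup_boxes J' f' \<longleftrightarrow> x \<in> limsup_boxes J f"
proof
  assume "translate (emb h) x \<in> limsup_boxes J' f'"
  hence "translate (emb (- h)) (translate (emb h) x) \<in> limsup_boxes J f"
  proof (rule limsup_boxes_shift)
    fix g assume "g \<in> J'"
    thus "g + - h \<in> J" using J[of "g + - h"] by simp
    thus "f (g + - h) = f' g" using f[of "g + - h"] by simp
  qed
  thus "x \<in> limsup_boxes J f" using translate_emb_minus[OF x] by simp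
next
  assume "x \<in> limsup_boxes J f"
  thus "translate (emb h) x \<in> limsup_boxes J' f'"
    by (rule limsup_boxes_shift) (simp_all add: J[symmetric] f)
qed

text \<open>The large alternative is phrased as conullity because periodic sets live in a space of,
  in general, infinite measure.\<close>

definition zero_one :: "(('k \<Rightarrow> complex) \<Rightarrow> complex) set \<Rightarrow> bool" where
  "zero_one E \<longleftrightarrow> (AE x in N. x \<notin> E) \<or> (AE x in N. x \<in> E)"

lemma zero_one_iff_emeasure:
  assumes [measurable]: "E \<in> sets N"
  shows "zero_one E \<longleftrightarrow> emeasure N E = 0 \<or> emeasure N (space N - E) = 0"
proof -
  have "(AE x in N. x \<notin> E) \<longleftrightarrow> emeasure N E = 0"
    using sets.sets_into_space[OF assms] by (intro AE_iff_measurable) auto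
  moreover have "(AE x in N. x \<in> E) \<longleftrightarrow> emeasure N (space N - E) = 0"
    by (intro AE_iff_measurable) auto
  ultimately show ?thesis by (simp add: zero_one_def)
qed

text \<open>One conull member decides the union; otherwise all members are null. This allows the
  approximants to be sorted by place and by prime.\<close>

lemma zero_one_UN:
  assumes "finite I" "\<And>i. i \<in> I \<Longrightarrow> zero_one (E i)"
  shows "zero_one (\<Union>i\<in>I. E i)"
proof (cases "\<exists>i\<in>I. AE x in N. x \<in> E i")
  case True
  then obtain i where "i \<in> I" "AE x in N. x \<in> E i" by blast
  hence "AE x in N. x \<in> (\<Union>i\<in>I. E i)" by (auto elim: eventually_mono)
  thus ?thesis by (simp add: zero_one_def)
next
  case False
  hence "\<forall>i\<in>I. AE x in N. x \<notin> E i" using assms(2) by (auto simp: zero_one_def)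
  hence "AE x in N. \<forall>i\<in>I. x \<notin> E i" using assms(1) by (simp add: AE_finite_all)
  hence "AE x in N. x \<notin> (\<Union>i\<in>I. E i)" by eventually_elim auto
  thus ?thesis by (simp add: zero_one_def)
qed

lemma zero_one_cong_AE:
  assumes "AE x in N. x \<in> E \<longleftrightarrow> x \<in> E'" "zero_one E'"
  shows "zero_one E"
proof -
  have "AE x in N. x \<notin> E" if "AE x in N. x \<notin> E'" using assms(1) that by eventually_elim simp
  moreover have "AE x in N. x \<in> E" if "AE x in N. x \<in> E'" using assms(1) that by eventually_elim simp
  ultimately show ?thesis using assms(2) unfolding zero_one_def by argo
qed

text \<open>After multiplication by \<open>a ^ j\<close>, the translation by
  \<open>b / a ^ j\<close> is the integral translation by \<open>b\<close>, under which the set is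
  periodic. Invariance under multiplication thus passes to these translations, and they are dense
  because \<open>1 / a\<close> is not integral.\<close>

lemma zero_one_multiplication:
  assumes \<rho>0: "\<rho>0 \<in> S"
    and a: "algebraic_int a" "a \<noteq> 0" "\<not> algebraic_int (1 / a)"
    and small: "\<And>\<rho>. \<rho> \<in> S \<Longrightarrow> \<rho> \<noteq> \<rho>0 \<Longrightarrow> cmod (\<rho> a) \<le> 1"
    and J_mult: "\<And>g. g \<in> J \<Longrightarrow> a * g \<in> J" and f_mult: "\<And>g. g \<in> J \<Longrightarrow> f (a * g) = f g"
    and J_add: "\<And>g b. algebraic_int b \<Longrightarrow> g + b \<in> J \<longleftrightarrow> g \<in> J"
    and f_add: "\<And>g b. g \<in> J \<Longrightarrow> algebraic_int b \<Longrightarrow> f (g + b) = f g"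
    and f_nonneg: "\<And>g \<rho>. g \<in> J \<Longrightarrow> \<rho> \<in> S \<Longrightarrow> 0 \<le> f g \<rho>"
    and shrink: "\<And>x e K. x \<in> space N \<Longrightarrow> 0 < e \<Longrightarrow> 1 \<le> K \<Longrightarrow>
      finite {g\<in>J. (\<forall>\<rho>\<in>S. cmod (x \<rho> - \<rho> g) \<le> (if \<rho> = \<rho>0 then K else 1) * f g \<rho>) \<and> e \<le> f g \<rho>0}"
  shows "zero_one (limsup_boxes J f)"
proof -
  let ?E = "limsup_boxes J f"
  define T where "T = scale (\<lambda>\<rho>. \<rho> a)"
  have AE_T: "AE x in N. P (T x)" if "AE x in N. P x" for P
    unfolding T_def using that a(2) by (intro AE_scale) (auto simp: embedding_in_place_field emb_eq_0_iff)
  \<comment> \<open>The maximum with 1 covers the case in which \<open>a\<close> contracts at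
    \<open>\<rho>0\<close> too, since Cassels' lemma speaks of enlargements.\<close>
  define K where "K = max 1 (cmod (\<rho>0 a))"
  have K: "1 \<le> K" by (simp add: K_def)
  let ?f' = "\<lambda>g \<rho>. (if \<rho> = \<rho>0 then K else 1) * f g \<rho>"
  have T_in: "T x \<in> limsup_boxes J ?f'" if x: "x \<in> ?E" for x
  proof -
    let ?A = "{g\<in>J. \<forall>\<rho>\<in>S. cmod (x \<rho> - \<rho> g) \<le> f g \<rho>}"
    have "infinite ?A" using x by (simp add: limsup_boxes_def)
    hence "infinite ((*) a ` ?A)" using a(2) by (subst finite_image_iff) (auto simp: inj_on_def)
    moreover have "(*) a ` ?A \<subseteq> {g\<in>J. \<forall>\<rho>\<in>S. cmod (T x \<rho> - \<rho> g) \<le> ?f' g \<rho>}"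
    proof safe
      fix g \<rho> assume g: "g \<in> J" "\<forall>\<rho>\<in>S. cmod (x \<rho> - \<rho> g) \<le> f g \<rho>" and \<rho>: "\<rho> \<in> S"
      have "T x \<rho> - \<rho> (a * g) = \<rho> a * (x \<rho> - \<rho> g)"
        using \<rho> by (simp add: T_def scale_def emb_mult right_diff_distrib)
      hence "cmod (T x \<rho> - \<rho> (a * g)) = cmod (\<rho> a) * cmod (x \<rho> - \<rho> g)" by (simp add: norm_mult)
      also have "\<dots> \<le> (if \<rho> = \<rho>0 then K else 1) * f g \<rho>"
        using g \<rho> small[OF \<rho>] K by (intro mult_mono) (auto simp: K_def)
      finally show "cmod (T x \<rho> - \<rho> (a * g)) \<le> ?f' (a * g) \<rho>" using f_mult[OF g(1)] by simp
    qed (rule J_mult)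
    ultimately have "infinite {g\<in>J. \<forall>\<rho>\<in>S. cmod (T x \<rho> - \<rho> g) \<le> ?f' g \<rho>}" using finite_subset by blast
    thus ?thesis by (simp add: limsup_boxes_def T_def)
  qed
  have "AE x in N. infinite {g\<in>J. \<forall>\<rho>\<in>S. cmod (x \<rho> - \<rho> g) \<le> ?f' g \<rho>} \<longrightarrow>
      infinite {g\<in>J. \<forall>\<rho>\<in>S. cmod (x \<rho> - \<rho> g) \<le> f g \<rho>}"
    by (rule cassels_coordinate[OF \<rho>0 _ K]) (simp_all add: f_nonneg shrink K)
  hence "AE x in N. x \<in> limsup_boxes J ?f' \<longrightarrow> x \<in> ?E"
    by eventually_elim (simp only: limsup_boxes_def mem_Collect_eq, blast)
  hence "AE x in N. T x \<in> limsup_boxes J ?f' \<longrightarrow> T x \<in> ?E" by (rule AE_T)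
  hence "AE x in N. x \<in> ?E \<longrightarrow> T x \<in> ?E" by eventually_elim (use T_in in blast)
  moreover have per: "translate (emb b) x \<in> ?E \<longleftrightarrow> x \<in> ?E" if "algebraic_int b" "x \<in> space N" for b x
    using that J_add f_add by (intro limsup_boxes_shift_iff) auto
  ultimately have inv: "AE x in N. T x \<in> ?E \<longleftrightarrow> x \<in> ?E"
    unfolding T_def using a by (intro multiplication_invariant) auto
  have Tj: "(T ^^ j) x = scale (\<lambda>\<rho>. \<rho> (a ^ j)) x" if "x \<in> space N" for j x
  proof (induction j)
    case 0
    show ?case
    proof
      show "(T ^^ 0) x \<rho> = scale (\<lambda>\<rho>. \<rho> (a ^ 0)) x \<rho>" for \<rho>
        using PiE_arb[OF that[unfolded space_N], of \<rho>] by (simp add: scale_def emb_1)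
    qed
  next
    case (Suc j)
    thus ?case by (auto simp: T_def scale_def fun_eq_iff emb_mult mult.assoc)
  qed
  have invj: "AE x in N. (T ^^ j) x \<in> ?E \<longleftrightarrow> x \<in> ?E" for j
  proof (induction j)
    case (Suc j)
    have "AE x in N. (T ^^ j) (T x) \<in> ?E \<longleftrightarrow> T x \<in> ?E" using Suc by (rule AE_T)
    thus ?case using inv by eventually_elim (simp add: funpow_swap1)
  qed simp
  define H where "H = {b / a ^ j | b j. algebraic_int b}"
  have HI: "b / a ^ j \<in> H" if "algebraic_int b" for b j using that by (auto simp: H_def)
  have "emeasure N ?E = 0 \<or> emeasure N (space N - ?E) = 0"
  proof (rule dense_translation_zero_one[OF limsup_boxes_sets])
    fix x and e :: real assume x: "x \<in> W" and e: "0 < e"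
    obtain y where "y \<in> H" "\<And>\<rho>. \<rho> \<in> S \<Longrightarrow> cmod (x \<rho> - \<rho> y) < e"
    proof (rule dense_module[of H "\<lambda>j. 1 / a ^ j" x e])
      fix u v assume "u \<in> H" "v \<in> H"
      then obtain b i c j where uv: "u = b / a ^ i" "v = c / a ^ j" "algebraic_int b" "algebraic_int c"
        by (auto simp: H_def)
      have "u - v = (b * a ^ j - c * a ^ i) / a ^ (i + j)"
        using a(2) by (simp add: uv field_simps power_add)
      moreover have "algebraic_int (b * a ^ j - c * a ^ i)"
        using uv a by (intro algebraic_int_diff algebraic_int_add_mult algebraic_int_power)
      ultimately show "u - v \<in> H" using HI by metis
    next
      fix u y :: 'k assume "u \<in> H" "algebraic_int y"
      then obtain b i where uv: "u = b / a ^ i" "algebraic_int b" by (auto simp: H_def)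
      have "u * y = (b * y) / a ^ i" by (simp add: uv)
      thus "u * y \<in> H" using HI algebraic_int_add_mult(2)[OF uv(2) \<open>algebraic_int y\<close>] by metis
    next
      show "1 \<in> H" using HI[of 1 0] by simp
      show "1 / a ^ j \<in> H" for j by (rule HI) simp
    next
      fix i j :: nat assume "i < j"
      show "\<not> algebraic_int (1 / a ^ i - 1 / a ^ j)"
      proof
        assume *: "algebraic_int (1 / a ^ i - 1 / a ^ j)"
        \<comment> \<open>Multiplying the supposed integer by \<open>a ^ (i + k)\<close>, one power
          short of \<open>a ^ j\<close>, isolates \<open>1 / a\<close>.\<close>
        obtain k where k: "j = Suc (i + k)" using \<open>i < j\<close> less_iff_Suc_add by auto
        have "1 / a = a ^ k - a ^ (i + k) * (1 / a ^ i - 1 / a ^ j)"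
          using a(2) by (simp add: k field_simps power_add)
        also have "algebraic_int \<dots>"
          by (rule algebraic_int_diff[OF algebraic_int_power[OF a(1)]
                algebraic_int_add_mult(2)[OF algebraic_int_power[OF a(1)] *]])
        finally show False using a(3) by simp
      qed
    next
      show "x \<rho> \<in> place_field \<rho>" if "\<rho> \<in> S" for \<rho> using x that by (auto simp: W_def)
    qed (use e in auto)
    thus "\<exists>h\<in>H. \<forall>\<rho>\<in>S. cmod (x \<rho> - \<rho> h) < e" by blast
  next
    fix h assume "h \<in> H"
    then obtain b j where h: "h = b / a ^ j" "algebraic_int b" by (auto simp: H_def)
    have "AE x in N. (T ^^ j) (translate (emb h) x) \<in> ?E \<longleftrightarrow> translate (emb h) x \<in> ?E"
      using AE_translate[OF emb_in_W invj] .
    thus "AE x in N. translate (emb h) x \<in> ?E \<longleftrightarrow> x \<in> ?E"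
      using invj[of j] AE_space
    proof eventually_elim
      case (elim x)
      have "(T ^^ j) (translate (emb h) x) = translate (emb b) ((T ^^ j) x)"
        unfolding Tj[OF translate_in_space] Tj[OF elim(3)]
      proof
        show "scale (\<lambda>\<rho>. \<rho> (a ^ j)) (translate (emb h) x) \<rho> = translate (emb b) (scale (\<lambda>\<rho>. \<rho> (a ^ j)) x) \<rho>" for \<rho>
          using a(2) by (simp add: translate_def scale_def emb_def distrib_left h(1) emb_divide emb_power emb_eq_0_iff)
      qed
      moreover have "(T ^^ j) x \<in> space N" using Tj[OF elim(3)] by simp
      ultimately show ?case using elim(1,2) per[OF h(2)] by simp
    qed
  qed
  thus ?thesis by (simp add: zero_one_iff_emeasure)
qed

end

text \<open>Finiteness of the integers of bounded size enters as an assumption; the main theorem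
  discharges it from the fundamental domain.\<close>

locale discrete_places = number_field_places S
  for S :: "('k::field_char_0 \<Rightarrow> complex) set" +
  assumes discrete: "finite {a. algebraic_int a \<and> (\<forall>\<rho>\<in>S. cmod (\<rho> a) \<le> B)}"
begin

lemma finite_bounded_fractions:
  assumes "m \<noteq> 0"
  shows "finite {g. algebraic_int (m * g) \<and> (\<forall>\<rho>\<in>S. cmod (\<rho> g) \<le> b \<rho>)}"
proof -
  define B where "B = (\<Sum>\<rho>\<in>S. cmod (\<rho> m) * \<bar>b \<rho>\<bar>)"
  have "(*) m ` {g. algebraic_int (m * g) \<and> (\<forall>\<rho>\<in>S. cmod (\<rho> g) \<le> b \<rho>)}
    \<subseteq> {a. algebraic_int a \<and> (\<forall>\<rho>\<in>S. cmod (\<rho> a) \<le> B)}"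
  proof safe
    fix g \<rho> assume g: "\<forall>\<rho>\<in>S. cmod (\<rho> g) \<le> b \<rho>" and \<rho>: "\<rho> \<in> S"
    have "cmod (\<rho> (m * g)) = cmod (\<rho> m) * cmod (\<rho> g)" using \<rho> by (simp add: emb_mult norm_mult)
    also have "\<dots> \<le> cmod (\<rho> m) * \<bar>b \<rho>\<bar>" using g \<rho> by (intro mult_left_mono) (auto intro: order_trans)
    also have "\<dots> \<le> B" unfolding B_def
      using member_le_sum[OF \<rho>, of "\<lambda>\<rho>. cmod (\<rho> m) * \<bar>b \<rho>\<bar>"] finite_places by simp
    finally show "cmod (\<rho> (m * g)) \<le> B" .
  qed
  hence "finite ((*) m ` {g. algebraic_int (m * g) \<and> (\<forall>\<rho>\<in>S. cmod (\<rho> g) \<le> b \<rho>)})"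
    using discrete finite_subset by blast
  thus ?thesis using assms by (subst (asm) finite_image_iff) (auto simp: inj_on_def)
qed

text \<open>Division with remainder: cocompactness provides a quotient whose remainder is bounded at
  every place, and discreteness leaves finitely many such remainders.\<close>

lemma finite_residues:
  fixes a :: 'k
  assumes "algebraic_int a" "a \<noteq> 0"
  obtains R where "finite R" "\<And>x. algebraic_int x \<Longrightarrow> \<exists>r\<in>R. \<exists>y. algebraic_int y \<and> x = r + a * y"
proof -
  obtain C where C: "C > 0"
    "\<And>x. (\<And>\<rho>. \<rho> \<in> S \<Longrightarrow> x \<rho> \<in> place_field \<rho>) \<Longrightarrow> \<exists>a. algebraic_int a \<and> (\<forall>\<rho>\<in>S. cmod (x \<rho> - \<rho> a) \<le> C)"
    using integers_cocompact by blast
  define R where "R = {r. algebraic_int (1 * r) \<and> (\<forall>\<rho>\<in>S. cmod (\<rho> r) \<le> cmod (\<rho> a) * C)}"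
  show ?thesis
  proof (rule that)
    show "finite R" unfolding R_def by (rule finite_bounded_fractions) simp
    fix x :: 'k assume x: "algebraic_int x"
    obtain y where y: "algebraic_int y" "\<forall>\<rho>\<in>S. cmod (\<rho> (x / a) - \<rho> y) \<le> C"
      using C(2)[of "\<lambda>\<rho>. \<rho> (x / a)"] embedding_in_place_field by blast
    have "cmod (\<rho> (x - a * y)) \<le> cmod (\<rho> a) * C" if \<rho>: "\<rho> \<in> S" for \<rho>
    proof -
      have "x - a * y = a * (x / a - y)" using assms(2) by (simp add: field_simps)
      hence "cmod (\<rho> (x - a * y)) = cmod (\<rho> a) * cmod (\<rho> (x / a) - \<rho> y)"
        using \<rho> by (simp only: emb_mult emb_diff norm_mult)
      thus ?thesis using y(2) \<rho> by (auto intro: mult_left_mono)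
    qed
    moreover have "algebraic_int (x - a * y)" using x y(1) assms(1) by (intro algebraic_int_diff algebraic_int_add_mult)
    ultimately have "x - a * y \<in> R" by (simp add: R_def)
    thus "\<exists>r\<in>R. \<exists>y. algebraic_int y \<and> x = r + a * y" using y(1) by (intro bexI[of _ "x - a * y"] exI[of _ y]) auto
  qed
qed

text \<open>An ideal containing \<open>a\<close> is a union of residue classes modulo
  \<open>a\<close>, so its trace on the finite system \<open>R\<close> determines it.\<close>

lemma finite_ideals_containing:
  fixes a :: 'k
  assumes "algebraic_int a" "a \<noteq> 0"
  shows "finite {I. integer_ideal I \<and> a \<in> I}"
proof -
  obtain R where R: "finite R" "\<And>x. algebraic_int x \<Longrightarrow> \<exists>r\<in>R. \<exists>y. algebraic_int y \<and> x = r + a * y"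
    using finite_residues[OF assms] by metis
  have sub: "I \<subseteq> J" if I: "integer_ideal I" "a \<in> I" and J: "integer_ideal J" "a \<in> J" and "I \<inter> R \<subseteq> J \<inter> R" for I J
  proof
    fix x assume x: "x \<in> I"
    obtain r y where ry: "r \<in> R" "algebraic_int y" "x = r + a * y"
      using R(2)[OF integer_idealD(1)[OF I(1) x]] by blast
    have ya: "y * a \<in> I" "y * a \<in> J" using integer_idealD(4) I J ry(2) by blast+
    have "r = x - y * a" using ry(3) by (simp add: mult.commute)
    hence "r \<in> I" using integer_ideal_diff[OF I(1) x ya(1)] by simp
    hence "r \<in> J" using that(5) ry(1) by blast
    thus "x \<in> J" using integer_idealD(3)[OF J(1) _ ya(2)] ry(3) by (simp add: mult.commute)
  qed
  have "inj_on (\<lambda>I. I \<inter> R) {I. integer_ideal I \<and> a \<in> I}"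
  proof (rule inj_onI)
    fix I J assume "I \<in> {I. integer_ideal I \<and> a \<in> I}" "J \<in> {I. integer_ideal I \<and> a \<in> I}" "I \<inter> R = J \<inter> R"
    thus "I = J" using sub[of I J] sub[of J I] by auto
  qed
  moreover have "finite ((\<lambda>I. I \<inter> R) ` {I. integer_ideal I \<and> a \<in> I})"
    by (rule finite_subset[of _ "Pow R"]) (use R(1) in auto)
  ultimately show ?thesis by (rule finite_imageD[rotated])
qed

text \<open>The numbers 0 to \<open>ideal_norm I\<close> are one more than there are cosets; two in
  the same coset differ by an element of \<open>I\<close>.\<close>

lemma ideal_norm_multiple:
  fixes I :: "'k set"
  assumes I: "I \<in> integral_ideals"
  obtains j where "0 < j" "j \<le> ideal_norm I" "of_nat j \<in> I"
proof -
  have ideal: "integer_ideal I" "I \<noteq> {0}" using I by (auto simp: integral_ideals_iff)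
  then obtain a where a: "a \<in> I" "a \<noteq> 0" using integer_idealD(2)[OF ideal(1)] by blast
  obtain R where R: "finite R" "\<And>x. algebraic_int x \<Longrightarrow> \<exists>r\<in>R. \<exists>y. algebraic_int y \<and> x = r + a * y"
    using finite_residues[OF integer_idealD(1)[OF ideal(1) a(1)] a(2)] by metis
  define coset where "coset x = (\<lambda>h. h + x) ` I" for x :: 'k
  have carrier: "carrier (ring_of_integers Quot I) = coset ` {x. algebraic_int x}"
    by (auto simp: FactRing_def A_RCOSETS_def' a_r_coset_def' coset_def)
  have coset_eq: "coset x = coset y" if "x - y \<in> I" for x y
  proof -
    have "h + x \<in> coset y" if "h \<in> I" for h
    proof -
      have "h + x = (h + (x - y)) + y" by simp
      moreover have "h + (x - y) \<in> I" using that \<open>x - y \<in> I\<close> by (rule integer_idealD(3)[OF ideal(1)])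
      ultimately show ?thesis unfolding coset_def by blast
    qed
    moreover have "h + y \<in> coset x" if "h \<in> I" for h
    proof -
      have "h + y = (h - (x - y)) + x" by simp
      moreover have "h - (x - y) \<in> I" using that \<open>x - y \<in> I\<close> by (rule integer_ideal_diff[OF ideal(1)])
      ultimately show ?thesis unfolding coset_def by blast
    qed
    ultimately show ?thesis unfolding coset_def by blast
  qed
  have "coset ` {x. algebraic_int x} \<subseteq> coset ` R"
  proof safe
    fix x :: 'k assume "algebraic_int x"
    then obtain r y where ry: "r \<in> R" "algebraic_int y" "x = r + a * y" using R(2) by blast
    have "x - r \<in> I" using integer_idealD(4)[OF ideal(1) ry(2) a(1)] ry(3) by (simp add: mult.commute)
    thus "coset x \<in> coset ` R" using coset_eq ry(1) by blast
  qed
  \<comment> \<open>An infinite quotient would have \<open>card\<close> equal to 0, so finiteness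
    must precede the count.\<close>
  hence fin: "finite (carrier (ring_of_integers Quot I))"
    unfolding carrier using R(1) by (meson finite_imageI finite_subset)
  define k where "k = ideal_norm I"
  have "(\<lambda>j. coset (of_nat j)) ` {..k} \<subseteq> carrier (ring_of_integers Quot I)"
    unfolding carrier by auto
  hence "card ((\<lambda>j. coset (of_nat j)) ` {..k}) \<le> k"
    unfolding k_def ideal_norm_def using fin by (rule card_mono[rotated])
  hence "\<not> inj_on (\<lambda>j. coset (of_nat j)) {..k}"
    using card_image[of "\<lambda>j. coset (of_nat j)" "{..k}"] by auto
  then obtain i j where ij: "i < j" "j \<le> k" "coset (of_nat i) = coset (of_nat j)"
    using linorder_inj_onI'[of "{..k}" "\<lambda>j. coset (of_nat j)"] by auto
  have "of_nat j \<in> coset (of_nat j)"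
    unfolding coset_def using integer_idealD(2)[OF ideal(1)] by (intro image_eqI[of _ _ 0]) auto
  hence "of_nat j \<in> coset (of_nat i)" by (simp only: ij(3))
  then obtain h where h: "h \<in> I" "of_nat j = h + of_nat i" by (auto simp: coset_def)
  have "of_nat (j - i) = h" using h(2) ij(1) by (simp add: of_nat_diff)
  thus ?thesis using that[of "j - i"] ij h(1) by (simp add: k_def)
qed

text \<open>An ideal of norm below \<open>m\<close> contains a positive integer up to
  \<open>m\<close>, and each such integer lies in finitely many ideals. This turns the limit at
  large norm into a statement about all but finitely many ideals.\<close>

lemma finite_small_norm: "finite {I :: 'k set. I \<in> integral_ideals \<and> ideal_norm I < m}"
proof -
  have "{I \<in> integral_ideals. ideal_norm I < m} \<subseteq> (\<Union>j\<in>{1..m}. {I :: 'k set. integer_ideal I \<and> of_nat j \<in> I})"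
  proof
    fix I :: "'k set" assume I: "I \<in> {I \<in> integral_ideals. ideal_norm I < m}"
    then obtain j where "0 < j" "j \<le> ideal_norm I" "of_nat j \<in> I" using ideal_norm_multiple by blast
    thus "I \<in> (\<Union>j\<in>{1..m}. {I. integer_ideal I \<and> of_nat j \<in> I})"
      using I by (auto simp: integral_ideals_iff intro!: bexI[of _ j])
  qed
  moreover have "finite (\<Union>j\<in>{1..m}. {I :: 'k set. integer_ideal I \<and> of_nat j \<in> I})"
    by (intro finite_UN_I finite_ideals_containing) auto
  ultimately show ?thesis by (rule finite_subset)
qed

lemma finite_maximal_ideals_over:
  fixes a :: 'k
  assumes "algebraic_int a" "a \<noteq> 0"
  shows "finite (maximal_ideals_over a)"
  by (rule finite_subset[OF _ finite_ideals_containing[OF assms]]) (auto simp: maximal_ideals_over_def)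

text \<open>If \<open>den g\<close> and \<open>a\<close> do not generate the unit ideal, the ideal
  they generate lies in a maximal one, which exists because only finitely many ideals contain
  \<open>a\<close>.\<close>

lemma den_coprime_or_maximal:
  fixes a :: 'k
  assumes a: "algebraic_int a" "a \<noteq> 0" and "\<not> den_coprime a g"
  obtains q where "q \<in> maximal_ideals_over a" "den g \<subseteq> q"
proof -
  define I where "I = {x + b * a | x b. x \<in> den g \<and> algebraic_int b}"
  have I: "integer_ideal I"
    unfolding I_def by (rule integer_ideal_add_principal[OF integer_ideal_den a(1)])
  have "den g \<subseteq> I" unfolding I_def by force
  have "a \<in> I" unfolding I_def using integer_idealD(2)[OF integer_ideal_den, of g] by force
  have "1 \<notin> I"
  proof
    assume "1 \<in> I"
    then obtain x b where xb: "1 = x + b * a" "x \<in> den g" "algebraic_int b" unfolding I_def by blast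
    have "1 - a * b = x" using xb(1) by (simp add: mult.commute algebra_simps)
    hence "den_coprime a g" using xb(2,3) by (auto simp: den_coprime_def den_def)
    thus False using assms(3) by simp
  qed
  define F where "F = {J. integer_ideal J \<and> I \<subseteq> J \<and> 1 \<notin> J}"
  have "finite F"
    by (rule finite_subset[OF _ finite_ideals_containing[OF a]]) (use \<open>a \<in> I\<close> in \<open>auto simp: F_def\<close>)
  moreover have "I \<in> F" using I \<open>1 \<notin> I\<close> by (simp add: F_def)
  ultimately obtain q where q: "q \<in> F" "I \<subseteq> q" "\<forall>J\<in>F. q \<subseteq> J \<longrightarrow> q = J"
    using finite_has_maximal2[of F I] by auto
  have "q \<in> maximal_ideals_over a"
    unfolding maximal_ideals_over_def
  proof (intro CollectI conjI allI impI)
    show "integer_ideal q" "1 \<notin> q" "a \<in> q" using q(1,2) \<open>a \<in> I\<close> by (auto simp: F_def)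
    fix J assume "integer_ideal J" "q \<subseteq> J" "1 \<notin> J"
    moreover from this have "J \<in> F" using q(2) by (simp add: F_def subset_trans)
    ultimately show "J = q" using q(3) by metis
  qed
  thus ?thesis using that \<open>den g \<subseteq> I\<close> q(2) by blast
qed

end

section \<open>The zero-one law in coordinates\<close>

context discrete_places
begin

text \<open>Translations \<open>y * e M / a ^ M\<close> preserve denominators in \<open>J j\<close>
  for \<open>j \<ge> M\<close>. Since the limsup sets decrease with the level, their intersection
  may start at any \<open>M\<close>, so it is invariant under the translations of all levels
  simultaneously. As \<open>e M \<notin> q\<close>, their denominators are unbounded at
  \<open>q\<close>, which gives density.\<close>

lemma zero_one_local_tail:
  assumes a: "algebraic_int a" "a \<noteq> 0" and q: "q \<in> maximal_ideals_over a"
  shows "zero_one (\<Inter>M. limsup_boxes {g. P (den g) \<and> den (a ^ M * g) \<subseteq> q} (\<lambda>g. F (den g)))"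
proof -
  define J where "J M = {g. P (den g) \<and> den (a ^ M * g) \<subseteq> q}" for M
  define E where "E = (\<Inter>M. limsup_boxes (J M) (\<lambda>g. F (den g)))"
  have J_mono: "J (M + i) \<subseteq> J M" for M i
    unfolding J_def using subset_trans[OF den_power_mono[OF a(1)]] by blast
  have E_sets: "E \<in> sets N" unfolding E_def by (intro sets.countable_INT) auto
  have qi: "integer_ideal q" "1 \<notin> q" "a \<in> q" using q by (auto simp: maximal_ideals_over_def)
  have fin: "finite {I. integer_ideal I \<and> a ^ M \<in> I}" for M
    using a by (intro finite_ideals_containing algebraic_int_power) auto
  have "\<forall>M. \<exists>e. algebraic_int e \<and> e \<notin> q \<and> (\<forall>I. integer_ideal I \<longrightarrow> a ^ M \<in> I \<longrightarrow> \<not> I \<subseteq> q \<longrightarrow> e \<in> I)"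
    using ex_local_element[OF q fin] by metis
  then obtain e where e: "\<And>M. algebraic_int (e M)" "\<And>M. e M \<notin> q"
    "\<And>M I. integer_ideal I \<Longrightarrow> a ^ M \<in> I \<Longrightarrow> \<not> I \<subseteq> q \<Longrightarrow> e M \<in> I"
    by metis
  \<comment> \<open>Invariance holds here at every point, not merely almost everywhere, so these
    translations are closed under differences by direct composition.\<close>
  define Inv where "Inv = {h. \<forall>x\<in>space N. translate (emb h) x \<in> E \<longleftrightarrow> x \<in> E}"
  have local_inv: "y * e M / a ^ M \<in> Inv" if y: "algebraic_int y" for y M
  proof -
    have sub: "g + y * e M / a ^ M \<in> J j \<and> den (g + y * e M / a ^ M) = den g"
      if "g \<in> J j" "M \<le> j" "algebraic_int y" for g y j
      using den_local_translate[OF number_field q a e(3) e(1) that(3) that(2), where g = g] that(1)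
      by (auto simp: J_def)
    define h where "h = y * e M / a ^ M"
    have iff: "g \<in> J j \<longleftrightarrow> g + h \<in> J j" if "M \<le> j" for g j
      using sub[where g = g and j = j and y = y] sub[where g = "g + h" and j = j and y = "- y"] that y
      by (auto simp: h_def)
    have "translate (emb h) x \<in> limsup_boxes (J j) (\<lambda>g. F (den g)) \<longleftrightarrow> x \<in> limsup_boxes (J j) (\<lambda>g. F (den g))"
      if "x \<in> space N" "M \<le> j" for x j
      using that iff[OF that(2)] sub[where y = y and j = j]  y
      by (intro limsup_boxes_shift_iff) (auto simp: h_def)
    moreover have "E = (\<Inter>j\<in>{M..}. limsup_boxes (J j) (\<lambda>g. F (den g)))"
    proof
      show "(\<Inter>j\<in>{M..}. limsup_boxes (J j) (\<lambda>g. F (den g))) \<subseteq> E"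
        unfolding E_def
      proof (intro subsetI INT_I)
        fix x i assume "x \<in> (\<Inter>j\<in>{M..}. limsup_boxes (J j) (\<lambda>g. F (den g)))"
        hence "x \<in> limsup_boxes (J (i + M)) (\<lambda>g. F (den g))" by simp
        thus "x \<in> limsup_boxes (J i) (\<lambda>g. F (den g))" using limsup_boxes_mono[OF J_mono] by blast
      qed
    qed (auto simp: E_def)
    ultimately show ?thesis by (auto simp: Inv_def h_def)
  qed
  have int_inv: "b \<in> Inv" if b: "algebraic_int b" for b
  proof -
    have "den (a ^ j * (g + b)) = den (a ^ j * g)" for j g
      using den_add_integer[of "a ^ j * b" "a ^ j * g"] a(1) b
      by (simp add: distrib_left algebraic_int_add_mult(2) algebraic_int_power)
    hence "translate (emb b) x \<in> limsup_boxes (J j) (\<lambda>g. F (den g)) \<longleftrightarrow> x \<in> limsup_boxes (J j) (\<lambda>g. F (den g))"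
      if "x \<in> space N" for x j
      using that den_add_integer[OF b] by (intro limsup_boxes_shift_iff) (auto simp: J_def)
    thus ?thesis by (auto simp: Inv_def E_def)
  qed
  have Inv_diff: "h - h' \<in> Inv" if "h \<in> Inv" "h' \<in> Inv" for h h'
  proof -
    have "translate (emb (h - h')) x \<in> E \<longleftrightarrow> x \<in> E" if x: "x \<in> space N" for x
    proof -
      have "translate (emb h') (translate (emb (h - h')) x) = translate (emb h) x"
        by (auto simp: translate_def emb_def fun_eq_iff emb_diff)
      moreover have "translate (emb h') z \<in> E \<longleftrightarrow> z \<in> E" if "z \<in> space N" for z
        using \<open>h' \<in> Inv\<close> that by (simp add: Inv_def)
      from this[OF translate_in_space] have "translate (emb h') (translate (emb (h - h')) x) \<in> E
          \<longleftrightarrow> translate (emb (h - h')) x \<in> E" .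
      moreover have "translate (emb h) x \<in> E \<longleftrightarrow> x \<in> E" using \<open>h \<in> Inv\<close> x by (simp add: Inv_def)
      ultimately show ?thesis by (simp only:)
    qed
    thus ?thesis by (simp add: Inv_def)
  qed
  \<comment> \<open>The elements all of whose integral multiples are admissible: a module inside
    \<open>Inv\<close>, as the density criterion demands.\<close>
  define H where "H = {h. \<forall>y. algebraic_int y \<longrightarrow> y * h \<in> Inv}"
  have "emeasure N E = 0 \<or> emeasure N (space N - E) = 0"
  proof (rule dense_translation_zero_one[OF E_sets])
    fix x and \<epsilon> :: real assume x: "x \<in> W" and \<epsilon>: "0 < \<epsilon>"
    obtain y where "y \<in> H" "\<And>\<rho>. \<rho> \<in> S \<Longrightarrow> cmod (x \<rho> - \<rho> y) < \<epsilon>"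
    proof (rule dense_module[of H "\<lambda>j. e (Suc j) / a ^ Suc j" x \<epsilon>])
      show "u - v \<in> H" if "u \<in> H" "v \<in> H" for u v
        using that Inv_diff by (auto simp: H_def right_diff_distrib)
      show "u * v \<in> H" if "u \<in> H" "algebraic_int v" for u v
        unfolding H_def
      proof (intro CollectI allI impI)
        fix y :: 'k assume y: "algebraic_int y"
        have "(y * v) * u \<in> Inv" using that algebraic_int_add_mult(2)[OF y that(2)] by (simp add: H_def)
        thus "y * (u * v) \<in> Inv" by (simp add: mult_ac)
      qed
      show "1 \<in> H" using int_inv by (simp add: H_def)
      show "e (Suc j) / a ^ Suc j \<in> H" for j
        using local_inv[of _ "Suc j"] unfolding H_def by simp
      fix i j :: nat assume ij: "i < j"
      show "\<not> algebraic_int (e (Suc i) / a ^ Suc i - e (Suc j) / a ^ Suc j)"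
      proof
        assume *: "algebraic_int (e (Suc i) / a ^ Suc i - e (Suc j) / a ^ Suc j)"
        \<comment> \<open>Multiplication by \<open>a ^ j\<close> isolates
          \<open>e (Suc j) / a\<close>. Were this integral, its product with
          \<open>a \<in> q\<close> would place \<open>e (Suc j)\<close> in \<open>q\<close>.\<close>
        obtain k where k: "j = Suc (i + k)" using ij less_iff_Suc_add by auto
        have "e (Suc j) / a = a ^ k * e (Suc i) - a ^ j * (e (Suc i) / a ^ Suc i - e (Suc j) / a ^ Suc j)"
          using a(2) by (simp add: k field_simps power_add)
        also have "algebraic_int \<dots>"
          by (rule algebraic_int_diff[OF algebraic_int_add_mult(2)[OF algebraic_int_power[OF a(1)] e(1)]
                algebraic_int_add_mult(2)[OF algebraic_int_power[OF a(1)] *]])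
        finally have "(e (Suc j) / a) * a \<in> q" using integer_idealD(4)[OF qi(1) _ qi(3)] by blast
        thus False using e(2) a(2) by simp
      qed
    next
      show "x \<rho> \<in> place_field \<rho>" if "\<rho> \<in> S" for \<rho> using x that by (auto simp: W_def)
    qed (use \<epsilon> in auto)
    thus "\<exists>h\<in>H. \<forall>\<rho>\<in>S. cmod (x \<rho> - \<rho> h) < \<epsilon>" by blast
  next
    fix h assume "h \<in> H"
    hence "1 * h \<in> Inv" unfolding H_def by (metis algebraic_int_1 mem_Collect_eq)
    thus "AE x in N. translate (emb h) x \<in> E \<longleftrightarrow> x \<in> E" by (intro AE_I2) (simp add: Inv_def)
  qed
  thus ?thesis using E_sets by (simp add: zero_one_iff_emeasure E_def J_def)
qed

text \<open>Only finitely many denominators have radius at least \<open>e\<close> at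
  \<open>\<rho>0\<close>. For each of them the admissible \<open>g\<close> are bounded and share a
  nonzero multiplier, so discreteness applies. This provides the shrinking condition of Cassels'
  lemma.\<close>

lemma finite_large_radius:
  assumes fin: "\<And>e. 0 < e \<Longrightarrow> finite {I\<in>integral_ideals. P I \<and> e \<le> F I \<rho>0}" and e: "0 < e"
  shows "finite {g. P (den g) \<and> (\<forall>\<rho>\<in>S. cmod (x \<rho> - \<rho> g) \<le> K \<rho> * F (den g) \<rho>) \<and> e \<le> F (den g) \<rho>0}"
proof -
  let ?\<I> = "{I\<in>integral_ideals. P I \<and> e \<le> F I \<rho>0}"
  have "finite {g. den g = I \<and> (\<forall>\<rho>\<in>S. cmod (x \<rho> - \<rho> g) \<le> K \<rho> * F I \<rho>)}" if I: "I \<in> integral_ideals" for I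
  proof -
    have "integer_ideal I" "I \<noteq> {0}" using I by (auto simp: integral_ideals_iff)
    then obtain m where m: "m \<in> I" "m \<noteq> 0" using integer_idealD(2) by blast
    have "{g. den g = I \<and> (\<forall>\<rho>\<in>S. cmod (x \<rho> - \<rho> g) \<le> K \<rho> * F I \<rho>)}
      \<subseteq> {g. algebraic_int (m * g) \<and> (\<forall>\<rho>\<in>S. cmod (\<rho> g) \<le> cmod (x \<rho>) + K \<rho> * F I \<rho>)}"
    proof safe
      fix g assume "I = den g"
      thus "algebraic_int (m * g)" using m(1) by (simp add: den_def)
    next
      fix g \<rho> assume *: "\<forall>\<rho>\<in>S. cmod (x \<rho> - \<rho> g) \<le> K \<rho> * F (den g) \<rho>" "\<rho> \<in> S"
      have "cmod (\<rho> g) \<le> cmod (x \<rho>) + cmod (x \<rho> - \<rho> g)"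
        using norm_triangle_ineq4[of "x \<rho>" "x \<rho> - \<rho> g"] by simp
      thus "cmod (\<rho> g) \<le> cmod (x \<rho>) + K \<rho> * F (den g) \<rho>" using * by fastforce
    qed
    thus ?thesis by (rule finite_subset) (rule finite_bounded_fractions[OF m(2)])
  qed
  hence "finite (\<Union>I\<in>?\<I>. {g. den g = I \<and> (\<forall>\<rho>\<in>S. cmod (x \<rho> - \<rho> g) \<le> K \<rho> * F I \<rho>)})"
    using fin[OF e] by (intro finite_UN_I) auto
  moreover have "{g. P (den g) \<and> (\<forall>\<rho>\<in>S. cmod (x \<rho> - \<rho> g) \<le> K \<rho> * F (den g) \<rho>) \<and> e \<le> F (den g) \<rho>0}
     \<subseteq> (\<Union>I\<in>?\<I>. {g. den g = I \<and> (\<forall>\<rho>\<in>S. cmod (x \<rho> - \<rho> g) \<le> K \<rho> * F I \<rho>)})"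
    using den_in_integral_ideals[OF number_field] by auto
  ultimately show ?thesis by (rule finite_subset[rotated])
qed

text \<open>
  Gallagher's argument.  If \<open>den (a\<^sup>M g)\<close> is prime to \<open>a\<close>, then \<open>g\<close> is, up to one of finitely many
  shifts \<open>d\<close>, an element with denominator prime to \<open>a\<close>, and multiplication by \<open>a\<close> preserves the
  denominator of \<open>g + d\<close>.  The remaining \<open>g\<close> have a denominator highly divisible by a prime over
  \<open>a\<close> and admit many translations.
\<close>

lemma zero_one_place:
  assumes \<rho>0: "\<rho>0 \<in> S"
    and F: "\<And>I \<rho>. I \<in> integral_ideals \<Longrightarrow> \<rho> \<in> S \<Longrightarrow> 0 \<le> F I \<rho>"
    and fin: "\<And>e. 0 < e \<Longrightarrow> finite {I\<in>integral_ideals. P I \<and> e \<le> F I \<rho>0}"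
  shows "zero_one (limsup_boxes {g. P (den g)} (\<lambda>g. F (den g)))"
proof -
  obtain t where t: "algebraic_int t" "t \<noteq> 0" "\<And>\<rho>. \<rho> \<in> S - {\<rho>0} \<Longrightarrow> cmod (\<rho> t) < 1 / 2"
    by (rule ex_small_integer[OF \<rho>0, of "1 / 2"]) auto
  \<comment> \<open>The bound 1/2 on \<open>t\<close> absorbs the factor 2, and that factor makes
    \<open>a\<close> a nonunit: an integral \<open>1 / a\<close> would give the integer
    \<open>t * (1 / a) = 1 / 2\<close>.\<close>
  define a where "a = of_nat 2 * t"
  have a: "algebraic_int a" "a \<noteq> 0"
    using t(2) algebraic_int_add_mult(2)[OF algebraic_int_of_nat t(1)] by (simp_all add: a_def del: of_nat_numeral)
  have small: "cmod (\<rho> a) \<le> 1" if "\<rho> \<in> S" "\<rho> \<noteq> \<rho>0" for \<rho>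
  proof -
    have "\<rho> a = 2 * \<rho> t" unfolding a_def emb_mult[OF that(1)] emb_of_nat[OF that(1)] by simp
    thus ?thesis using t(3)[of \<rho>] that by (simp add: norm_mult)
  qed
  have nonunit: "\<not> algebraic_int (1 / a)"
  proof
    assume "algebraic_int (1 / a)"
    hence "algebraic_int (t * (1 / a))" by (rule algebraic_int_add_mult(2)[OF t(1)])
    also have "t * (1 / a) = inverse 2" using t(2) by (simp add: a_def field_simps)
    finally have "algebraic_int (inverse 2 :: 'k)" .
    hence "(inverse 2 :: 'k) \<in> \<int>" by (rule rational_algebraic_int_is_int) auto
    then obtain n where "(inverse 2 :: 'k) = of_int n" by (auto elim: Ints_cases)
    hence "(of_int (2 * n) :: 'k) = of_int 1" by (simp flip: \<open>inverse 2 = of_int n\<close>)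
    hence "2 * n = 1" by (simp only: of_int_eq_iff)
    thus False by presburger
  qed
  define G where "G = (\<lambda>g. F (den g))"
  define E where "E = limsup_boxes {g. P (den g)} G"
  define J where "J q M = {g. P (den g) \<and> den (a ^ M * g) \<subseteq> q}" for q M
  have coprime_add: "den_coprime a (g + b) \<longleftrightarrow> den_coprime a g" if b: "algebraic_int b" for g b
    using den_coprime_add[OF _ b a(1), of g] den_coprime_add[of a "g + b" "- b"] b a(1) by auto
  define C where "C d = {g. den_coprime a (g - d) \<and> P (den g)}" for d
  have zC: "zero_one (limsup_boxes (C d) G)" if d: "algebraic_int (a ^ M * d)" for d M
  proof -
    \<comment> \<open>The class recentred at \<open>d\<close>: multiplication by \<open>a\<close>
      acts on \<open>g\<close> while the denominator and radii are those of
      \<open>g + d\<close>.\<close>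
    define C0 where "C0 = {g. den_coprime a g \<and> P (den (g + d))}"
    define G0 where "G0 = (\<lambda>g. G (g + d))"
    have "zero_one (limsup_boxes C0 G0)"
    proof (rule zero_one_multiplication[where a = a, OF \<rho>0 a nonunit])
      show "cmod (\<rho> a) \<le> 1" if "\<rho> \<in> S" "\<rho> \<noteq> \<rho>0" for \<rho> using that by (rule small)
    next
      fix g assume g: "g \<in> C0"
      have den: "den (a * g + d) = den (g + d)" using g a(1) d by (intro den_coprime_shift) (auto simp: C0_def)
      show "a * g \<in> C0" using g a(1) den by (auto simp: C0_def intro: den_coprime_mult)
      show "G0 (a * g) = G0 g" by (simp add: G0_def G_def den)
      show "0 \<le> G0 g \<rho>" if "\<rho> \<in> S" for \<rho>
        using that F den_in_integral_ideals[OF number_field] by (simp add: G0_def G_def)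
      show "G0 (g + b) = G0 g" if "algebraic_int b" for b
        using den_add_integer[OF that, of "g + d"] by (simp add: G0_def G_def add_ac)
    next
      fix g b :: 'k assume b: "algebraic_int b"
      show "g + b \<in> C0 \<longleftrightarrow> g \<in> C0"
        using den_add_integer[OF b, of "g + d"] coprime_add[OF b, of g] by (simp add: C0_def add_ac)
    next
      fix x and e K :: real assume x: "x \<in> space N" and e: "0 < e" and K: "1 \<le> K"
      let ?A = "{g\<in>C0. (\<forall>\<rho>\<in>S. cmod (x \<rho> - \<rho> g) \<le> (if \<rho> = \<rho>0 then K else 1) * G0 g \<rho>) \<and> e \<le> G0 g \<rho>0}"
      have "(\<lambda>g. g + d) ` ?A \<subseteq> {g. P (den g) \<and> (\<forall>\<rho>\<in>S. cmod ((x \<rho> + \<rho> d) - \<rho> g)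
          \<le> (if \<rho> = \<rho>0 then K else 1) * F (den g) \<rho>) \<and> e \<le> F (den g) \<rho>0}"
        by (auto simp: C0_def G0_def G_def emb_add)
      hence "finite ((\<lambda>g. g + d) ` ?A)"
      proof (rule finite_subset)
        show "finite {g. P (den g) \<and> (\<forall>\<rho>\<in>S. cmod ((x \<rho> + \<rho> d) - \<rho> g)
          \<le> (if \<rho> = \<rho>0 then K else 1) * F (den g) \<rho>) \<and> e \<le> F (den g) \<rho>0}"
          by (rule finite_large_radius[where P = P and F = F and ?\<rho>0.0 = \<rho>0, OF fin e])
      qed
      thus "finite ?A" by (subst (asm) finite_image_iff) (auto simp: inj_on_def)
    qed
    moreover have iff: "translate (emb d) x \<in> limsup_boxes (C d) G \<longleftrightarrow> x \<in> limsup_boxes C0 G0" if "x \<in> space N" for x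
      using that by (intro limsup_boxes_shift_iff) (auto simp: C0_def C_def G0_def)
    have shift: "AE x in N. Q x" if "AE x in N. Q (translate (emb d) x)" for Q
    proof -
      have "AE x in N. Q (translate (emb d) (translate (emb (- d)) x))"
        by (rule AE_translate[OF emb_in_W that])
      thus ?thesis using AE_space
      proof eventually_elim
        case (elim x)
        thus ?case using translate_emb_minus[OF elim(2), of "- d"] by simp
      qed
    qed
    have "AE x in N. x \<notin> limsup_boxes (C d) G" if "AE x in N. x \<notin> limsup_boxes C0 G0"
    proof (rule shift)
      show "AE x in N. translate (emb d) x \<notin> limsup_boxes (C d) G"
        using that AE_space by eventually_elim (simp only: iff, simp)
    qed
    moreover have "AE x in N. x \<in> limsup_boxes (C d) G" if "AE x in N. x \<in> limsup_boxes C0 G0"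
    proof (rule shift)
      show "AE x in N. translate (emb d) x \<in> limsup_boxes (C d) G"
        using that AE_space by eventually_elim (simp only: iff)
    qed
    ultimately show ?thesis unfolding zero_one_def by argo
  qed
  have finmax: "finite (maximal_ideals_over a)" by (rule finite_maximal_ideals_over[OF a])
  have "\<exists>D. finite D \<and> (\<forall>d\<in>D. algebraic_int (a ^ M * d)) \<and>
      {g. P (den g)} = (\<Union>d\<in>D. C d) \<union> (\<Union>q\<in>maximal_ideals_over a. J q M)" for M
  proof -
    have aM: "algebraic_int (a ^ M)" "a ^ M \<noteq> 0" using a by (auto intro: algebraic_int_power)
    obtain R where R: "finite R" "\<And>x. algebraic_int x \<Longrightarrow> \<exists>r\<in>R. \<exists>y. algebraic_int y \<and> x = r + a ^ M * y"
      using finite_residues[OF aM] by metis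
    \<comment> \<open>A shift matters only modulo the integers, and the elements that
      \<open>a ^ M\<close> makes integral fall into finitely many classes modulo the integers,
      represented here.\<close>
    define D where "D = (\<lambda>r. r / a ^ M) ` {r\<in>R. algebraic_int r}"
    have "g \<in> (\<Union>d\<in>D. C d) \<union> (\<Union>q\<in>maximal_ideals_over a. J q M)" if g: "P (den g)" for g
    proof (cases "den_coprime a (a ^ M * g)")
      case True
      then obtain g' d where gd: "g = g' + d" "algebraic_int (a ^ M * d)" "den_coprime a g'"
        using coprime_decomposition[OF a(1)] by metis
      obtain r y where ry: "r \<in> R" "algebraic_int y" "a ^ M * d = r + a ^ M * y" using R(2)[OF gd(2)] by blast
      have "r = a ^ M * d - a ^ M * y" using ry(3) by simp
      hence "algebraic_int r" using gd(2) algebraic_int_add_mult(2)[OF aM(1) ry(2)] by (simp add: algebraic_int_diff)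
      hence "r / a ^ M \<in> D" using ry(1) by (auto simp: D_def)
      moreover have "g - r / a ^ M = g' + y" using gd(1) ry(3) aM(2) by (simp add: field_simps)
      hence "g \<in> C (r / a ^ M)" using gd(3) coprime_add[OF ry(2), of g'] g by (simp add: C_def)
      ultimately show ?thesis by blast
    next
      case False
      then obtain q where "q \<in> maximal_ideals_over a" "den (a ^ M * g) \<subseteq> q"
        using den_coprime_or_maximal[OF a] by blast
      thus ?thesis using g by (auto simp: J_def)
    qed
    hence "{g. P (den g)} = (\<Union>d\<in>D. C d) \<union> (\<Union>q\<in>maximal_ideals_over a. J q M)"
      by (auto simp: C_def J_def)
    moreover have "finite D" using R(1) by (simp add: D_def)
    moreover have "algebraic_int (a ^ M * d)" if "d \<in> D" for d using that aM(2) by (auto simp: D_def)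
    ultimately show ?thesis by blast
  qed
  then obtain D where D: "\<And>M. finite (D M)" "\<And>M d. d \<in> D M \<Longrightarrow> algebraic_int (a ^ M * d)"
      "\<And>M. {g. P (den g)} = (\<Union>d\<in>D M. C d) \<union> (\<Union>q\<in>maximal_ideals_over a. J q M)" by metis
  have E_eq: "E = (\<Union>d\<in>D M. limsup_boxes (C d) G) \<union> (\<Union>q\<in>maximal_ideals_over a. limsup_boxes (J q M) G)" for M
    unfolding E_def D(3)[of M] limsup_boxes_Un limsup_boxes_UN[OF D(1)] limsup_boxes_UN[OF finmax] ..
  show ?thesis
  \<comment> \<open>The alternative concerns all levels at once: otherwise countably many coprime
    classes are null together, and almost every point of \<open>E\<close> is caught at some
    \<open>q\<close> on every level.\<close>
  proof (cases "\<exists>M. \<exists>d\<in>D M. AE x in N. x \<in> limsup_boxes (C d) G")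
    case True
    then obtain M d where "d \<in> D M" "AE x in N. x \<in> limsup_boxes (C d) G" by blast
    hence "AE x in N. x \<in> E" using E_eq[of M] by (auto elim!: eventually_mono)
    thus ?thesis by (simp add: zero_one_def E_def G_def)
  next
    case False
    hence "AE x in N. x \<notin> limsup_boxes (C d) G" if "d \<in> D M" for M d
      using zC[OF D(2)[OF that]] that by (auto simp: zero_one_def)
    hence "AE x in N. \<forall>d\<in>D M. x \<notin> limsup_boxes (C d) G" for M using D(1) by (simp add: AE_finite_all)
    hence null: "AE x in N. \<forall>M. \<forall>d\<in>D M. x \<notin> limsup_boxes (C d) G" by (subst AE_all_countable) blast
    have J_mono: "J q (M + i) \<subseteq> J q M" for q M i
      unfolding J_def using subset_trans[OF den_power_mono[OF a(1)]] by blast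
    have J_anti: "limsup_boxes (J q M') G \<subseteq> limsup_boxes (J q M) G" if "M \<le> M'" for q M M'
      using limsup_boxes_mono[OF J_mono[of q M "M' - M"], of G] that by simp
    define E' where "E' = (\<Union>q\<in>maximal_ideals_over a. \<Inter>M. limsup_boxes (J q M) G)"
    have "zero_one E'"
      unfolding E'_def J_def G_def using a by (intro zero_one_UN[OF finmax] zero_one_local_tail)
    moreover have "AE x in N. x \<in> E \<longleftrightarrow> x \<in> E'"
      using null
    proof eventually_elim
      case (elim x)
      show "x \<in> E \<longleftrightarrow> x \<in> E'"
      proof
        assume "x \<in> E'"
        thus "x \<in> E" unfolding E_eq[of 0] by (auto simp: E'_def)
      next
        assume "x \<in> E"
        hence all: "\<forall>M. \<exists>q\<in>maximal_ideals_over a. x \<in> limsup_boxes (J q M) G"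
          using E_eq elim by blast
        show "x \<in> E'"
        proof (rule ccontr)
          assume "x \<notin> E'"
          hence "\<forall>q\<in>maximal_ideals_over a. \<exists>M. x \<notin> limsup_boxes (J q M) G" by (auto simp: E'_def)
          then obtain m where m: "\<And>q. q \<in> maximal_ideals_over a \<Longrightarrow> x \<notin> limsup_boxes (J q (m q)) G" by metis
          \<comment> \<open>The prime may vary with the level. If each of the finitely many primes
            failed at its own level \<open>m q\<close>, all of them would fail at this common larger
            one.\<close>
          define M where "M = (\<Sum>q\<in>maximal_ideals_over a. m q)"
          obtain q where q: "q \<in> maximal_ideals_over a" "x \<in> limsup_boxes (J q M) G" using all by blast
          have "m q \<le> M" unfolding M_def using q(1) finmax by (intro member_le_sum) auto
          thus False using J_anti[of "m q" M q] q m by blast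
        qed
      qed
    qed
    ultimately have "zero_one E" by (rule zero_one_cong_AE[rotated])
    thus ?thesis by (simp add: E_def G_def)
  qed
qed

text \<open>
  Each denominator is assigned to a place at which its radius is minimal; the minimum tends
  to \<open>0\<close>, while the individual radii need not.
\<close>

lemma zero_one_good_approximation:
  assumes S: "S \<noteq> {}"
    and F: "\<And>I \<rho>. I \<in> integral_ideals \<Longrightarrow> \<rho> \<in> S \<Longrightarrow> 0 \<le> F I \<rho>"
    and fin: "\<And>e. 0 < e \<Longrightarrow> finite {I\<in>integral_ideals. \<forall>\<rho>\<in>S. e \<le> F I \<rho>}"
  shows "zero_one (limsup_boxes UNIV (\<lambda>g. F (den g)))"
proof -
  have "\<exists>\<rho>\<in>S. \<forall>\<sigma>\<in>S. F I \<rho> \<le> F I \<sigma>" for I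
    using ex_min_if_finite[of "F I ` S"] finite_places S by (auto simp: not_less)
  then obtain pl where pl: "\<And>I. pl I \<in> S" "\<And>I \<sigma>. \<sigma> \<in> S \<Longrightarrow> F I (pl I) \<le> F I \<sigma>" by metis
  have "zero_one (\<Union>\<rho>\<in>S. limsup_boxes {g. pl (den g) = \<rho>} (\<lambda>g. F (den g)))"
  proof (intro zero_one_UN finite_places zero_one_place[where P = "\<lambda>I. pl I = \<rho>" for \<rho>] F)
    fix \<rho> and e :: real assume \<rho>: "\<rho> \<in> S" and e: "0 < e"
    have "{I\<in>integral_ideals. pl I = \<rho> \<and> e \<le> F I \<rho>} \<subseteq> {I\<in>integral_ideals. \<forall>\<rho>\<in>S. e \<le> F I \<rho>}"
      using pl(2) by (auto intro: order_trans)
    thus "finite {I\<in>integral_ideals. pl I = \<rho> \<and> e \<le> F I \<rho>}" using fin[OF e] finite_subset by blast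
  qed
  moreover have "(\<Union>\<rho>\<in>S. {g. pl (den g) = \<rho>}) = UNIV" using pl(1) by auto
  ultimately show ?thesis by (simp flip: limsup_boxes_UN[OF finite_places])
qed

end

section \<open>Transport to Minkowski space\<close>

context number_field_places
begin

definition P :: "'k point measure" where
  "P = PiM (real_places S) (\<lambda>_. lborel) \<Otimes>\<^sub>M PiM (complex_places S) (\<lambda>_. lborel)"

lemma minkowski_lebesgue_eq: "minkowski_lebesgue S = completion P"
  by (simp add: minkowski_lebesgue_def P_def)

definition to_coords :: "'k point \<Rightarrow> ('k \<Rightarrow> complex) \<Rightarrow> complex" where
  "to_coords x = (\<lambda>\<rho>\<in>S. point_coord x \<rho>)"

definition of_coords :: "(('k \<Rightarrow> complex) \<Rightarrow> complex) \<Rightarrow> 'k point" where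
  "of_coords y = (\<lambda>\<rho>\<in>real_places S. Re (y \<rho>), \<lambda>\<rho>\<in>complex_places S. y \<rho>)"

lemma places_partition: "real_places S \<union> complex_places S = S" "real_places S \<inter> complex_places S = {}"
  by (auto simp: real_places_def complex_places_def)

lemma finite_real_complex_places: "finite (real_places S)" "finite (complex_places S)"
  using finite_places by (simp_all add: real_places_def complex_places_def)

lemma space_P: "space P = Pi\<^sub>E (real_places S) (\<lambda>_. UNIV) \<times> Pi\<^sub>E (complex_places S) (\<lambda>_. UNIV)"
  by (simp add: P_def space_pair_measure space_PiM)

lemma to_coords_in_space [simp]: "to_coords x \<in> space N"
  by (auto simp: to_coords_def space_N)

lemma of_to_coords:
  assumes "x \<in> space P"
  shows "of_coords (to_coords x) = x"
proof (rule prod_eqI)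
  have fst: "fst x \<in> Pi\<^sub>E (real_places S) (\<lambda>_. UNIV)" and snd: "snd x \<in> Pi\<^sub>E (complex_places S) (\<lambda>_. UNIV)"
    using assms by (auto simp: space_P)
  show "fst (of_coords (to_coords x)) = fst x"
  proof
    show "fst (of_coords (to_coords x)) \<rho> = fst x \<rho>" for \<rho>
      using PiE_arb[OF fst, of \<rho>] by (simp add: of_coords_def to_coords_def point_coord_def real_places_def)
  qed
  show "snd (of_coords (to_coords x)) = snd x"
  proof
    show "snd (of_coords (to_coords x)) \<rho> = snd x \<rho>" for \<rho>
      using PiE_arb[OF snd, of \<rho>] by (simp add: of_coords_def to_coords_def point_coord_def complex_places_def)
  qed
qed

lemma to_of_coords:
  assumes "y \<in> W"
  shows "to_coords (of_coords y) = y"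
proof
  show "to_coords (of_coords y) \<rho> = y \<rho>" for \<rho>
  proof (cases "\<rho> \<in> S")
    case True
    hence "real_embedding \<rho> \<Longrightarrow> y \<rho> \<in> \<real>" using assms by (auto simp: W_def place_field_def PiE_iff)
    thus ?thesis using True
      by (simp add: to_coords_def of_coords_def point_coord_def real_places_def complex_places_def of_real_Re)
  next
    case False
    thus ?thesis using PiE_arb[OF assms[unfolded W_def], of \<rho>] by (simp add: to_coords_def)
  qed
qed

lemma measurable_to_coords [measurable]: "to_coords \<in> P \<rightarrow>\<^sub>M N"
  unfolding to_coords_def
proof (rule measurable_N_I)
  fix \<rho> assume \<rho>: "\<rho> \<in> S"
  show "(\<lambda>x. point_coord x \<rho>) \<in> borel_measurable P"
  proof (cases "real_embedding \<rho>")
    case True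
    have "(\<lambda>x. fst x \<rho>) \<in> borel_measurable P"
      unfolding P_def using measurable_component_singleton[of \<rho> "real_places S" "\<lambda>_. lborel"] \<rho> True
      by (intro measurable_compose[OF measurable_fst]) (simp add: real_places_def cong: measurable_cong_sets)
    thus ?thesis using True by (simp add: point_coord_def)
  next
    case False
    have "(\<lambda>x. snd x \<rho>) \<in> borel_measurable P"
      unfolding P_def using measurable_component_singleton[of \<rho> "complex_places S" "\<lambda>_. lborel"] \<rho> False
      by (intro measurable_compose[OF measurable_snd]) (simp add: complex_places_def cong: measurable_cong_sets)
    thus ?thesis using False by (simp add: point_coord_def)
  qed
qed

lemma measurable_of_coords [measurable]: "of_coords \<in> N \<rightarrow>\<^sub>M P"
  unfolding of_coords_def P_def
proof (rule measurable_Pair; rule measurable_restrict)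
  show "(\<lambda>y. Re (y \<rho>)) \<in> N \<rightarrow>\<^sub>M lborel" if "\<rho> \<in> real_places S" for \<rho>
    using that measurable_compose[OF measurable_coord[of \<rho>] borel_measurable_Re]
    by (simp add: real_places_def cong: measurable_cong_sets)
  show "(\<lambda>y. y \<rho>) \<in> N \<rightarrow>\<^sub>M lborel" if "\<rho> \<in> complex_places S" for \<rho>
    using that measurable_coord[of \<rho>] by (simp add: complex_places_def cong: measurable_cong_sets)
qed

text \<open>On a rectangle the preimage is a product of a real and a complex rectangle; the real
  axis carries the measure of the line, so the factors agree place by place.\<close>

lemma distr_to_coords: "distr P N to_coords = N"
proof -
  interpret R: product_sigma_finite "\<lambda>_ :: 'k \<Rightarrow> complex. lborel :: real measure" by standard
  interpret C: product_sigma_finite "\<lambda>_ :: 'k \<Rightarrow> complex. lborel :: complex measure" by standard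
  interpret R': sigma_finite_measure "PiM (real_places S) (\<lambda>_. lborel :: real measure)"
    by (rule R.sigma_finite[OF finite_real_complex_places(1)])
  interpret C': sigma_finite_measure "PiM (complex_places S) (\<lambda>_. lborel :: complex measure)"
    by (rule C.sigma_finite[OF finite_real_complex_places(2)])
  have "distr P N to_coords = PiM S place_measure"
  proof (rule PiM_eqI[OF finite_places])
    show "sets (distr P N to_coords) = sets (PiM S place_measure)" by (simp add: N_def)
    fix A assume "\<And>\<rho>. \<rho> \<in> S \<Longrightarrow> A \<rho> \<in> sets (place_measure \<rho>)"
    hence A: "\<And>\<rho>. \<rho> \<in> S \<Longrightarrow> A \<rho> \<in> sets borel" by simp
    have Ar: "complex_of_real -` A \<rho> \<in> sets lborel" if "\<rho> \<in> real_places S" for \<rho>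
      using measurable_sets_borel[of complex_of_real borel "A \<rho>"] A[of \<rho>] that by (auto simp: real_places_def)
    have Ac: "A \<rho> \<in> sets lborel" if "\<rho> \<in> complex_places S" for \<rho>
      using A[of \<rho>] that by (auto simp: complex_places_def)
    have "emeasure (distr P N to_coords) (Pi\<^sub>E S A) = emeasure P (to_coords -` Pi\<^sub>E S A \<inter> space P)"
      using A by (intro emeasure_distr rect_in_sets) auto
    also have "to_coords -` Pi\<^sub>E S A \<inter> space P
        = Pi\<^sub>E (real_places S) (\<lambda>\<rho>. complex_of_real -` A \<rho>) \<times> Pi\<^sub>E (complex_places S) A"
    proof -
      have "(\<forall>\<rho>\<in>S. point_coord x \<rho> \<in> A \<rho>) \<longleftrightarrow>
          (\<forall>\<rho>\<in>real_places S. of_real (fst x \<rho>) \<in> A \<rho>) \<and> (\<forall>\<rho>\<in>complex_places S. snd x \<rho> \<in> A \<rho>)" for x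
        by (auto simp: point_coord_def real_places_def complex_places_def)
      thus ?thesis by (auto simp: to_coords_def space_P PiE_iff mem_Times_iff)
    qed
    also have "emeasure P \<dots> = emeasure (PiM (real_places S) (\<lambda>_. lborel)) (Pi\<^sub>E (real_places S) (\<lambda>\<rho>. complex_of_real -` A \<rho>))
        * emeasure (PiM (complex_places S) (\<lambda>_. lborel)) (Pi\<^sub>E (complex_places S) A)"
      unfolding P_def using Ar Ac
      by (intro C'.emeasure_pair_measure_Times sets_PiM_I_finite finite_real_complex_places) auto
    also have "\<dots> = (\<Prod>\<rho>\<in>real_places S. emeasure lborel (complex_of_real -` A \<rho>)) * (\<Prod>\<rho>\<in>complex_places S. emeasure lborel (A \<rho>))"
      using Ar Ac finite_real_complex_places by (subst R.emeasure_PiM, simp, simp, subst C.emeasure_PiM) auto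
    also have "(\<Prod>\<rho>\<in>real_places S. emeasure lborel (complex_of_real -` A \<rho>)) = (\<Prod>\<rho>\<in>real_places S. emeasure (place_measure \<rho>) (A \<rho>))"
      using A by (intro prod.cong refl) (auto simp: real_places_def emeasure_place_measure_real)
    also have "(\<Prod>\<rho>\<in>complex_places S. emeasure lborel (A \<rho>)) = (\<Prod>\<rho>\<in>complex_places S. emeasure (place_measure \<rho>) (A \<rho>))"
      by (intro prod.cong refl) (auto simp: complex_places_def place_measure_def)
    also have "(\<Prod>\<rho>\<in>real_places S. emeasure (place_measure \<rho>) (A \<rho>)) * (\<Prod>\<rho>\<in>complex_places S. emeasure (place_measure \<rho>) (A \<rho>))
        = (\<Prod>\<rho>\<in>S. emeasure (place_measure \<rho>) (A \<rho>))"
      using prod.union_disjoint[OF finite_real_complex_places places_partition(2), of "\<lambda>\<rho>. emeasure (place_measure \<rho>) (A \<rho>)"]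
      by (simp add: places_partition(1))
    finally show "emeasure (distr P N to_coords) (Pi\<^sub>E S A) = (\<Prod>\<rho>\<in>S. emeasure (place_measure \<rho>) (A \<rho>))" .
  qed
  thus ?thesis by (simp add: N_def)
qed

text \<open>Passing to coordinates and back is the identity on \<open>P\<close>, so
  almost-everywhere statements transfer in both directions.\<close>

lemma distr_of_coords: "distr N P of_coords = P"
proof -
  have "distr N P of_coords = distr (distr P N to_coords) P of_coords" by (simp add: distr_to_coords)
  also have "\<dots> = distr P P (of_coords \<circ> to_coords)" by (rule distr_distr) measurable
  also have "\<dots> = distr P P (\<lambda>x. x)" by (rule distr_cong) (auto simp: of_to_coords)
  finally show ?thesis by (simp add: distr_id)
qed

lemma AE_to_coords: "AE y in N. Q y \<Longrightarrow> AE x in P. Q (to_coords x)"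
  using AE_distrD[OF measurable_to_coords, of Q] by (simp only: distr_to_coords)

lemma AE_of_coords: "AE x in P. Q x \<Longrightarrow> AE y in N. Q (of_coords y)"
  using AE_distrD[OF measurable_of_coords, of Q] by (simp only: distr_of_coords)

lemma to_coords_point_add:
  "to_coords (point_add S (minkowski_emb S a) x) = translate (emb a) (to_coords x)"
proof
  have "\<rho> a = of_real (Re (\<rho> a))" if "real_embedding \<rho>" for \<rho> :: "'k \<Rightarrow> complex"
    using that by (auto simp: real_embedding_def image_subset_iff of_real_Re)
  thus "to_coords (point_add S (minkowski_emb S a) x) \<rho> = translate (emb a) (to_coords x) \<rho>" for \<rho>
    by (cases "real_embedding \<rho>")
      (simp_all add: to_coords_def translate_def emb_def point_add_def minkowski_emb_def
        point_coord_def real_places_def complex_places_def add.commute)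
qed

lemma point_add_of_coords:
  "point_add S (minkowski_emb S a) (of_coords y) = of_coords (translate (emb a) y)"
  by (auto simp: point_add_def minkowski_emb_def of_coords_def translate_def emb_def fun_eq_iff
      real_places_def complex_places_def)

text \<open>
  Infinitely many integers of bounded size would give infinitely many almost disjoint
  translates of a part of \<open>D\<close> of positive measure inside a box.
\<close>

lemma fundamental_domain_imp_discrete:
  assumes "fundamental_domain S D"
  shows "finite {a. algebraic_int a \<and> (\<forall>\<rho>\<in>S. cmod (\<rho> a) \<le> B)}"
proof -
  have D: "D \<in> sets (completion P)"
    "AE x in P. \<exists>a. algebraic_int a \<and> x \<in> point_add S (minkowski_emb S a) ` D"
    "\<And>a b. algebraic_int a \<Longrightarrow> algebraic_int b \<Longrightarrow> a \<noteq> b \<Longrightarrow>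
      point_add S (minkowski_emb S a) ` D \<inter> point_add S (minkowski_emb S b) ` D \<in> null_sets (completion P)"
    using assms[unfolded fundamental_domain_def minkowski_lebesgue_eq AE_completion_iff
        carrier_ring_of_integers Bex_def Ball_def mem_Collect_eq] by blast+
  \<comment> \<open>The domain is only measurable for the completion; its Borel part
    \<open>D0\<close> is what can be pulled back to coordinates.\<close>
  obtain D0 Z Z' where D0: "D = D0 \<union> Z" "Z \<subseteq> Z'" "Z' \<in> null_sets P" "D0 \<in> sets P"
    using D(1) by (rule sets_completionE)
  define D' where "D' = of_coords -` D0 \<inter> space N"
  have D'_sets [measurable]: "D' \<in> sets N" unfolding D'_def using D0(4) by measurable
  have D_space: "D \<subseteq> space P" using sets.sets_into_space[OF D(1)] by simp
  have cancel: "translate (emb a) (translate (emb (- a)) y) = y" if "y \<in> space N" for a y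
    using translate_emb_minus[OF that, of "- a"] by simp
  have covered: "x \<in> point_add S (minkowski_emb S a) ` E \<Longrightarrow> x = of_coords y \<Longrightarrow> y \<in> W \<Longrightarrow> E \<subseteq> space P \<Longrightarrow>
      of_coords (translate (emb (- a)) y) \<in> E" for x y a E
  proof -
    assume "x \<in> point_add S (minkowski_emb S a) ` E" and x: "x = of_coords y" and y: "y \<in> W" and E: "E \<subseteq> space P"
    then obtain d where d: "d \<in> E" "x = point_add S (minkowski_emb S a) d" by blast
    have "y = to_coords x" using to_of_coords[OF y] x by simp
    also have "\<dots> = translate (emb a) (to_coords d)" unfolding d(2) by (rule to_coords_point_add)
    finally have "translate (emb (- a)) y = to_coords d" using translate_emb_minus[OF to_coords_in_space] by simp
    thus "of_coords (translate (emb (- a)) y) \<in> E" using of_to_coords[of d] d(1) E by auto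
  qed
  \<comment> \<open>If \<open>D'\<close> were null, so would be its countably many integral
    translates, although the translates of \<open>D\<close> cover almost everything.\<close>
  have pos: "emeasure N D' \<noteq> 0"
  proof
    assume "emeasure N D' = 0"
    hence "AE y in N. y \<notin> D'" by (intro AE_not_in null_setsI) auto
    moreover have "AE y in N. of_coords y \<notin> Z'" by (rule AE_of_coords[OF AE_not_in[OF D0(3)]])
    ultimately have "AE y in N. of_coords y \<notin> D"
      using AE_space by eventually_elim (use D0(1,2) in \<open>auto simp: D'_def\<close>)
    hence "AE y in N. of_coords (translate (emb (- a)) y) \<notin> D" for a
      by (rule AE_translate[OF emb_in_W])
    hence "AE y in N. \<forall>a\<in>{a. algebraic_int a}. of_coords (translate (emb (- a)) y) \<notin> D"
      using number_field_countable[OF number_field]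
      by (subst AE_ball_countable) (auto intro: countable_subset[rotated])
    moreover have "AE y in N. \<exists>a. algebraic_int a \<and> of_coords y \<in> point_add S (minkowski_emb S a) ` D"
      by (rule AE_of_coords[OF D(2)])
    ultimately have "AE y in N. False"
      using AE_in_W by eventually_elim (use covered D_space in blast)
    hence "emeasure N (space N) = 0" by (simp add: AE_iff_measurable[of "space N"])
    moreover have "emeasure N (centred_box (\<lambda>_. 1)) \<le> emeasure N (space N)" by (rule emeasure_space)
    ultimately show False using emeasure_centred_box_pos[of "\<lambda>_. 1"] by simp
  qed
  then obtain n :: nat where n: "emeasure N (D' \<inter> centred_box (\<lambda>_. real n)) \<noteq> 0"
    using emeasure_centred_box_Int_pos[OF D'_sets] by blast
  define Q where "Q = D' \<inter> centred_box (\<lambda>_. real n)"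
  define X where "X a = translate (emb (- a)) -` Q \<inter> space N" for a
  have [measurable]: "Q \<in> sets N" by (simp add: Q_def)
  have X_sets: "X a \<in> sets N" for a unfolding X_def by measurable
  let ?B = "centred_box (\<lambda>_. real n + B)"
  have X_sub: "X a \<subseteq> ?B" if a: "\<forall>\<rho>\<in>S. cmod (\<rho> a) \<le> B" for a
  proof
    fix y assume y: "y \<in> X a"
    have "cmod (y \<rho>) \<le> real n + B" if \<rho>: "\<rho> \<in> S" for \<rho>
    proof -
      have "cmod (y \<rho> - \<rho> a) \<le> real n"
        using y \<rho> by (auto simp: X_def Q_def centred_box_def translate_def emb_def PiE_iff embedding_minus[OF embedding])
      moreover have "cmod (y \<rho>) \<le> cmod (y \<rho> - \<rho> a) + cmod (\<rho> a)"
        using norm_triangle_ineq[of "y \<rho> - \<rho> a" "\<rho> a"] by simp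
      ultimately show ?thesis using a \<rho> by fastforce
    qed
    thus "y \<in> ?B" using y by (auto simp: X_def centred_box_def space_N PiE_iff)
  qed
  have fin: "emeasure N A \<noteq> \<infinity>" if "A \<subseteq> ?B" for A
  proof -
    have "emeasure N A \<le> emeasure N ?B" using that by (rule emeasure_mono) simp
    thus ?thesis using emeasure_centred_box_finite[of "\<lambda>_. real n + B"] by (auto simp: top_unique)
  qed
  have X_meas: "measure N (X a) = measure N Q" for a
    unfolding X_def measure_def by (subst emeasure_translate[OF emb_in_W]) auto
  have disj: "AE y in N. y \<notin> X a \<or> y \<notin> X b" if "algebraic_int a" "algebraic_int b" "a \<noteq> b" for a b
  proof -
    have "AE x in P. x \<notin> point_add S (minkowski_emb S a) ` D \<inter> point_add S (minkowski_emb S b) ` D"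
      using AE_not_in[OF D(3)[OF that]] by (simp only: AE_completion_iff)
    hence "AE y in N. of_coords y \<notin> point_add S (minkowski_emb S a) ` D \<inter> point_add S (minkowski_emb S b) ` D"
      by (rule AE_of_coords)
    thus ?thesis
      using AE_space
    proof eventually_elim
      case (elim y)
      have "of_coords y \<in> point_add S (minkowski_emb S c) ` D" if "y \<in> X c" for c
      proof (rule image_eqI)
        show "of_coords y = point_add S (minkowski_emb S c) (of_coords (translate (emb (- c)) y))"
          unfolding point_add_of_coords cancel[OF elim(2)] ..
        show "of_coords (translate (emb (- c)) y) \<in> D"
          using that D0(1) by (auto simp: X_def Q_def D'_def)
      qed
      thus ?case using elim(1) by blast
    qed
  qed
  have Qpos: "0 < measure N Q"
  proof -
    have "emeasure N Q \<le> emeasure N (centred_box (\<lambda>_. real n))" unfolding Q_def by (rule emeasure_mono) auto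
    hence "emeasure N Q \<noteq> \<infinity>" using emeasure_centred_box_finite[of "\<lambda>_. real n"] by (auto simp: top_unique)
    thus ?thesis using n by (simp add: Q_def measure_def enn2real_positive_iff zero_less_iff_neq_zero less_top)
  qed
  show ?thesis
  proof (rule ccontr)
    assume inf: "infinite {a. algebraic_int a \<and> (\<forall>\<rho>\<in>S. cmod (\<rho> a) \<le> B)}"
    \<comment> \<open>More almost disjoint translates of \<open>Q\<close> than the measure of the
      common box can accommodate.\<close>
    obtain k :: nat where k: "measure N ?B < real k * measure N Q"
      using Qpos reals_Archimedean3 by blast
    obtain F where F: "F \<subseteq> {a. algebraic_int a \<and> (\<forall>\<rho>\<in>S. cmod (\<rho> a) \<le> B)}" "finite F" "card F = k"
      using infinite_arbitrarily_large[OF inf] by blast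
    have "measure N (\<Union>a\<in>F. X a) = (\<Sum>a\<in>F. measure N (X a))"
    proof (rule measure_UNION_AE[OF F(2)])
      show "X a \<in> fmeasurable N" if "a \<in> F" for a
        using that F(1) X_sub[of a] fin[of "X a"] X_sets by (intro fmeasurableI) (auto simp: less_top)
      show "pairwise (\<lambda>a b. AE y in N. y \<notin> X a \<or> y \<notin> X b) F"
        using disj F(1) by (auto simp: pairwise_def)
    qed
    also have "\<dots> = real k * measure N Q" by (simp add: X_meas F(3))
    finally have "real k * measure N Q = measure N (\<Union>a\<in>F. X a)" ..
    also have "\<dots> \<le> measure N ?B"
      unfolding measure_def
    proof (intro enn2real_mono emeasure_mono)
      show "(\<Union>a\<in>F. X a) \<subseteq> ?B" using X_sub F(1) by blast
    qed (use fin[of ?B] in \<open>auto simp: less_top\<close>)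
    finally show False using k by simp
  qed
qed

end

theorem theorem2p1:
  fixes S :: "('k::field_char_0 \<Rightarrow> complex) set"
    and D :: "'k point set"
    and \<psi> :: "('k \<Rightarrow> complex) \<Rightarrow> 'k set \<Rightarrow> real"
  assumes "number_field TYPE('k)"
    and "place_reps S"
    and "fundamental_domain S D"
    and "\<And>\<rho> \<nn>. \<rho> \<in> S \<Longrightarrow> \<nn> \<in> integral_ideals \<Longrightarrow> \<psi> \<rho> \<nn> \<ge> 0"
    and "(psi_prod S \<psi> \<longlongrightarrow> 0) (ideal_norm going_to at_top within integral_ideals)"
  shows "approximable_set S \<psi> D \<in> sets (minkowski_lebesgue S) \<and>
         (emeasure (minkowski_lebesgue S) (approximable_set S \<psi> D) = 0 \<or>
          emeasure (minkowski_lebesgue S) (approximable_set S \<psi> D) =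
            emeasure (minkowski_lebesgue S) D)"
proof -
  interpret number_field_places S by standard fact+
  interpret discrete_places S
    by standard (rule fundamental_domain_imp_discrete[OF assms(3)])
  have D: "D \<in> sets (completion P)" using assms(3) by (simp add: fundamental_domain_def minkowski_lebesgue_eq)
  \<comment> \<open>At a complex place \<open>place_abs\<close> is the squared modulus, so the
    radius measured by \<open>cmod\<close> is a square root.\<close>
  define w where "w I \<rho> = (if real_embedding \<rho> then \<psi> \<rho> I else sqrt (\<psi> \<rho> I))" for I \<rho>
  define E where "E = limsup_boxes UNIV (\<lambda>g. w (den g))"
  have good: "good_approximation S \<psi> x g \<longleftrightarrow> (\<forall>\<rho>\<in>S. cmod (to_coords x \<rho> - \<rho> g) \<le> w (den g) \<rho>)" for x g
  proof -
    have "place_abs \<rho> z \<le> \<psi> \<rho> (den g) \<longleftrightarrow> cmod z \<le> w (den g) \<rho>" if "\<rho> \<in> S" for \<rho> z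
      using real_sqrt_le_iff[of "(cmod z)\<^sup>2" "\<psi> \<rho> (den g)"]
      by (simp add: place_abs_def w_def)
    thus ?thesis unfolding good_approximation_def dnm_eq_den[OF assms(1)] by (simp add: to_coords_def)
  qed
  have approx: "approximable_set S \<psi> D = D \<inter> (to_coords -` E \<inter> space P)"
    using sets.sets_into_space[OF D]
    by (auto simp: approximable_set_def good E_def limsup_boxes_def)
  have "to_coords -` E \<inter> space P \<in> sets P" unfolding E_def by measurable
  hence sets: "approximable_set S \<psi> D \<in> sets (completion P)" unfolding approx using D by auto
  have "zero_one E"
  \<comment> \<open>An empty product is a single point, for which every subset is empty or the whole
    space; minimal radii are available only for nonempty \<open>S\<close>.\<close>
  proof (cases "S = {}")
    case True
    have "space N = {\<lambda>_. undefined}" unfolding space_N using True by simp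
    moreover have "E \<subseteq> space N" unfolding E_def by (rule sets.sets_into_space[OF limsup_boxes_sets])
    ultimately have "E = {} \<or> E = space N" by (simp add: subset_singleton_iff)
    thus ?thesis by (auto simp: zero_one_def)
  next
    case False
    show ?thesis
      unfolding E_def
    proof (rule zero_one_good_approximation[OF False])
      show "0 \<le> w I \<rho>" if "I \<in> integral_ideals" "\<rho> \<in> S" for I \<rho>
        using assms(4)[OF that(2,1)] by (simp add: w_def)
      fix e :: real assume e: "0 < e"
      \<comment> \<open>If all radii \<open>w\<close> are at least \<open>e\<close>, a real place
        contributes at least \<open>e\<close> to \<open>psi_prod\<close>. At a complex place
        \<open>\<psi>\<close> is at least \<open>e\<close> squared and enters
        \<open>psi_prod\<close> as a square, whence the fourth power.\<close>
      define \<delta> where "\<delta> = e ^ card (real_places S) * ((e\<^sup>2)\<^sup>2) ^ card (complex_places S)"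
      have "\<delta> > 0" using e by (simp add: \<delta>_def)
      hence "eventually (\<lambda>I. psi_prod S \<psi> I < \<delta>) (ideal_norm going_to at_top within integral_ideals)"
        using assms(5) by (rule order_tendstoD(2)[rotated])
      then obtain m where m: "\<And>I. m \<le> ideal_norm I \<Longrightarrow> I \<in> integral_ideals \<Longrightarrow> psi_prod S \<psi> I < \<delta>"
        unfolding going_to_within_def eventually_inf_principal eventually_filtercomap_at_top_linorder by blast
      have "\<delta> \<le> psi_prod S \<psi> I" if I: "I \<in> integral_ideals" "\<forall>\<rho>\<in>S. e \<le> w I \<rho>" for I
      proof -
        have "e \<le> \<psi> \<rho> I" if "\<rho> \<in> real_places S" for \<rho>
          using I(2) that by (auto simp: real_places_def w_def)
        hence "(\<Prod>\<rho>\<in>real_places S. e) \<le> (\<Prod>\<rho>\<in>real_places S. \<psi> \<rho> I)"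
          using e by (intro prod_mono) auto
        moreover have "(e\<^sup>2)\<^sup>2 \<le> (\<psi> \<rho> I)\<^sup>2" if "\<rho> \<in> complex_places S" for \<rho>
        proof -
          have "e \<le> sqrt (\<psi> \<rho> I)" using I(2) that by (auto simp: complex_places_def w_def)
          hence "e\<^sup>2 \<le> (sqrt (\<psi> \<rho> I))\<^sup>2" using e by (intro power_mono) auto
          also have "\<dots> = \<psi> \<rho> I" using assms(4)[OF _ I(1), of \<rho>] that by (simp add: complex_places_def)
          finally show ?thesis using e by (intro power_mono) auto
        qed
        hence "(\<Prod>\<rho>\<in>complex_places S. (e\<^sup>2)\<^sup>2) \<le> (\<Prod>\<rho>\<in>complex_places S. (\<psi> \<rho> I)\<^sup>2)"
          by (intro prod_mono) auto
        ultimately show ?thesis unfolding \<delta>_def psi_prod_def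
          using e by (simp only: prod_constant) (intro mult_mono; auto intro!: prod_nonneg assms(4)[OF _ I(1)] simp: real_places_def)
      qed
      hence "{I\<in>integral_ideals. \<forall>\<rho>\<in>S. e \<le> w I \<rho>} \<subseteq> {I. I \<in> integral_ideals \<and> ideal_norm I < m}"
        using m by (force simp: not_less[symmetric])
      thus "finite {I\<in>integral_ideals. \<forall>\<rho>\<in>S. e \<le> w I \<rho>}" by (rule finite_subset[OF _ finite_small_norm])
    qed
  qed
  hence "(AE x in P. to_coords x \<notin> E) \<or> (AE x in P. to_coords x \<in> E)"
    unfolding zero_one_def using AE_to_coords by blast
  hence "emeasure (completion P) (approximable_set S \<psi> D) = 0 \<or>
      emeasure (completion P) (approximable_set S \<psi> D) = emeasure (completion P) D"
  proof
    assume "AE x in P. to_coords x \<notin> E"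
    hence "AE x in completion P. x \<in> approximable_set S \<psi> D \<longleftrightarrow> x \<in> {}"
      unfolding AE_completion_iff approx by eventually_elim auto
    hence "emeasure (completion P) (approximable_set S \<psi> D) = emeasure (completion P) {}"
      using sets by (intro emeasure_eq_AE) auto
    thus ?thesis by simp
  next
    assume "AE x in P. to_coords x \<in> E"
    hence "AE x in completion P. x \<in> approximable_set S \<psi> D \<longleftrightarrow> x \<in> D"
      unfolding AE_completion_iff approx using AE_space by eventually_elim auto
    hence "emeasure (completion P) (approximable_set S \<psi> D) = emeasure (completion P) D"
      using sets D by (intro emeasure_eq_AE) auto
    thus ?thesis by simp
  qed
  thus ?thesis using sets by (simp add: minkowski_lebesgue_eq)
qed

end
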